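(* Let $m>0$ and $\alpha>0$, let $\psi$ and $\phi$ be entire functions on $\mathbb C$ such that $C_{\psi,\phi}$ is bounded on $F^2_{\alpha,m}(\mathbb C)$, and suppose $\phi$ is non-constant. Then $$\|C_{\psi,\phi}\|_e^2\asymp\limsup_{|z|\to\infty}|\psi(z)|^2e^{\alpha(|\phi(z)|^m-|z|^m)},$$ that is, there are constants $c_1,c_2>0$, which may depend on $\alpha$, $m$ and $\phi$ but not on $\psi$, such that $$c_1\limsup_{|z|\to\infty}|\psi(z)|^2e^{\alpha(|\phi(z)|^m-|z|^m)}\le\|C_{\psi,\phi}\|_e^2\le c_2\limsup_{|z|\to\infty}|\psi(z)|^2e^{\alpha(|\phi(z)|^m-|z|^m)}.$$
   Context: For $m>0$ and $\alpha>0$, the weighted Fock space $F^2_{\alpha,m}(\mathbb C)$ is the Hilbert space of all entire functions on $\mathbb C$ that are square integrable with respect to the measure $d\mu_{\alpha,m}(z)=\frac{m\alpha^{2/m}}{2\pi\Gamma(2/m)}e^{-\alpha|z|^m}\,dA(z)$, where $dA$ is Lebesgue measure on $\mathbb C$ and $\Gamma$ is the Euler gamma function; its inner product is $\langle f,g\rangle_{\alpha,m}=\int_{\mathbb C} f\overline{g}\,d\mu_{\alpha,m}$ and its norm is $\|\cdot\|_{\alpha,m}$. For entire functions $\psi$ and $\phi$, the weighted composition operator is $C_{\psi,\phi}f=\psi\cdot(f\circ\phi)$. Saying that it is bounded on $F^2_{\alpha,m}(\mathbb C)$ means that it maps $F^2_{\alpha,m}(\mathbb C)$ into itself and is a bounded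 linear operator there. The essential norm of a bounded linear operator $T$ on $F^2_{\alpha,m}(\mathbb C)$ is $\|T\|_e=\inf\{\|T-K\|: K\text{ is a compact operator on }F^2_{\alpha,m}(\mathbb C)\}$. *)

theory Defs
  imports "HOL-Complex_Analysis.Complex_Analysis"
begin

definition fock_measure :: "real \<Rightarrow> real \<Rightarrow> complex measure" where
  "fock_measure \<alpha> m = density lborel (\<lambda>z. ennreal
     (m * \<alpha> powr (2 / m) / (2 * pi * Gamma (2 / m)) * exp (- \<alpha> * cmod z powr m)))"

definition fock_space :: "real \<Rightarrow> real \<Rightarrow> (complex \<Rightarrow> complex) set" where
  "fock_space \<alpha> m = {f. f holomorphic_on UNIV \<and>
     integrable (fock_measure \<alpha> m) (\<lambda>z. (cmod (f z))\<^sup>2)}"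

definition fock_norm :: "real \<Rightarrow> real \<Rightarrow> (complex \<Rightarrow> complex) \<Rightarrow> real" where
  "fock_norm \<alpha> m f = sqrt (\<integral>z. (cmod (f z))\<^sup>2 \<partial>fock_measure \<alpha> m)"

(* Operators on the Fock space are total functions on "complex \<Rightarrow> complex"; only
   their values on fock_space are ever constrained or used. *)

type_synonym fock_operator = "(complex \<Rightarrow> complex) \<Rightarrow> (complex \<Rightarrow> complex)"

definition fock_linear :: "real \<Rightarrow> real \<Rightarrow> fock_operator \<Rightarrow> bool" where
  "fock_linear \<alpha> m T \<longleftrightarrow>
     (\<forall>f\<in>fock_space \<alpha> m. T f \<in> fock_space \<alpha> m) \<and>
     (\<forall>f\<in>fock_space \<alpha> m. \<forall>g\<in>fock_space \<alpha> m. \<forall>a b.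
        T (\<lambda>z. a * f z + b * g z) = (\<lambda>z. a * T f z + b * T g z))"

definition fock_bounded :: "real \<Rightarrow> real \<Rightarrow> fock_operator \<Rightarrow> bool" where
  "fock_bounded \<alpha> m T \<longleftrightarrow> fock_linear \<alpha> m T \<and>
     (\<exists>C. \<forall>f\<in>fock_space \<alpha> m. fock_norm \<alpha> m (T f) \<le> C * fock_norm \<alpha> m f)"

definition fock_compact :: "real \<Rightarrow> real \<Rightarrow> fock_operator \<Rightarrow> bool" where
  "fock_compact \<alpha> m K \<longleftrightarrow> fock_linear \<alpha> m K \<and>
     (\<forall>F :: nat \<Rightarrow> complex \<Rightarrow> complex.
        (\<forall>n. F n \<in> fock_space \<alpha> m \<and> fock_norm \<alpha> m (F n) \<le> 1) \<longrightarrow>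
        (\<exists>g\<in>fock_space \<alpha> m. \<exists>r :: nat \<Rightarrow> nat. strict_mono r \<and>
           (\<lambda>n. fock_norm \<alpha> m (\<lambda>z. K (F (r n)) z - g z)) \<longlonglongrightarrow> 0))"

(* The supremum and infimum below are taken in the reals. They are the intended
   ones when T is bounded: K is then bounded too, so the set of values of the norm
   is bounded above, and the infimum is over a nonempty set (K = 0) of
   nonnegative numbers. *)

definition fock_onorm :: "real \<Rightarrow> real \<Rightarrow> fock_operator \<Rightarrow> real" where
  "fock_onorm \<alpha> m T =
     (SUP f\<in>{f \<in> fock_space \<alpha> m. fock_norm \<alpha> m f \<le> 1}. fock_norm \<alpha> m (T f))"

definition fock_ess_norm :: "real \<Rightarrow> real \<Rightarrow> fock_operator \<Rightarrow> real" where
  "fock_ess_norm \<alpha> m T =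
     (INF K\<in>{K. fock_compact \<alpha> m K}. fock_onorm \<alpha> m (\<lambda>f z. T f z - K f z))"

definition weighted_comp :: "(complex \<Rightarrow> complex) \<Rightarrow> (complex \<Rightarrow> complex) \<Rightarrow> fock_operator" where
  "weighted_comp \<psi> \<phi> f = (\<lambda>z. \<psi> z * f (\<phi> z))"

(* Extended-real valued, so that the limes superior is meaningful without knowing
   beforehand that the function is bounded near infinity. *)

definition fock_limsup ::
  "real \<Rightarrow> real \<Rightarrow> (complex \<Rightarrow> complex) \<Rightarrow> (complex \<Rightarrow> complex) \<Rightarrow> ereal" where
  "fock_limsup \<alpha> m \<psi> \<phi> = Limsup at_infinity (\<lambda>z. ereal
     ((cmod (\<psi> z))\<^sup>2 * exp (\<alpha> * (cmod (\<phi> z) powr m - cmod z powr m))))"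

end

theory Submission
  imports Defs "HOL-Real_Asymp.Real_Asymp"
begin

text \<open>
  Why the theorem is true. The Fock space is a weighted sequence space: because the measure is
  radial, \<open>\<parallel>f\<parallel>\<^sup>2 = \<Sum>n. \<bar>a n\<bar>\<^sup>2 * \<omega> n\<close> for \<open>f z = \<Sum>n. a n * z ^ n\<close>, where \<open>\<omega> n\<close> is the squared norm
  of the monomial \<open>z ^ n\<close>, a quotient of Gamma values (\<open>Parseval_fock\<close>). Hence point evaluations
  satisfy \<open>\<bar>f z\<bar>\<^sup>2 \<le> K \<bar>z\<bar> * \<parallel>f\<parallel>\<^sup>2\<close> with \<open>K r = \<Sum>n. r ^ (2 * n) / \<omega> n\<close>, and everything depends
  on the size of \<open>K\<close>: up to constants it is, for large \<open>r\<close>, \<open>r powr (m - 2) * exp (\<alpha> * r powr m)\<close>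
  (\<open>fock_kernel_asymp\<close>).

  If \<open>\<psi>\<close> is not identically zero, boundedness forces \<open>\<phi>\<close> to be affine. Indeed, suppose that \<open>\<phi>\<close>
  takes a value \<open>w\<close> at two points and apply the operator to \<open>(u - w) ^ n\<close>. The image vanishes to
  order \<open>n\<close> at both points, so after dividing by these zeros the maximum principle on the circle of
  radius \<open>n powr (1 / m)\<close> gains a factor of size \<open>n powr (- 2 * n / m)\<close>, while the norm of
  \<open>(u - w) ^ n\<close> grows only like \<open>n powr (n / m)\<close> and all other factors are at most geometric in \<open>n\<close>;
  this is impossible for large \<open>n\<close>. So \<open>\<phi>\<close> is
  injective (\<open>bounded_weighted_comp_imp_inj\<close>), and injective entire functions are affine by
  the great Picard theorem. If \<open>\<psi>\<close> vanishes identically, both sides of the estimate are zero.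

  For \<open>\<phi> z = a * z + b\<close> with \<open>a \<noteq> 0\<close> the factors \<open>r powr (m - 2)\<close> of \<open>K\<close> at \<open>z\<close> and at \<open>\<phi> z\<close> are comparable.
  The lower bound tests the operator on normalised reproducing kernels at points \<open>\<phi> z\<close> with \<open>z\<close> far
  out, truncated to pairwise disjoint blocks of degrees. The truncations keep a fixed part of the
  kernel and are orthonormal, and a compact operator sends a subsequence of them to zero in norm
  (\<open>ess_norm_ge_blocks\<close>, \<open>ess_norm_lower_bound\<close>). For the upper bound the Taylor polynomials of degree
  below \<open>M\<close> give a finite rank operator, and what is left acts on Taylor remainders: these are
  uniformly small on discs, and outside a large disc the weight is at most the limes superior plus
  an arbitrarily small number, so the affine substitution \<open>w = \<phi> z\<close> finishes the estimate
  (\<open>ess_norm_upper_bound\<close>).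
\<close>

section \<open>Translation invariant measures and affine substitution in the plane\<close>

text \<open>Uniqueness of Haar measure. The double integral of
\<open>indicator A (x + y) * indicator B y\<close>, with \<open>B\<close> the unit ball, is evaluated in both orders by
Fubini; translation invariance and the symmetry of \<open>B\<close> give the two sides.\<close>

lemma translation_invariant_proportional_lborel:
  fixes N :: "'a::euclidean_space measure"
  assumes [measurable_cong]: "sets N = sets borel"
    and sf: "sigma_finite_measure N"
    and inv: "\<And>c. distr N borel ((+) c) = N"
    and A[measurable]: "A \<in> sets borel"
  shows "emeasure N A * emeasure lborel (ball (0::'a) 1)
       = emeasure lborel A * emeasure N (ball (0::'a) 1)"
proof -
  interpret N: sigma_finite_measure N by (rule sf)
  interpret P: pair_sigma_finite N "lborel :: 'a measure" ..
  define B where "B = ball (0::'a) 1"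
  have B[measurable]: "B \<in> sets borel" by (simp add: B_def)
  have sym: "indicator B (- x) = (indicator B x :: ennreal)" for x
    by (simp add: B_def indicator_def)
  have trN: "(\<integral>\<^sup>+x. f (c + x) \<partial>N) = (\<integral>\<^sup>+x. f x \<partial>N)" if [measurable]: "f \<in> borel_measurable borel" for f c
    by (subst (2) inv[of c, symmetric]) (subst nn_integral_distr, auto)
  have trL: "(\<integral>\<^sup>+x. f (c + x) \<partial>lborel) = (\<integral>\<^sup>+x. f x \<partial>lborel)"
    if [measurable]: "f \<in> borel_measurable borel" for f :: "'a \<Rightarrow> ennreal" and c
    by (subst (2) lborel_distr_plus[of c, symmetric]) (subst nn_integral_distr, auto)
  have "emeasure N A * emeasure lborel B
      = (\<integral>\<^sup>+y. (\<integral>\<^sup>+x. indicator A x \<partial>N) * indicator B y \<partial>lborel)"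
    by (simp add: nn_integral_cmult)
  also have "\<dots> = (\<integral>\<^sup>+y. (\<integral>\<^sup>+x. indicator A (y + x) \<partial>N) * indicator B y \<partial>lborel)"
    by (subst trN) auto
  also have "\<dots> = (\<integral>\<^sup>+y. (\<integral>\<^sup>+x. indicator A (y + x) * indicator B y \<partial>N) \<partial>lborel)"
    by (intro nn_integral_cong nn_integral_multc[symmetric]) measurable
  also have "\<dots> = (\<integral>\<^sup>+x. (\<integral>\<^sup>+y. indicator A (y + x) * indicator B y \<partial>lborel) \<partial>N)"
    by (rule P.Fubini') measurable
  also have "\<dots> = (\<integral>\<^sup>+x. (\<integral>\<^sup>+y. indicator A (x + y) * indicator B (- x + (x + y)) \<partial>lborel) \<partial>N)"
    by (simp add: add.commute)
  also have "\<dots> = (\<integral>\<^sup>+x. (\<integral>\<^sup>+y. indicator A y * indicator B (- x + y) \<partial>lborel) \<partial>N)"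
    by (intro nn_integral_cong trL[of "\<lambda>y. indicator A y * indicator B (- x + y)" for x]) measurable
  also have "\<dots> = (\<integral>\<^sup>+y. (\<integral>\<^sup>+x. indicator A y * indicator B (- x + y) \<partial>N) \<partial>lborel)"
    by (rule P.Fubini'[symmetric]) measurable
  also have "\<dots> = (\<integral>\<^sup>+y. indicator A y * (\<integral>\<^sup>+x. indicator B (- y + x) \<partial>N) \<partial>lborel)"
  proof (intro nn_integral_cong)
    fix y
    have "indicator B (- x + y) = (indicator B (- y + x) :: ennreal)" for x
      using sym[of "- x + y"] by (simp add: add.commute)
    then show "(\<integral>\<^sup>+x. indicator A y * indicator B (- x + y) \<partial>N) = indicator A y * (\<integral>\<^sup>+x. indicator B (- y + x) \<partial>N)"
      by (simp add: nn_integral_cmult)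
  qed
  also have "\<dots> = emeasure lborel A * emeasure N B"
    by (subst trN) (auto simp: nn_integral_multc)
  finally show ?thesis by (simp add: B_def)
qed

text \<open>The image of Lebesgue measure under multiplication by \<open>a\<close> is again translation invariant, so it is
a multiple of Lebesgue measure; the factor is read off from the unit ball. The case
\<open>cmod a = 1\<close> is the rotation invariance used for the Parseval identity.\<close>

lemma nn_integral_lborel_complex_mult:
  fixes a :: complex and f :: "complex \<Rightarrow> ennreal"
  assumes a: "a \<noteq> 0" and f[measurable]: "f \<in> borel_measurable borel"
  shows "(\<integral>\<^sup>+z. f (a * z) \<partial>lborel) = ennreal (1 / (cmod a)\<^sup>2) * (\<integral>\<^sup>+z. f z \<partial>lborel)"
proof -
  define N where "N = distr lborel borel (\<lambda>z. a * z)"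
  have [measurable_cong]: "sets N = sets borel" by (simp add: N_def)
  have ball: "emeasure N (ball 0 r) = ennreal (pi * (r / cmod a)\<^sup>2)" if "r \<ge> 0" for r
  proof -
    have "(\<lambda>z. a * z) -` ball 0 r = ball 0 (r / cmod a)"
      using a by (auto simp: norm_mult field_simps)
    then show ?thesis using that
      by (simp add: N_def emeasure_distr emeasure_ball unit_ball_vol_2)
  qed
  have "sigma_finite_measure N"
  proof (rule sigma_finite_measure.intro, intro exI conjI ballI)
    show "countable (range (\<lambda>n::nat. ball (0::complex) (real n)))" by simp
    show "\<Union>(range (\<lambda>n::nat. ball (0::complex) (real n))) = space N"
      using reals_Archimedean2 by (auto simp: N_def)
  qed (auto simp: ball)
  moreover have "distr N borel ((+) c) = N" for c
  proof -
    have "distr N borel ((+) c) = distr (distr lborel borel ((+) (c / a))) borel (\<lambda>z. a * z)"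
      unfolding N_def using a by (simp add: distr_distr o_def algebra_simps)
    then show ?thesis by (simp add: lborel_distr_plus N_def)
  qed
  ultimately have *: "emeasure N A * ennreal pi = emeasure lborel A * ennreal (pi * (1 / cmod a)\<^sup>2)"
    if "A \<in> sets borel" for A
    using translation_invariant_proportional_lborel[of N A] that ball[of 1]
    by (simp add: emeasure_ball unit_ball_vol_2 N_def)
  have "N = density lborel (\<lambda>_. ennreal (1 / (cmod a)\<^sup>2))"
  proof (rule measure_eqI)
    fix A assume "A \<in> sets N"
    then have A: "A \<in> sets borel" by (simp add: N_def)
    have "emeasure N A * ennreal pi * ennreal (1/pi) = emeasure lborel A * ennreal (pi * (1 / cmod a)\<^sup>2) * ennreal (1/pi)"
      using *[OF A] by simp
    then have "emeasure N A = emeasure lborel A * ennreal ((1 / cmod a)\<^sup>2)"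
      by (simp add: mult.assoc ennreal_mult[symmetric])
    then show "emeasure N A = emeasure (density lborel (\<lambda>_. ennreal (1 / (cmod a)\<^sup>2))) A"
      using A by (simp add: emeasure_density_const mult.commute power_divide)
  qed (simp add: N_def)
  then have "(\<integral>\<^sup>+z. f z \<partial>N) = ennreal (1 / (cmod a)\<^sup>2) * (\<integral>\<^sup>+z. f z \<partial>lborel)"
    by (simp add: nn_integral_density nn_integral_cmult)
  then show ?thesis by (simp add: N_def nn_integral_distr)
qed

lemma nn_integral_lborel_complex_affine:
  fixes a b :: complex and f :: "complex \<Rightarrow> ennreal"
  assumes a: "a \<noteq> 0" and f[measurable]: "f \<in> borel_measurable borel"
  shows "(\<integral>\<^sup>+z. f (a * z + b) \<partial>lborel) = ennreal (1 / (cmod a)\<^sup>2) * (\<integral>\<^sup>+z. f z \<partial>lborel)"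
proof -
  have "(\<integral>\<^sup>+z. f (a * z + b) \<partial>lborel) = ennreal (1 / (cmod a)\<^sup>2) * (\<integral>\<^sup>+z. f (z + b) \<partial>lborel)"
    by (rule nn_integral_lborel_complex_mult[OF a]) measurable
  also have "(\<integral>\<^sup>+z. f (z + b) \<partial>lborel) = (\<integral>\<^sup>+z. f z \<partial>distr lborel borel ((+) b))"
    by (subst nn_integral_distr) (auto simp: add.commute)
  also have "\<dots> = (\<integral>\<^sup>+z. f z \<partial>lborel)" by (simp add: lborel_distr_plus)
  finally show ?thesis .
qed

section \<open>Moments of the radial measure\<close>

text \<open>Polar coordinates for radial integrands. Both measures are determined by their values on half-lines, and
the preimage of a half-line is a disc whose area is known. Taking \<open>\<alpha> * cmod z powr m\<close> as radial
variable turns the moments directly into Gamma integrals.\<close>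

lemma distr_lborel_complex_norm_powr:
  fixes \<alpha> m :: real
  assumes \<alpha>: "\<alpha> > 0" and m: "m > 0"
  shows "distr lborel borel (\<lambda>z::complex. \<alpha> * cmod z powr m)
       = density lborel (\<lambda>t. ennreal (2 * pi / (m * \<alpha> powr (2/m)) * t powr (2/m - 1)) * indicator {0..} t)"
    (is "?L = ?R")
proof (rule measure_eqI_generator_eq[where E = "range (\<lambda>a::real. {..a})" and \<Omega> = UNIV and A = "\<lambda>i. {..real i}"])
  define c where "c = 2 * pi / (m * \<alpha> powr (2/m))"
  have c: "c \<ge> 0" using m by (simp add: c_def)
  have L: "emeasure ?L {..t} = ennreal (if t < 0 then 0 else pi * (t / \<alpha>) powr (2 / m))" for t
  proof (cases "t < 0")
    case True
    then have "(\<lambda>z::complex. \<alpha> * cmod z powr m) -` {..t} = {}"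
      using \<alpha> by (auto simp: not_le) (smt (verit) mult_nonneg_nonneg powr_ge_zero)
    then show ?thesis using True by (simp add: emeasure_distr)
  next
    case False
    have "(\<lambda>z::complex. \<alpha> * cmod z powr m) -` {..t} = cball 0 ((t / \<alpha>) powr (1 / m))"
    proof -
      have "\<alpha> * r powr m \<le> t \<longleftrightarrow> r \<le> (t / \<alpha>) powr (1 / m)" if "r \<ge> 0" for r
      proof -
        have "\<alpha> * r powr m \<le> t \<longleftrightarrow> r powr m \<le> t / \<alpha>" using \<alpha> by (simp add: field_simps)
        also have "\<dots> \<longleftrightarrow> r powr m \<le> ((t / \<alpha>) powr (1 / m)) powr m"
          using m False \<alpha> by (simp add: powr_powr)
        also have "\<dots> \<longleftrightarrow> r \<le> (t / \<alpha>) powr (1 / m)"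
          using powr_less_mono2[of m r "(t / \<alpha>) powr (1 / m)"] powr_less_mono2[of m "(t / \<alpha>) powr (1 / m)" r] m that
          by (smt (verit) powr_ge_zero)
        finally show ?thesis .
      qed
      then show ?thesis by auto
    qed
    moreover have "((t / \<alpha>) powr (1 / m))\<^sup>2 = (t / \<alpha>) powr (2 / m)"
      by (simp add: power2_eq_square powr_add[symmetric])
    ultimately show ?thesis using False
      by (simp add: emeasure_distr emeasure_cball unit_ball_vol_2)
  qed
  have R: "emeasure ?R {..t} = ennreal (if t < 0 then 0 else pi * (t / \<alpha>) powr (2 / m))" for t
  proof -
    have e: "emeasure ?R {..t} = (\<integral>\<^sup>+s. ennreal (c * s powr (2/m - 1)) * indicator {0..t} s \<partial>lborel)"
      by (subst emeasure_density) (auto simp: c_def indicator_def intro!: nn_integral_cong)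
    show ?thesis
    proof (cases "t < 0")
      case True
      then show ?thesis unfolding e by simp
    next
      case False
      have "((\<lambda>s. c * s powr (2/m - 1)) has_integral c * (t powr (2/m - 1 + 1) / (2/m - 1 + 1))) {0..t}"
        using False m by (intro has_integral_mult_right has_integral_powr_from_0) auto
      then have "(\<integral>\<^sup>+s. ennreal (c * s powr (2/m - 1)) * indicator {0..t} s \<partial>lborel) = ennreal (c * (t powr (2/m - 1 + 1) / (2/m - 1 + 1)))"
        using c by (intro nn_integral_has_integral_lebesgue') auto
      also have "c * (t powr (2/m - 1 + 1) / (2/m - 1 + 1)) = pi * (t / \<alpha>) powr (2 / m)"
        using m \<alpha> False by (simp add: c_def powr_divide)
      finally show ?thesis using False unfolding e by simp
    qed
  qed
  show "emeasure ?L X = emeasure ?R X" if "X \<in> range (\<lambda>a::real. {..a})" for X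
    using that L R by (auto simp: c_def)
  show "emeasure ?L {..real i} \<noteq> \<infinity>" for i by (subst L) simp
  have bs: "sets (borel::real measure) = sigma_sets UNIV (range (\<lambda>a::real. {..a}))"
    by (subst borel_eq_atMost) simp
  show "sets ?L = sigma_sets UNIV (range (\<lambda>a::real. {..a}))"
    "sets ?R = sigma_sets UNIV (range (\<lambda>a::real. {..a}))"
    using bs by simp_all
  show "Int_stable (range (\<lambda>a::real. {..a}))"
    by (auto simp: Int_stable_def)
  show "(\<Union>i. {..real i}) = UNIV"
    using real_arch_simple by auto
qed auto

text \<open>The squared norm of \<open>z ^ n\<close> in the Fock space, see \<open>nn_integral_norm_power_fock_measure\<close>.\<close>

definition monomial_norm2 :: "real \<Rightarrow> real \<Rightarrow> nat \<Rightarrow> real" where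
  "monomial_norm2 \<alpha> m n = Gamma (2 / m * (real n + 1)) / (\<alpha> powr (2 / m * real n) * Gamma (2 / m))"

lemma sets_fock_measure [simp, measurable_cong]: "sets (fock_measure \<alpha> m) = sets borel"
  by (simp add: fock_measure_def)

lemma nn_integral_fock_measure:
  assumes [measurable]: "f \<in> borel_measurable borel"
  assumes "m > 0" "\<alpha> > 0"
  shows "(\<integral>\<^sup>+z. f z \<partial>fock_measure \<alpha> m)
       = (\<integral>\<^sup>+z. f z * ennreal (m * \<alpha> powr (2 / m) / (2 * pi * Gamma (2 / m)) * exp (- \<alpha> * cmod z powr m)) \<partial>lborel)"
  unfolding fock_measure_def by (subst nn_integral_density) (auto simp: mult.commute)

lemma nn_integral_norm_power_fock_measure:
  assumes \<alpha>: "\<alpha> > 0" and m: "m > 0"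
  shows "(\<integral>\<^sup>+z. ennreal (cmod z ^ (2 * n)) \<partial>fock_measure \<alpha> m) = ennreal (monomial_norm2 \<alpha> m n)"
proof -
  define b where "b = 2 / m"
  have b: "b > 0" using m by (simp add: b_def)
  define c where "c = m * \<alpha> powr b / (2 * pi * Gamma b)"
  have G: "Gamma b > 0" using b by simp
  have c: "c \<ge> 0" using m G by (simp add: c_def)
  define h where "h t = c * (t / \<alpha>) powr (b * n) * exp (- t)" for t
  have h: "h t \<ge> 0" for t using c by (simp add: h_def)
  have p: "cmod z ^ (2 * n) = ((\<alpha> * cmod z powr m) / \<alpha>) powr (b * n)" if "z \<noteq> 0" for z
    using m \<alpha> that by (simp add: b_def powr_powr powr_realpow[symmetric])
  \<comment> \<open>the origin is left out because \<open>0 powr 0 = 0\<close>\<close>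
  have "(\<integral>\<^sup>+z. ennreal (cmod z ^ (2 * n)) \<partial>fock_measure \<alpha> m)
      = (\<integral>\<^sup>+z. ennreal (cmod z ^ (2 * n)) * ennreal (c * exp (- \<alpha> * cmod z powr m)) \<partial>lborel)"
    unfolding c_def b_def using m \<alpha> by (intro nn_integral_fock_measure) auto
  also have "\<dots> = (\<integral>\<^sup>+z. ennreal (h (\<alpha> * cmod z powr m)) \<partial>lborel)"
  proof (intro nn_integral_cong_AE eventually_mono[OF AE_lborel_singleton[of "0::complex"]])
    fix z :: complex assume z: "z \<noteq> 0"
    have "h (\<alpha> * cmod z powr m) = cmod z ^ (2 * n) * (c * exp (- \<alpha> * cmod z powr m))"
      unfolding h_def p[OF z] by (simp add: mult_ac)
    then show "ennreal (cmod z ^ (2 * n)) * ennreal (c * exp (- \<alpha> * cmod z powr m)) = ennreal (h (\<alpha> * cmod z powr m))"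
      using c by (simp add: ennreal_mult)
  qed
  also have "\<dots> = (\<integral>\<^sup>+t. ennreal (h t) \<partial>distr lborel borel (\<lambda>z::complex. \<alpha> * cmod z powr m))"
    by (subst nn_integral_distr) (auto simp: h_def)
  also have "\<dots> = (\<integral>\<^sup>+t. ennreal (h t * (2 * pi / (m * \<alpha> powr b) * t powr (b - 1))) * indicator {0..} t \<partial>lborel)"
    unfolding distr_lborel_complex_norm_powr[OF \<alpha> m] b_def[symmetric] using m h
    by (subst nn_integral_density) (auto simp: h_def ennreal_mult[symmetric] mult_ac indicator_def intro!: nn_integral_cong)
  also have "\<dots> = (\<integral>\<^sup>+t. ennreal (1 / (\<alpha> powr (b * n) * Gamma b) * (t powr (b * (real n + 1) - 1) / exp t)) * indicator {0..} t \<partial>lborel)"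
  proof (intro nn_integral_cong)
    fix t :: real
    have "h t * (2 * pi / (m * \<alpha> powr b) * t powr (b - 1)) = 1 / (\<alpha> powr (b * n) * Gamma b) * (t powr (b * (real n + 1) - 1) / exp t)"
      if "t \<ge> 0"
    proof -
      have "b * (real n + 1) - 1 = b * n + (b - 1)" by (simp add: algebra_simps)
      then have "t powr (b * (real n + 1) - 1) = t powr (b * n) * t powr (b - 1)" by (simp only: powr_add)
      then show ?thesis using that m \<alpha> G by (simp add: h_def c_def powr_divide exp_minus field_simps)
    qed
    then show "ennreal (h t * (2 * pi / (m * \<alpha> powr b) * t powr (b - 1))) * indicator {0..} t =
         ennreal (1 / (\<alpha> powr (b * n) * Gamma b) * (t powr (b * (real n + 1) - 1) / exp t)) * indicator {0..} t"
      by (auto simp: indicator_def)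
  qed
  also have "\<dots> = ennreal (1 / (\<alpha> powr (b * n) * Gamma b) * Gamma (b * (real n + 1)))"
    using b G by (intro nn_integral_has_integral_lebesgue' has_integral_mult_right Gamma_integral_real) auto
  finally show ?thesis by (simp add: monomial_norm2_def b_def field_simps)
qed

section \<open>Parseval identity\<close>

lemma integral_cis_int:
  fixes k :: int
  shows "(\<integral>\<theta>. indicator {0..2*pi} \<theta> *\<^sub>R cis (of_int k * \<theta>) \<partial>lborel) = (if k = 0 then 2 * pi else 0)"
proof (cases "k = 0")
  case True
  then show ?thesis by (simp add: scaleR_conv_of_real)
next
  case False
  define F where "F \<theta> = - (\<i> / of_int k) * cis (of_int k * \<theta>)" for \<theta>
  have "(\<integral>\<theta>. indicator {0..2*pi} \<theta> *\<^sub>R cis (of_int k * \<theta>) \<partial>lborel) = F (2*pi) - F 0"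
  proof (rule integral_FTC_Icc)
    fix x :: real
    have "(F has_vector_derivative (- (\<i> / of_int k) * (of_int k *\<^sub>R (\<i> * cis (of_int k * x))))) (at x within {0..2*pi})"
      unfolding F_def has_vector_derivative_def
      by (auto intro!: derivative_eq_intros simp: mult_ac scaleR_conv_of_real)
    then show "(F has_vector_derivative cis (of_int k * x)) (at x within {0..2*pi})"
      using False by (simp add: scaleR_conv_of_real)
  qed (auto intro!: continuous_intros)
  also have "cis (of_int k * (2*pi)) = 1"
    using cis_multiple_2pi[of "of_int k"] by (simp add: mult_ac)
  then have "F (2*pi) - F 0 = 0" by (simp add: F_def)
  finally show ?thesis using False by simp
qed

text \<open>The finite sums follow from the orthogonality of the characters; dominated convergence, with the
absolutely convergent sum of the coefficients as bound, passes to the limit.\<close>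

lemma circle_Parseval:
  fixes c :: "nat \<Rightarrow> complex"
  assumes c: "summable (\<lambda>n. norm (c n))"
  defines "F \<equiv> \<lambda>\<theta>. \<Sum>n. c n * cis (real n * \<theta>)"
  shows "(\<lambda>n. ennreal (2 * pi * (norm (c n))\<^sup>2)) sums (\<integral>\<^sup>+\<theta>. ennreal ((norm (F \<theta>))\<^sup>2) * indicator {0..2*pi} \<theta> \<partial>lborel)"
proof -
  define S where "S N \<theta> = (\<Sum>n<N. c n * cis (real n * \<theta>))" for N \<theta>
  have S_lim: "(\<lambda>N. S N \<theta>) \<longlonglongrightarrow> F \<theta>" for \<theta>
  proof -
    have "summable (\<lambda>n. c n * cis (real n * \<theta>))"
      by (rule summable_norm_cancel) (simp add: norm_mult c)
    then show ?thesis unfolding S_def F_def using summable_LIMSEQ by blast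
  qed
  have [measurable]: "S N \<in> borel_measurable borel" for N
    unfolding S_def by (intro borel_measurable_continuous_onI continuous_intros)
  have [measurable]: "F \<in> borel_measurable borel"
    by (rule borel_measurable_LIMSEQ_metric[OF _ S_lim]) simp
  define B where "B = (\<Sum>n. norm (c n))"
  have S_le: "norm (S N \<theta>) \<le> B" for N \<theta>
  proof -
    have "norm (S N \<theta>) \<le> (\<Sum>n<N. norm (c n))"
      unfolding S_def by (rule order.trans[OF norm_sum]) (simp add: norm_mult)
    also have "\<dots> \<le> B" unfolding B_def by (rule sum_le_suminf[OF c]) auto
    finally show ?thesis .
  qed
  have S_int: "(\<integral>\<theta>. indicator {0..2*pi} \<theta> *\<^sub>R (norm (S N \<theta>))\<^sup>2 \<partial>lborel) = (\<Sum>n<N. 2 * pi * (norm (c n))\<^sup>2)" for N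
  proof -
    have ci: "integrable lborel (\<lambda>\<theta>. indicator {0..2*pi} \<theta> *\<^sub>R cis (of_int k * \<theta>))" for k
      by (rule borel_integrable_compact) (auto intro!: continuous_intros)
    have ci': "integrable lborel (\<lambda>\<theta>. (c n * cnj (c k)) * (indicator {0..2*pi} \<theta> *\<^sub>R cis (of_int (int n - int k) * \<theta>)))" for n k
      by (intro integrable_mult_right ci)
    have "complex_of_real (indicator {0..2*pi} \<theta> *\<^sub>R (norm (S N \<theta>))\<^sup>2)
        = (\<Sum>n<N. \<Sum>k<N. (c n * cnj (c k)) * (indicator {0..2*pi} \<theta> *\<^sub>R cis (of_int (int n - int k) * \<theta>)))" for \<theta>
    proof -
      have cc: "cis (of_int (int n - int k) * \<theta>) = cis (real n * \<theta>) * cnj (cis (real k * \<theta>))" for n k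
        by (simp add: cis_mult cis_cnj algebra_simps)
      have "complex_of_real ((norm (S N \<theta>))\<^sup>2) = S N \<theta> * cnj (S N \<theta>)"
        by (rule complex_norm_square)
      also have "\<dots> = (\<Sum>n<N. \<Sum>k<N. (c n * cnj (c k)) * cis (of_int (int n - int k) * \<theta>))"
        unfolding S_def cnj_sum sum_product by (intro sum.cong refl, subst cc) (simp add: mult_ac)
      finally show ?thesis
        by (simp add: indicator_def sum_distrib_left)
    qed
    then have "complex_of_real (\<integral>\<theta>. indicator {0..2*pi} \<theta> *\<^sub>R (norm (S N \<theta>))\<^sup>2 \<partial>lborel)
       = (\<integral>\<theta>. (\<Sum>n<N. \<Sum>k<N. (c n * cnj (c k)) * (indicator {0..2*pi} \<theta> *\<^sub>R cis (of_int (int n - int k) * \<theta>))) \<partial>lborel)"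
      by (subst integral_complex_of_real[symmetric]) simp
    also have "\<dots> = (\<Sum>n<N. \<Sum>k<N. (c n * cnj (c k)) * (if int n - int k = 0 then 2 * pi else 0))"
      by (subst Bochner_Integration.integral_sum, intro Bochner_Integration.integrable_sum ci',
          intro sum.cong refl, subst Bochner_Integration.integral_sum, intro ci',
          intro sum.cong refl) (simp only: integral_mult_right_zero integral_cis_int)
    also have "\<dots> = (\<Sum>n<N. (c n * cnj (c n)) * (2 * pi))"
      by (intro sum.cong refl) (simp add: if_distrib sum.delta cong: if_cong)
    also have "\<dots> = complex_of_real (\<Sum>n<N. 2 * pi * (norm (c n))\<^sup>2)"
      by (simp add: complex_norm_square[symmetric] mult.commute)
    finally show ?thesis by (simp only: of_real_eq_iff)
  qed
  let ?g = "\<lambda>\<theta>. indicator {0..2*pi} \<theta> *\<^sub>R (norm (F \<theta>))\<^sup>2"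
  have dom: "integrable lborel (\<lambda>\<theta>. indicator {0..2*pi} \<theta> *\<^sub>R B\<^sup>2)"
    by (rule borel_integrable_compact) auto
  have "integrable lborel ?g" and
    lim: "(\<lambda>N. \<integral>\<theta>. indicator {0..2*pi} \<theta> *\<^sub>R (norm (S N \<theta>))\<^sup>2 \<partial>lborel) \<longlonglongrightarrow> integral\<^sup>L lborel ?g"
  proof -
    have 1: "AE x in lborel. (\<lambda>N. indicator {0..2*pi} x *\<^sub>R (norm (S N x))\<^sup>2) \<longlonglongrightarrow> ?g x"
      by (intro AE_I2 tendsto_intros S_lim)
    have 2: "AE x in lborel. norm (indicator {0..2*pi} x *\<^sub>R (norm (S N x))\<^sup>2) \<le> indicator {0..2*pi} x *\<^sub>R B\<^sup>2" for N
      using S_le[of N] by (intro AE_I2) (auto simp: indicator_def intro!: power_mono)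
    show "integrable lborel ?g"
      by (rule integrable_dominated_convergence[OF _ _ dom 1 2]) auto
    show "(\<lambda>N. \<integral>\<theta>. indicator {0..2*pi} \<theta> *\<^sub>R (norm (S N \<theta>))\<^sup>2 \<partial>lborel) \<longlonglongrightarrow> integral\<^sup>L lborel ?g"
      by (rule integral_dominated_convergence[OF _ _ dom 1 2]) auto
  qed
  have "(\<integral>\<^sup>+\<theta>. ennreal ((norm (F \<theta>))\<^sup>2) * indicator {0..2*pi} \<theta> \<partial>lborel) = (\<integral>\<^sup>+\<theta>. ennreal (?g \<theta>) \<partial>lborel)"
    by (intro nn_integral_cong) (auto simp: indicator_def)
  also have "\<dots> = ennreal (integral\<^sup>L lborel ?g)"
    by (rule nn_integral_eq_integral[OF \<open>integrable lborel ?g\<close>]) auto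
  finally have eq: "(\<integral>\<^sup>+\<theta>. ennreal ((norm (F \<theta>))\<^sup>2) * indicator {0..2*pi} \<theta> \<partial>lborel) = ennreal (integral\<^sup>L lborel ?g)" .
  show ?thesis unfolding eq sums_def
    using tendsto_ennrealI[OF lim[unfolded S_int]] by (simp add: sum_ennreal)
qed

lemma entire_power_series_summable:
  fixes a :: "nat \<Rightarrow> complex"
  assumes "\<And>z. (\<lambda>n. a n * z ^ n) sums f z"
  shows "summable (\<lambda>n. norm (a n * z ^ n))"
  using powser_insidea[of a "of_real (norm z + 1)" z] assms[of "of_real (norm z + 1)"]
  by (auto simp: sums_iff)

lemma entire_power_series_holomorphic:
  fixes a :: "nat \<Rightarrow> complex"
  assumes "\<And>z. (\<lambda>n. a n * z ^ n) sums f z"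
  shows "f holomorphic_on UNIV"
proof -
  have "f holomorphic_on ball 0 r" for r
    by (rule power_series_holomorphic[of 0 r a]) (use assms in simp)
  then have "f holomorphic_on (\<Union>n::nat. ball 0 (real n))"
    by (intro holomorphic_on_UN_open) auto
  also have "(\<Union>n::nat. ball (0::complex) (real n)) = UNIV"
    using reals_Archimedean2 by auto
  finally show ?thesis .
qed

text \<open>Averaging the integrand over all rotations does not change the integral, and after exchanging the
two integrations the inner one is \<open>circle_Parseval\<close>. Only nonnegative integrals occur, so the
identity also decides when \<open>f\<close> belongs to the Fock space.\<close>

lemma Parseval_fock:
  fixes a :: "nat \<Rightarrow> complex"
  assumes f: "\<And>z. (\<lambda>n. a n * z ^ n) sums f z" and \<alpha>: "\<alpha> > 0" and m: "m > 0"
  shows "(\<integral>\<^sup>+z. ennreal ((cmod (f z))\<^sup>2) \<partial>fock_measure \<alpha> m) = (\<Sum>n. ennreal ((cmod (a n))\<^sup>2 * monomial_norm2 \<alpha> m n))"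
proof -
  have "continuous_on UNIV f"
    using entire_power_series_holomorphic[OF f] holomorphic_on_imp_continuous_on by blast
  then have fm[measurable]: "f \<in> borel_measurable borel"
    by (simp add: borel_measurable_continuous_onI)
  define w where "w r = ennreal (m * \<alpha> powr (2 / m) / (2 * pi * Gamma (2 / m)) * exp (- \<alpha> * r powr m))" for r :: real
  have wm[measurable]: "w \<in> borel_measurable borel" unfolding w_def by measurable
  note [measurable] = borel_measurable_continuous_onI[OF continuous_on_cis[OF continuous_on_id]]
  have circ: "(\<integral>\<^sup>+\<theta>. ennreal ((cmod (f (cis \<theta> * z)))\<^sup>2) * indicator {0..2*pi} \<theta> \<partial>lborel)
      = (\<Sum>n. ennreal (2 * pi * (cmod (a n * z ^ n))\<^sup>2))" for z
  proof -
    have "f (cis \<theta> * z) = (\<Sum>n. a n * z ^ n * cis (real n * \<theta>))" for \<theta>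
      using f[of "cis \<theta> * z"] by (simp add: sums_iff power_mult_distrib Complex.DeMoivre mult_ac)
    then show ?thesis
      using circle_Parseval[OF entire_power_series_summable[OF f, of z]] by (simp add: sums_iff)
  qed
  define I where "I = (\<integral>\<^sup>+z. ennreal ((cmod (f z))\<^sup>2) * w (cmod z) \<partial>lborel)"
  have rot: "(\<integral>\<^sup>+z. ennreal ((cmod (f (cis \<theta> * z)))\<^sup>2) * w (cmod z) \<partial>lborel) = I" for \<theta>
    using nn_integral_lborel_complex_mult[of "cis \<theta>" "\<lambda>z. ennreal ((cmod (f z))\<^sup>2) * w (cmod z)"]
    by (simp add: I_def norm_mult)
  have "ennreal (2 * pi) * I = (\<integral>\<^sup>+\<theta>. I * indicator {0..2*pi} \<theta> \<partial>lborel)"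
    by (subst nn_integral_cmult) (auto simp: mult.commute)
  also have "\<dots> = (\<integral>\<^sup>+\<theta>. (\<integral>\<^sup>+z. ennreal ((cmod (f (cis \<theta> * z)))\<^sup>2) * w (cmod z) * indicator {0..2*pi} \<theta> \<partial>lborel) \<partial>lborel)"
    by (intro nn_integral_cong, subst rot[symmetric], subst nn_integral_multc) auto
  also have "\<dots> = (\<integral>\<^sup>+z. (\<integral>\<^sup>+\<theta>. ennreal ((cmod (f (cis \<theta> * z)))\<^sup>2) * w (cmod z) * indicator {0..2*pi} \<theta> \<partial>lborel) \<partial>lborel)"
    by (rule lborel_pair.Fubini') measurable
  also have "\<dots> = (\<integral>\<^sup>+z. (\<Sum>n. ennreal (2 * pi * (cmod (a n * z ^ n))\<^sup>2)) * w (cmod z) \<partial>lborel)"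
  proof (intro nn_integral_cong)
    fix z
    have "(\<integral>\<^sup>+\<theta>. ennreal ((cmod (f (cis \<theta> * z)))\<^sup>2) * w (cmod z) * indicator {0..2*pi} \<theta> \<partial>lborel)
      = (\<integral>\<^sup>+\<theta>. (ennreal ((cmod (f (cis \<theta> * z)))\<^sup>2) * indicator {0..2*pi} \<theta>) * w (cmod z) \<partial>lborel)"
      by (simp add: mult_ac)
    also have "\<dots> = (\<integral>\<^sup>+\<theta>. (ennreal ((cmod (f (cis \<theta> * z)))\<^sup>2) * indicator {0..2*pi} \<theta>) \<partial>lborel) * w (cmod z)"
      by (rule nn_integral_multc) measurable
    finally show "(\<integral>\<^sup>+\<theta>. ennreal ((cmod (f (cis \<theta> * z)))\<^sup>2) * w (cmod z) * indicator {0..2*pi} \<theta> \<partial>lborel)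
       = (\<Sum>n. ennreal (2 * pi * (cmod (a n * z ^ n))\<^sup>2)) * w (cmod z)" by (simp add: circ)
  qed
  also have "\<dots> = (\<integral>\<^sup>+z. (\<Sum>n. ennreal (2 * pi * (cmod (a n * z ^ n))\<^sup>2)) \<partial>fock_measure \<alpha> m)"
    using \<alpha> m by (subst nn_integral_fock_measure) (auto simp: w_def)
  also have "\<dots> = (\<Sum>n. \<integral>\<^sup>+z. ennreal (2 * pi * (cmod (a n))\<^sup>2) * ennreal (cmod z ^ (2 * n)) \<partial>fock_measure \<alpha> m)"
    by (subst nn_integral_suminf)
       (auto simp: norm_mult norm_power power_mult_distrib power_mult[symmetric] mult_ac ennreal_mult[symmetric])
  also have "\<dots> = (\<Sum>n. ennreal (2 * pi) * ennreal ((cmod (a n))\<^sup>2 * monomial_norm2 \<alpha> m n))"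
  proof -
    have "(\<integral>\<^sup>+z. ennreal (2 * pi * (cmod (a n))\<^sup>2) * ennreal (cmod z ^ (2 * n)) \<partial>fock_measure \<alpha> m)
      = ennreal (2 * pi * (cmod (a n))\<^sup>2) * ennreal (monomial_norm2 \<alpha> m n)" for n
      by (subst nn_integral_cmult) (auto simp: nn_integral_norm_power_fock_measure[OF \<alpha> m])
    also have "\<dots> n = ennreal (2 * pi) * ennreal ((cmod (a n))\<^sup>2 * monomial_norm2 \<alpha> m n)" for n
      using m \<alpha> by (simp add: ennreal_mult[symmetric] monomial_norm2_def mult_ac)
    finally show ?thesis by simp
  qed
  also have "\<dots> = ennreal (2 * pi) * (\<Sum>n. ennreal ((cmod (a n))\<^sup>2 * monomial_norm2 \<alpha> m n))"
    by (rule ennreal_suminf_cmult)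
  finally have "I = (\<Sum>n. ennreal ((cmod (a n))\<^sup>2 * monomial_norm2 \<alpha> m n))"
    by (subst (asm) ennreal_mult_cancel_left) auto
  then show ?thesis
    using \<alpha> m by (subst nn_integral_fock_measure) (auto simp: I_def w_def)
qed

section \<open>The reproducing kernel on the diagonal\<close>

text \<open>For \<open>s = k + 1\<close> with a natural number \<open>k\<close> this is the \<open>k\<close>-th term of the exponential series at \<open>x\<close>. The
kernel is the sum of these terms along an arithmetic progression of step \<open>2 / m\<close> instead of \<open>1\<close>.\<close>

definition gamma_term :: "real \<Rightarrow> real \<Rightarrow> real" where
  "gamma_term x s = x powr (s - 1) / Gamma s"

lemma gamma_term_pos: "x > 0 \<Longrightarrow> s > 0 \<Longrightarrow> gamma_term x s > 0"
  by (simp add: gamma_term_def)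

lemma gamma_term_exp: "x > 0 \<Longrightarrow> s > 0 \<Longrightarrow> gamma_term x s = exp ((s - 1) * ln x - ln_Gamma s)"
  by (simp add: gamma_term_def powr_def exp_diff Gamma_real_pos_exp)

text \<open>The logarithm of \<open>gamma_term x\<close> is concave because \<open>ln_Gamma\<close> is convex, but an upper bound between
two grid points needs the reverse inequality. It holds up to a constant because the second
derivative of \<open>ln_Gamma\<close>, the trigamma function, is bounded on \<open>{s0..}\<close>: adding a suitable
quadratic to \<open>- ln_Gamma\<close> makes it convex. The constant does not depend on \<open>x\<close>.\<close>

lemma gamma_term_between:
  assumes s0: "s0 > 0" and H: "H > 0"
  shows "\<exists>D>0. \<forall>x>0. \<forall>s\<ge>s0. \<forall>u\<in>{s..s+H}. gamma_term x u \<le> D * (gamma_term x s + gamma_term x (s + H))"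
proof -
  define K where "K = Polygamma 1 s0 / 2"
  have K: "K \<ge> 0" unfolding K_def
    using Polygamma_real_odd_pos[of s0 1] s0 nonpos_Ints_nonpos[of s0] by fastforce
  define F where "F s = K * s\<^sup>2 - ln_Gamma s" for s
  have conv: "convex_on {s0..} F"
  proof (rule f''_ge0_imp_convex)
    fix s assume "s \<in> {s0..}"
    then have s: "s \<ge> s0" "s > 0" using s0 by auto
    then have ns: "s \<notin> \<int>\<^sub>\<le>\<^sub>0" using nonpos_Ints_nonpos[of s] by fastforce
    show "(F has_real_derivative (2 * K * s - Digamma s)) (at s)"
      unfolding F_def using s by (auto intro!: derivative_eq_intros)
    show "((\<lambda>s. 2 * K * s - Digamma s) has_real_derivative (2 * K - Polygamma 1 s)) (at s)"
      using ns by (auto intro!: derivative_eq_intros)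
    show "0 \<le> 2 * K - Polygamma 1 s"
      using Polygamma_real_strict_antimono[of s0 s 1] s s0 unfolding K_def
      by (cases "s = s0") auto
  qed simp
  show ?thesis
  proof (intro exI[of _ "exp (K * H\<^sup>2)"] conjI allI impI ballI)
    fix x s u :: real assume x: "x > 0" and s: "s \<ge> s0" and u: "u \<in> {s..s + H}"
    define t where "t = (u - s) / H"
    have t: "0 \<le> t" "t \<le> 1" using u H by (auto simp: t_def field_simps)
    have u_eq: "u = (1 - t) * s + t * (s + H)" using H by (simp add: t_def field_simps)
    have "F u \<le> (1 - t) * F s + t * F (s + H)"
      using convex_onD[OF conv t, of s "s + H"] s H unfolding u_eq by simp
    moreover have "K * u\<^sup>2 = (1 - t) * (K * s\<^sup>2) + t * (K * (s + H)\<^sup>2) - K * H\<^sup>2 * (t * (1 - t))"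
      unfolding u_eq by (simp add: power2_eq_square algebra_simps)
    moreover have "K * H\<^sup>2 * (t * (1 - t)) \<le> K * H\<^sup>2 * 1"
      using t K by (intro mult_left_mono) (auto simp: mult_le_one)
    ultimately have A: "- ln_Gamma u \<le> (1 - t) * (- ln_Gamma s) + t * (- ln_Gamma (s + H)) + K * H\<^sup>2"
      unfolding F_def by (simp add: algebra_simps)
    define L where "L s = (s - 1) * ln x - ln_Gamma s" for s
    have "(u - 1) * ln x = (1 - t) * ((s - 1) * ln x) + t * ((s + H - 1) * ln x)"
      unfolding u_eq by (simp add: algebra_simps)
    with A have "L u \<le> (1 - t) * L s + t * L (s + H) + K * H\<^sup>2"
      unfolding L_def by (simp add: algebra_simps)
    also have "(1 - t) * L s + t * L (s + H) \<le> max (L s) (L (s + H))"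
      using t by (intro convex_bound_le) auto
    finally have "exp (L u) \<le> exp (max (L s) (L (s + H)) + K * H\<^sup>2)" by simp
    also have "\<dots> = exp (K * H\<^sup>2) * exp (max (L s) (L (s + H)))" by (simp add: exp_add mult.commute)
    also have "exp (max (L s) (L (s + H))) \<le> exp (L s) + exp (L (s + H))"
      by (simp add: max_def)
    finally have "exp (L u) \<le> exp (K * H\<^sup>2) * (exp (L s) + exp (L (s + H)))" by simp
    then show "gamma_term x u \<le> exp (K * H\<^sup>2) * (gamma_term x s + gamma_term x (s + H))"
      using x s u s0 H by (simp add: gamma_term_exp L_def)
  qed simp
qed

text \<open>This covers the finitely many grid points to the left of the first point of the other grid, where
\<open>gamma_term_between\<close> does not apply.\<close>

lemma gamma_term_below:
  assumes h: "h > 0"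
  shows "\<exists>D>0. \<forall>x\<ge>1. \<forall>u\<in>{h..H}. gamma_term x u \<le> D * gamma_term x H"
proof (cases "h \<le> H")
  case True
  have "continuous_on {h..H} (Gamma :: real \<Rightarrow> real)"
    using h nonpos_Ints_nonpos by (intro continuous_on_Gamma) force
  then obtain v where v: "v \<in> {h..H}" "\<And>u. u \<in> {h..H} \<Longrightarrow> Gamma v \<le> Gamma u"
    using continuous_attains_inf[of "{h..H}" "Gamma :: real \<Rightarrow> real"] True by auto
  have pos: "Gamma v > 0" "Gamma H > 0" using v h True by auto
  show ?thesis
  proof (intro exI[of _ "Gamma H / Gamma v"] conjI allI impI ballI)
    fix x u :: real assume "x \<ge> 1" and u: "u \<in> {h..H}"
    have "x powr (u - 1) / Gamma u \<le> x powr (H - 1) / Gamma v"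
      using \<open>x \<ge> 1\<close> u v pos by (intro frac_le powr_mono) auto
    then show "gamma_term x u \<le> Gamma H / Gamma v * gamma_term x H"
      using pos by (simp add: gamma_term_def)
  qed (use pos in simp)
qed (auto intro: exI[of _ 1])

lemma suminf_reindex_bounded:
  fixes f :: "nat \<Rightarrow> real" and k :: "nat \<Rightarrow> nat"
  assumes f: "\<And>n. f n \<ge> 0" "summable f" and M: "\<And>j N. card {n\<in>{..<N}. k n = j} \<le> M"
  shows "summable (\<lambda>n. f (k n))" "(\<Sum>n. f (k n)) \<le> real M * (\<Sum>n. f n)"
proof -
  have le: "(\<Sum>n<N. f (k n)) \<le> real M * (\<Sum>n. f n)" for N
  proof -
    have "(\<Sum>n<N. f (k n)) = (\<Sum>j\<in>k ` {..<N}. of_nat (card {n\<in>{..<N}. k n = j}) * f j)"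
      by (rule sum_fun_comp) auto
    also have "\<dots> \<le> (\<Sum>j\<in>k ` {..<N}. real M * f j)"
      using f(1) M by (intro sum_mono mult_right_mono) auto
    also have "\<dots> = real M * (\<Sum>j\<in>k ` {..<N}. f j)" by (simp add: sum_distrib_left)
    also have "\<dots> \<le> real M * (\<Sum>n. f n)"
      using f by (intro mult_left_mono sum_le_suminf) auto
    finally show ?thesis .
  qed
  show "summable (\<lambda>n. f (k n))"
    using f(1) le by (rule summableI_nonneg_bounded)
  then show "(\<Sum>n. f (k n)) \<le> real M * (\<Sum>n. f n)"
    by (rule suminf_le_const) (rule le)
qed

lemma card_grid_floor_le:
  assumes "h > 0" "H > 0"
  shows "card {n\<in>{..<N}. nat \<lfloor>h * (real n + 1) / H\<rfloor> = j} \<le> nat \<lceil>H / h\<rceil> + 1"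
proof -
  let ?A = "{n\<in>{..<N}. nat \<lfloor>h * (real n + 1) / H\<rfloor> = j}"
  show ?thesis
  proof (cases "?A = {}")
    case False
    define p where "p = Min ?A"
    have fin: "finite ?A" by simp
    have p: "p \<in> ?A" unfolding p_def using Min_in[OF fin False] .
    have "?A \<subseteq> {p..p + nat \<lceil>H / h\<rceil>}"
    proof
      fix n assume n: "n \<in> ?A"
      then have "p \<le> n" unfolding p_def using fin by (intro Min_le)
      have "\<lfloor>h * (real n + 1) / H\<rfloor> = \<lfloor>h * (real p + 1) / H\<rfloor>"
        using n p assms by (auto simp: nat_eq_iff2)
      then have "h * (real n + 1) / H - h * (real p + 1) / H < 1" by linarith
      then have "h * (real n - real p) / H < 1" by (simp add: diff_divide_distrib[symmetric] algebra_simps)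
      then have "h * (real n - real p) < H" using assms by (simp add: pos_divide_less_eq)
      then have "real n - real p < H / h" using assms by (simp add: field_simps)
      then have "n \<le> p + nat \<lceil>H / h\<rceil>" by linarith
      with \<open>p \<le> n\<close> show "n \<in> {p..p + nat \<lceil>H / h\<rceil>}" by simp
    qed
    then have "card ?A \<le> card {p..p + nat \<lceil>H / h\<rceil>}" by (intro card_mono) auto
    then show ?thesis by simp
  next
    case True
    show ?thesis unfolding True by simp
  qed
qed

text \<open>Each point of the grid of step \<open>h\<close> lies between two neighbours of the grid of step \<open>H\<close>, and each
gap contains boundedly many such points; so the sums over the two grids are comparable with a
constant that is uniform in \<open>x\<close>.\<close>

lemma gamma_sum_step_le:
  assumes h: "h > 0" and H: "H > 0"
  shows "\<exists>C>0. \<forall>x\<ge>1. summable (\<lambda>n. gamma_term x (H * (real n + 1))) \<longrightarrow>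
     summable (\<lambda>n. gamma_term x (h * (real n + 1))) \<and>
     (\<Sum>n. gamma_term x (h * (real n + 1))) \<le> C * (\<Sum>n. gamma_term x (H * (real n + 1)))"
proof -
  obtain D1 where D1: "D1 > 0" "\<And>x s u. x > 0 \<Longrightarrow> s \<ge> H \<Longrightarrow> u \<in> {s..s+H} \<Longrightarrow>
      gamma_term x u \<le> D1 * (gamma_term x s + gamma_term x (s + H))"
    using gamma_term_between[OF H H] by blast
  obtain D2 where D2: "D2 > 0" "\<And>x u. x \<ge> 1 \<Longrightarrow> u \<in> {h..H} \<Longrightarrow> gamma_term x u \<le> D2 * gamma_term x H"
    using gamma_term_below[OF h] by blast
  \<comment> \<open>the neighbours of the \<open>n\<close>-th point on the other grid have indices \<open>k n - 1\<close> and \<open>k n\<close>; for \<open>k n = 0\<close> both are \<open>0\<close>\<close>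
  define k where "k n = nat \<lfloor>h * (real n + 1) / H\<rfloor>" for n
  define M where "M = nat \<lceil>H / h\<rceil> + 1"
  have M: "card {n\<in>{..<N}. k n = j} \<le> M" for N j
    unfolding k_def M_def by (rule card_grid_floor_le[OF h H])
  have M': "card {n\<in>{..<N}. k n - 1 = j} \<le> 2 * M" for N j
  proof -
    have "{n\<in>{..<N}. k n - 1 = j} \<subseteq> {n\<in>{..<N}. k n = j + 1} \<union> {n\<in>{..<N}. k n = 0}" by auto
    then have "card {n\<in>{..<N}. k n - 1 = j} \<le> card ({n\<in>{..<N}. k n = j + 1} \<union> {n\<in>{..<N}. k n = 0})"
      by (intro card_mono) auto
    also have "\<dots> \<le> card {n\<in>{..<N}. k n = j + 1} + card {n\<in>{..<N}. k n = 0}" by (rule card_Un_le)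
    finally show ?thesis using M[of N "j + 1"] M[of N 0] by linarith
  qed
  define C where "C = (D1 + D2) * (3 * real M)"
  have "C > 0" using D1 D2 by (simp add: C_def M_def)
  moreover {
    fix x :: real assume x: "x \<ge> 1"
    define f where "f n = gamma_term x (H * (real n + 1))" for n
    assume "summable (\<lambda>n. gamma_term x (H * (real n + 1)))"
    then have f: "summable f" "\<And>n. f n \<ge> 0"
      unfolding f_def using x H by (auto intro!: less_imp_le gamma_term_pos)
    have pt: "gamma_term x (h * (real n + 1)) \<le> (D1 + D2) * (f (k n - 1) + f (k n))" for n
    proof -
      define u where "u = h * (real n + 1)"
      have u: "u \<ge> h" using h by (simp add: u_def)
      have "gamma_term x u \<le> max D1 D2 * (f (k n - 1) + f (k n))"
      proof (cases "k n = 0")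
        case True
        then have "u / H < 1" unfolding k_def u_def[symmetric] by linarith
        then have "u \<le> H" using H by (simp add: field_simps)
        then have "gamma_term x u \<le> D2 * f 0" using D2(2)[OF x, of u] u by (simp add: f_def)
        also have "\<dots> \<le> max D1 D2 * (f 0 + f 0)" using f(2)[of 0] D2 by (intro mult_mono) auto
        finally show ?thesis using True by simp
      next
        case False
        define s where "s = H * real (k n)"
        have "\<lfloor>u / H\<rfloor> \<ge> 0" using u h H by simp
        then have kf: "real (k n) = of_int \<lfloor>u / H\<rfloor>" by (simp add: k_def u_def[symmetric])
        have "s \<le> u"
          using H mult_left_mono[OF of_int_floor_le[of "u / H"], of H] unfolding s_def kf by simp
        moreover have "u / H \<le> of_int \<lfloor>u / H\<rfloor> + 1" by linarith
        then have "u \<le> s + H" using H unfolding s_def kf by (simp add: field_simps)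
        moreover have "s \<ge> H" using False H by (simp add: s_def)
        ultimately have "gamma_term x u \<le> D1 * (gamma_term x s + gamma_term x (s + H))"
          using x by (intro D1(2)) auto
        also have "gamma_term x s = f (k n - 1)" using False by (simp add: f_def s_def of_nat_diff)
        also have "gamma_term x (s + H) = f (k n)" by (simp add: f_def s_def algebra_simps)
        also have "D1 * (f (k n - 1) + f (k n)) \<le> max D1 D2 * (f (k n - 1) + f (k n))"
          using f(2) by (intro mult_right_mono) (auto intro: add_nonneg_nonneg)
        finally show ?thesis .
      qed
      also have "\<dots> \<le> (D1 + D2) * (f (k n - 1) + f (k n))"
        using D1 D2 f(2) by (intro mult_right_mono) (auto intro: add_nonneg_nonneg)
      finally show ?thesis by (simp add: u_def)
    qed
    note r1 = suminf_reindex_bounded[of f k M, OF f(2,1) M]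
    note r2 = suminf_reindex_bounded[of f "\<lambda>n. k n - 1" "2 * M", OF f(2,1) M']
    have sm: "summable (\<lambda>n. (D1 + D2) * (f (k n - 1) + f (k n)))"
      by (intro summable_mult summable_add r1 r2)
    have sh: "summable (\<lambda>n. gamma_term x (h * (real n + 1)))"
    proof (rule summable_comparison_test'[OF sm, of 0])
      fix n show "norm (gamma_term x (h * (real n + 1))) \<le> (D1 + D2) * (f (k n - 1) + f (k n))"
        using pt[of n] gamma_term_pos[of x "h * (real n + 1)"] x h by simp
    qed
    have "(\<Sum>n. gamma_term x (h * (real n + 1))) \<le> (\<Sum>n. (D1 + D2) * (f (k n - 1) + f (k n)))"
      by (rule suminf_le[OF pt sh sm])
    also have "\<dots> = (D1 + D2) * ((\<Sum>n. f (k n - 1)) + (\<Sum>n. f (k n)))"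
      using r1 r2 by (simp add: suminf_mult suminf_add summable_add)
    also have "\<dots> \<le> (D1 + D2) * (real (2 * M) * (\<Sum>n. f n) + real M * (\<Sum>n. f n))"
      using r1 r2 D1 D2 by (intro mult_left_mono add_mono) auto
    also have "\<dots> = C * (\<Sum>n. f n)" by (simp add: C_def algebra_simps)
    finally have "summable (\<lambda>n. gamma_term x (h * (real n + 1))) \<and>
       (\<Sum>n. gamma_term x (h * (real n + 1))) \<le> C * (\<Sum>n. gamma_term x (H * (real n + 1)))"
      using sh by (simp add: f_def)
  }
  ultimately show ?thesis by blast
qed

lemma gamma_sum_unit_step:
  assumes "x > 0"
  shows "(\<lambda>n. gamma_term x (1 * (real n + 1))) sums exp x"
proof -
  have "gamma_term x (1 * (real n + 1)) = x ^ n /\<^sub>R fact n" for n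
    using assms Gamma_fact[of n, where 'a = real]
    by (simp add: gamma_term_def powr_realpow field_simps add.commute)
  then show ?thesis using exp_converges[of x] by simp
qed

text \<open>The grid of step \<open>1\<close> gives the exponential series exactly; the comparison of steps is used in both
directions.\<close>

lemma gamma_sum_asymp_exp:
  assumes h: "h > 0"
  shows "\<exists>c>0. \<exists>C>0. \<forall>x\<ge>1. summable (\<lambda>n. gamma_term x (h * (real n + 1))) \<and>
    c * exp x \<le> (\<Sum>n. gamma_term x (h * (real n + 1))) \<and>
    (\<Sum>n. gamma_term x (h * (real n + 1))) \<le> C * exp x"
proof -
  obtain C where C: "C > 0" "\<And>x. x \<ge> 1 \<Longrightarrow> summable (\<lambda>n. gamma_term x (1 * (real n + 1))) \<Longrightarrow>
     summable (\<lambda>n. gamma_term x (h * (real n + 1))) \<and>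
     (\<Sum>n. gamma_term x (h * (real n + 1))) \<le> C * (\<Sum>n. gamma_term x (1 * (real n + 1)))"
    using gamma_sum_step_le[OF h zero_less_one] by blast
  obtain B where B: "B > 0" "\<And>x. x \<ge> 1 \<Longrightarrow> summable (\<lambda>n. gamma_term x (h * (real n + 1))) \<Longrightarrow>
     (\<Sum>n. gamma_term x (1 * (real n + 1))) \<le> B * (\<Sum>n. gamma_term x (h * (real n + 1)))"
    using gamma_sum_step_le[OF zero_less_one h] by blast
  show ?thesis
  proof (rule exI[of _ "1 / B"], intro conjI, use B in simp, rule exI[of _ C], intro conjI allI impI)
    fix x :: real assume x: "x \<ge> 1"
    then have e: "(\<lambda>n. gamma_term x (1 * (real n + 1))) sums exp x" by (intro gamma_sum_unit_step) simp
    note c = C(2)[OF x sums_summable[OF e], folded sums_unique[OF e]]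
    show "summable (\<lambda>n. gamma_term x (h * (real n + 1)))" "(\<Sum>n. gamma_term x (h * (real n + 1))) \<le> C * exp x"
      using c by auto
    show "1 / B * exp x \<le> (\<Sum>n. gamma_term x (h * (real n + 1)))"
      using B(2)[OF x] c B(1) unfolding sums_unique[OF e, symmetric] by (simp add: field_simps)
  qed (use C in simp)
qed


text \<open>The reproducing kernel of the Fock space at a pair of equal points of modulus \<open>r\<close>.\<close>

definition fock_kernel :: "real \<Rightarrow> real \<Rightarrow> real \<Rightarrow> real" where
  "fock_kernel \<alpha> m r = (\<Sum>n. r ^ (2 * n) / monomial_norm2 \<alpha> m n)"

lemma monomial_norm2_pos: "\<alpha> > 0 \<Longrightarrow> m > 0 \<Longrightarrow> monomial_norm2 \<alpha> m n > 0"
  by (simp add: monomial_norm2_def)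

lemma kernel_term_gamma_term:
  assumes "\<alpha> > 0" "m > 0" "r > 0"
  shows "r ^ (2 * n) / monomial_norm2 \<alpha> m n
       = Gamma (2 / m) * (\<alpha> * r powr m) powr (1 - 2 / m) * gamma_term (\<alpha> * r powr m) (2 / m * (real n + 1))"
proof -
  define x where "x = \<alpha> * r powr m"
  define b where "b = 2 / m"
  have x: "x > 0" using assms by (simp add: x_def)
  have "x powr (1 - b) * x powr (b * (real n + 1) - 1) = x powr (b * n)"
    unfolding powr_add[symmetric] by (simp add: algebra_simps)
  moreover have "x powr (b * n) = \<alpha> powr (b * n) * r ^ (2 * n)"
    using assms by (simp add: x_def b_def powr_mult powr_powr powr_realpow[symmetric])
  ultimately show ?thesis
    unfolding monomial_norm2_def gamma_term_def x_def[symmetric] b_def[symmetric]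
    by (simp add: field_simps)
qed

lemma fock_kernel_asymp:
  assumes "\<alpha> > 0" "m > 0"
  shows "\<exists>c>0. \<exists>C>0. \<forall>r>0. \<alpha> * r powr m \<ge> 1 \<longrightarrow>
     c * ((\<alpha> * r powr m) powr (1 - 2 / m) * exp (\<alpha> * r powr m)) \<le> fock_kernel \<alpha> m r \<and>
     fock_kernel \<alpha> m r \<le> C * ((\<alpha> * r powr m) powr (1 - 2 / m) * exp (\<alpha> * r powr m))"
proof -
  have b: "2 / m > 0" using assms by simp
  obtain c C where c: "c > 0" "C > 0" and cC: "\<And>x. x \<ge> 1 \<Longrightarrow> summable (\<lambda>n. gamma_term x (2 / m * (real n + 1))) \<and>
    c * exp x \<le> (\<Sum>n. gamma_term x (2 / m * (real n + 1))) \<and>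
    (\<Sum>n. gamma_term x (2 / m * (real n + 1))) \<le> C * exp x"
    using gamma_sum_asymp_exp[OF b] by blast
  define g where "g = Gamma (2 / m)"
  have g: "g > 0" using assms by (simp add: g_def)
  show ?thesis
  proof (rule exI[of _ "g * c"], intro conjI, use g c in simp, rule exI[of _ "g * C"], intro conjI allI impI, use g c in simp)
    fix r :: real assume r: "r > 0" "\<alpha> * r powr m \<ge> 1"
    define x where "x = \<alpha> * r powr m"
    define y where "y = x powr (1 - 2 / m)"
    have y: "y \<ge> 0" by (simp add: y_def)
    note cx = cC[OF r(2), folded x_def]
    have K: "fock_kernel \<alpha> m r = g * y * (\<Sum>n. gamma_term x (2 / m * (real n + 1)))"
      unfolding fock_kernel_def kernel_term_gamma_term[OF assms r(1)] g_def[symmetric] x_def[symmetric] y_def[symmetric]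
      using cx by (intro suminf_mult) auto
    have "g * y * (c * exp x) \<le> fock_kernel \<alpha> m r" "fock_kernel \<alpha> m r \<le> g * y * (C * exp x)"
      unfolding K using g y cx by (auto intro!: mult_left_mono)
    then show "g * c * ((\<alpha> * r powr m) powr (1 - 2 / m) * exp (\<alpha> * r powr m)) \<le> fock_kernel \<alpha> m r"
      "fock_kernel \<alpha> m r \<le> g * C * ((\<alpha> * r powr m) powr (1 - 2 / m) * exp (\<alpha> * r powr m))"
      unfolding x_def[symmetric] y_def[symmetric] by (simp_all add: mult_ac)
  qed
qed

lemma summable_fock_kernel:
  assumes "\<alpha> > 0" "m > 0" "r \<ge> 0"
  shows "summable (\<lambda>n. r ^ (2 * n) / monomial_norm2 \<alpha> m n)"
proof -
  define R where "R = max r ((1 / \<alpha>) powr (1 / m))"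
  have R: "R > 0" "r \<le> R" using assms by (auto simp: R_def less_max_iff_disj)
  have "1 = \<alpha> * ((1 / \<alpha>) powr (1 / m)) powr m" using assms by (simp add: powr_powr)
  also have "\<dots> \<le> \<alpha> * R powr m" using assms by (intro mult_left_mono powr_mono2) (auto simp: R_def)
  finally have "summable (\<lambda>n. gamma_term (\<alpha> * R powr m) (2 / m * (real n + 1)))"
    using gamma_sum_asymp_exp[of "2 / m"] assms by auto
  then have "summable (\<lambda>n. R ^ (2 * n) / monomial_norm2 \<alpha> m n)"
    unfolding kernel_term_gamma_term[OF assms(1,2) R(1)] by (intro summable_mult)
  then show ?thesis
  proof (rule summable_comparison_test')
    fix n show "norm (r ^ (2 * n) / monomial_norm2 \<alpha> m n) \<le> R ^ (2 * n) / monomial_norm2 \<alpha> m n"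
      using assms R monomial_norm2_pos[OF assms(1,2), of n] by (auto intro!: divide_right_mono power_mono)
  qed
qed

section \<open>The Fock space as a weighted sequence space\<close>

definition taylor_coeff :: "(complex \<Rightarrow> complex) \<Rightarrow> nat \<Rightarrow> complex" where
  "taylor_coeff f n = (deriv ^^ n) f 0 / fact n"

lemma taylor_coeff_sums:
  assumes "f holomorphic_on UNIV"
  shows "(\<lambda>n. taylor_coeff f n * z ^ n) sums f z"
  using holomorphic_power_series[of f 0 "cmod z + 1" z] assms holomorphic_on_subset[of f UNIV]
  by (auto simp: taylor_coeff_def)

lemma taylor_coeff_linear:
  assumes "f holomorphic_on UNIV" "g holomorphic_on UNIV"
  shows "taylor_coeff (\<lambda>z. a * f z + b * g z) n = a * taylor_coeff f n + b * taylor_coeff g n"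
proof -
  have "(deriv ^^ n) (\<lambda>z. a * f z + b * g z) 0 = (deriv ^^ n) (\<lambda>z. a * f z) 0 + (deriv ^^ n) (\<lambda>z. b * g z) 0"
    using assms by (intro higher_deriv_add[of _ UNIV] holomorphic_intros) auto
  also have "\<dots> = a * (deriv ^^ n) f 0 + b * (deriv ^^ n) g 0"
    using assms by (simp add: higher_deriv_cmult[of _ UNIV])
  finally show ?thesis by (simp add: taylor_coeff_def add_divide_distrib)
qed

lemma finite_power_series_sums:
  fixes a :: "nat \<Rightarrow> complex"
  assumes "\<And>n. n \<ge> N \<Longrightarrow> a n = 0"
  shows "(\<lambda>n. a n * z ^ n) sums (\<Sum>n<N. a n * z ^ n)"
  using assms by (intro sums_finite) (auto simp: not_less)

lemma sum_le_sums:
  fixes f :: "nat \<Rightarrow> real"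
  assumes "f sums s" "finite A" "\<And>n. f n \<ge> 0"
  shows "sum f A \<le> s"
  using assms by (auto simp: sums_iff intro: sum_le_suminf)

locale fock_parameters =
  fixes \<alpha> m :: real
  assumes alpha_pos: "\<alpha> > 0" and m_pos: "m > 0"
begin

abbreviation "\<omega> \<equiv> monomial_norm2 \<alpha> m"
abbreviation "\<F> \<equiv> fock_space \<alpha> m"
abbreviation "\<N> \<equiv> fock_norm \<alpha> m"
abbreviation "\<mu> \<equiv> fock_measure \<alpha> m"

lemma omega_pos: "\<omega> n > 0"
  by (rule monomial_norm2_pos[OF alpha_pos m_pos])

lemma omega_nonneg [simp]: "\<omega> n \<ge> 0"
  using omega_pos[of n] by simp

lemma fock_holomorphic: "f \<in> \<F> \<Longrightarrow> f holomorphic_on UNIV"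
  by (simp add: fock_space_def)

lemma holomorphic_borel: "f holomorphic_on UNIV \<Longrightarrow> f \<in> borel_measurable borel"
  by (simp add: borel_measurable_continuous_onI holomorphic_on_imp_continuous_on)

lemma fock_borel: "f \<in> \<F> \<Longrightarrow> f \<in> borel_measurable borel"
  by (simp add: fock_holomorphic holomorphic_borel)

lemma fock_norm_nonneg [simp]: "\<N> f \<ge> 0"
  by (simp add: fock_norm_def)

lemma fock_norm2: "(\<N> f)\<^sup>2 = (\<integral>z. (cmod (f z))\<^sup>2 \<partial>\<mu>)"
  by (simp add: fock_norm_def)

lemma fock_space_iff:
  assumes "f holomorphic_on UNIV"
  shows "f \<in> \<F> \<longleftrightarrow> (\<integral>\<^sup>+z. ennreal ((cmod (f z))\<^sup>2) \<partial>\<mu>) < \<infinity>"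
  using assms holomorphic_borel[OF assms] by (auto simp: fock_space_def integrable_iff_bounded)

lemma nn_integral_fock:
  assumes "f \<in> \<F>"
  shows "(\<integral>\<^sup>+z. ennreal ((cmod (f z))\<^sup>2) \<partial>\<mu>) = ennreal ((\<N> f)\<^sup>2)"
  unfolding fock_norm2 using assms by (intro nn_integral_eq_integral) (auto simp: fock_space_def)

lemma fock_memI:
  assumes "f holomorphic_on UNIV" "(\<integral>\<^sup>+z. ennreal ((cmod (f z))\<^sup>2) \<partial>\<mu>) \<le> ennreal B"
  shows "f \<in> \<F>"
  using assms by (subst fock_space_iff) (auto intro: le_less_trans)

lemma fock_norm2_le:
  assumes "f \<in> \<F>" "(\<integral>\<^sup>+z. ennreal ((cmod (f z))\<^sup>2) \<partial>\<mu>) \<le> ennreal B" "B \<ge> 0"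
  shows "(\<N> f)\<^sup>2 \<le> B"
  using assms by (simp add: nn_integral_fock)

lemma fock_Cauchy_Schwarz:
  assumes "f \<in> \<F>" "g \<in> \<F>"
  shows "(\<integral>\<^sup>+z. ennreal (cmod (f z) * cmod (g z)) \<partial>\<mu>) \<le> ennreal (\<N> f * \<N> g)"
proof -
  note [measurable] = fock_borel[OF assms(1)] fock_borel[OF assms(2)]
  define x where "x = (\<integral>\<^sup>+z. ennreal (cmod (f z)) * ennreal (cmod (g z)) \<partial>\<mu>)"
  have "x\<^sup>2 \<le> ennreal ((\<N> f)\<^sup>2) * ennreal ((\<N> g)\<^sup>2)"
    using Cauchy_Schwarz_nn_integral[of "\<lambda>z. ennreal (cmod (f z))" \<mu> "\<lambda>z. ennreal (cmod (g z))"]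
    by (simp add: x_def nn_integral_fock[OF assms(1)] nn_integral_fock[OF assms(2)] ennreal_power)
  also have "\<dots> = ennreal ((\<N> f * \<N> g)\<^sup>2)" by (simp add: ennreal_mult power_mult_distrib)
  finally have le: "x\<^sup>2 \<le> ennreal ((\<N> f * \<N> g)\<^sup>2)" .
  have "x \<le> ennreal (\<N> f * \<N> g)"
  proof (cases x rule: ennreal_cases)
    case (real r)
    then have "r\<^sup>2 \<le> (\<N> f * \<N> g)\<^sup>2" using le by (simp add: ennreal_power)
    then have "r \<le> \<N> f * \<N> g" by (rule power2_le_imp_le) auto
    then show ?thesis using real by (simp add: ennreal_leI)
  next
    case top
    then show ?thesis using le by (simp add: power2_eq_square top_unique ennreal_top_mult)
  qed
  then show ?thesis by (simp add: x_def ennreal_mult)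
qed

lemma fock_add:
  assumes "f \<in> \<F>" "g \<in> \<F>"
  shows "(\<lambda>z. f z + g z) \<in> \<F>" "\<N> (\<lambda>z. f z + g z) \<le> \<N> f + \<N> g"
proof -
  note [measurable] = fock_borel[OF assms(1)] fock_borel[OF assms(2)]
  have "(\<integral>\<^sup>+z. ennreal ((cmod (f z + g z))\<^sup>2) \<partial>\<mu>)
     \<le> (\<integral>\<^sup>+z. ennreal ((cmod (f z))\<^sup>2) + (2 * ennreal (cmod (f z) * cmod (g z)) + ennreal ((cmod (g z))\<^sup>2)) \<partial>\<mu>)"
  proof (intro nn_integral_mono)
    fix z
    have "(cmod (f z + g z))\<^sup>2 \<le> (cmod (f z) + cmod (g z))\<^sup>2"
      by (intro power_mono norm_triangle_ineq) auto
    also have "\<dots> = (cmod (f z))\<^sup>2 + (2 * (cmod (f z) * cmod (g z)) + (cmod (g z))\<^sup>2)"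
      by (simp add: power2_eq_square algebra_simps)
    finally have "ennreal ((cmod (f z + g z))\<^sup>2) \<le> ennreal ((cmod (f z))\<^sup>2 + (2 * (cmod (f z) * cmod (g z)) + (cmod (g z))\<^sup>2))"
      by (rule ennreal_leI)
    then show "ennreal ((cmod (f z + g z))\<^sup>2) \<le> ennreal ((cmod (f z))\<^sup>2) + (2 * ennreal (cmod (f z) * cmod (g z)) + ennreal ((cmod (g z))\<^sup>2))"
      by (simp add: ennreal_plus ennreal_mult)
  qed
  also have "\<dots> = ennreal ((\<N> f)\<^sup>2) + (2 * (\<integral>\<^sup>+z. ennreal (cmod (f z) * cmod (g z)) \<partial>\<mu>) + ennreal ((\<N> g)\<^sup>2))"
    by (simp add: nn_integral_add nn_integral_cmult nn_integral_fock assms)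
  also have "\<dots> \<le> ennreal ((\<N> f)\<^sup>2) + (2 * ennreal (\<N> f * \<N> g) + ennreal ((\<N> g)\<^sup>2))"
    by (intro add_mono mult_left_mono fock_Cauchy_Schwarz assms) auto
  also have "\<dots> = ennreal ((\<N> f)\<^sup>2 + (2 * (\<N> f * \<N> g) + (\<N> g)\<^sup>2))"
    using fock_norm_nonneg by (simp add: ennreal_plus ennreal_mult)
  also have "(\<N> f)\<^sup>2 + (2 * (\<N> f * \<N> g) + (\<N> g)\<^sup>2) = (\<N> f + \<N> g)\<^sup>2"
    by (simp add: power2_eq_square algebra_simps)
  finally have le: "(\<integral>\<^sup>+z. ennreal ((cmod (f z + g z))\<^sup>2) \<partial>\<mu>) \<le> ennreal ((\<N> f + \<N> g)\<^sup>2)" .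
  show mem: "(\<lambda>z. f z + g z) \<in> \<F>"
    by (rule fock_memI[OF holomorphic_on_add le]) (simp_all add: fock_holomorphic assms)
  show "\<N> (\<lambda>z. f z + g z) \<le> \<N> f + \<N> g"
    using fock_norm2_le[OF mem le zero_le_power2] by (rule power2_le_imp_le) simp_all
qed

lemma fock_scale:
  assumes "f \<in> \<F>"
  shows "(\<lambda>z. c * f z) \<in> \<F>" "\<N> (\<lambda>z. c * f z) = cmod c * \<N> f"
proof -
  show "(\<lambda>z. c * f z) \<in> \<F>" using assms
    by (simp add: fock_space_def norm_mult power_mult_distrib holomorphic_on_mult)
  have "(\<N> (\<lambda>z. c * f z))\<^sup>2 = (cmod c * \<N> f)\<^sup>2"
    by (simp add: fock_norm2 norm_mult power_mult_distrib)
  then show "\<N> (\<lambda>z. c * f z) = cmod c * \<N> f"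
    by (rule power2_eq_imp_eq) auto
qed

lemma fock_zero: "(\<lambda>z. 0) \<in> \<F>" "\<N> (\<lambda>z. 0) = 0"
  by (auto simp: fock_space_def fock_norm_def)

lemma fock_diff:
  assumes "f \<in> \<F>" "g \<in> \<F>"
  shows "(\<lambda>z. f z - g z) \<in> \<F>" "\<N> (\<lambda>z. f z - g z) \<le> \<N> f + \<N> g"
  using fock_add[OF assms(1) fock_scale(1)[OF assms(2), of "-1"]] fock_scale(2)[OF assms(2), of "-1"]
  by simp_all

lemma fock_norm_diff_ge:
  assumes "f \<in> \<F>" "g \<in> \<F>"
  shows "\<N> f - \<N> g \<le> \<N> (\<lambda>z. f z - g z)"
  using fock_add(2)[OF fock_diff(1)[OF assms] assms(2)] by simp

lemma fock_sum:
  assumes "finite A" "\<And>i. i \<in> A \<Longrightarrow> f i \<in> \<F>"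
  shows "(\<lambda>z. \<Sum>i\<in>A. f i z) \<in> \<F>" "\<N> (\<lambda>z. \<Sum>i\<in>A. f i z) \<le> (\<Sum>i\<in>A. \<N> (f i))"
proof -
  have "(\<lambda>z. \<Sum>i\<in>A. f i z) \<in> \<F> \<and> \<N> (\<lambda>z. \<Sum>i\<in>A. f i z) \<le> (\<Sum>i\<in>A. \<N> (f i))"
    using assms
  proof (induction rule: finite_induct)
    case (insert x A)
    then have IH: "(\<lambda>z. \<Sum>i\<in>A. f i z) \<in> \<F>" "\<N> (\<lambda>z. \<Sum>i\<in>A. f i z) \<le> (\<Sum>i\<in>A. \<N> (f i))" and "f x \<in> \<F>"
      by auto
    from fock_add[OF \<open>f x \<in> \<F>\<close> IH(1)] IH(2) insert.hyps show ?case by auto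
  qed (auto simp: fock_zero)
  then show "(\<lambda>z. \<Sum>i\<in>A. f i z) \<in> \<F>" "\<N> (\<lambda>z. \<Sum>i\<in>A. f i z) \<le> (\<Sum>i\<in>A. \<N> (f i))" by auto
qed

lemma fock_series:
  fixes a :: "nat \<Rightarrow> complex"
  assumes f: "\<And>z. (\<lambda>n. a n * z ^ n) sums f z"
  shows "f \<in> \<F> \<longleftrightarrow> summable (\<lambda>n. (cmod (a n))\<^sup>2 * \<omega> n)"
    and "f \<in> \<F> \<Longrightarrow> (\<lambda>n. (cmod (a n))\<^sup>2 * \<omega> n) sums (\<N> f)\<^sup>2"
proof -
  have hol: "f holomorphic_on UNIV" by (rule entire_power_series_holomorphic[OF f])
  have nn: "(cmod (a n))\<^sup>2 * \<omega> n \<ge> 0" for n using omega_pos[of n] by simp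
  note P = Parseval_fock[OF f alpha_pos m_pos]
  show iff: "f \<in> \<F> \<longleftrightarrow> summable (\<lambda>n. (cmod (a n))\<^sup>2 * \<omega> n)"
  proof
    assume "f \<in> \<F>"
    then show "summable (\<lambda>n. (cmod (a n))\<^sup>2 * \<omega> n)"
      using P nn_integral_fock[of f] by (intro summable_suminf_not_top nn) (metis ennreal_neq_top)
  next
    assume "summable (\<lambda>n. (cmod (a n))\<^sup>2 * \<omega> n)"
    then show "f \<in> \<F>" using P hol nn by (simp add: fock_space_iff suminf_ennreal2)
  qed
  assume f': "f \<in> \<F>"
  then have s: "summable (\<lambda>n. (cmod (a n))\<^sup>2 * \<omega> n)" using iff by simp
  have "ennreal ((\<N> f)\<^sup>2) = ennreal (\<Sum>n. (cmod (a n))\<^sup>2 * \<omega> n)"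
    using P nn_integral_fock[OF f'] s nn by (simp add: suminf_ennreal2)
  then show "(\<lambda>n. (cmod (a n))\<^sup>2 * \<omega> n) sums (\<N> f)\<^sup>2"
    using s nn by (subst (asm) ennreal_inj) (auto simp: suminf_nonneg summable_sums)
qed

text \<open>The kernel, on the diagonal, of the closed subspace of functions that vanish at the origin to order \<open>M\<close>.\<close>

definition kernel_tail :: "nat \<Rightarrow> real \<Rightarrow> real" where
  "kernel_tail M r = (\<Sum>n. r ^ (2 * (n + M)) / \<omega> (n + M))"

lemma summable_kernel: "r \<ge> 0 \<Longrightarrow> summable (\<lambda>n. r ^ (2 * n) / \<omega> n)"
  by (rule summable_fock_kernel[OF alpha_pos m_pos])

lemma kernel_tail_0: "kernel_tail 0 r = fock_kernel \<alpha> m r"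
  by (simp add: kernel_tail_def fock_kernel_def)

lemma kernel_tail_tendsto:
  assumes "r \<ge> 0" shows "(\<lambda>M. kernel_tail M r) \<longlonglongrightarrow> 0"
proof -
  have "kernel_tail M r = fock_kernel \<alpha> m r - (\<Sum>n<M. r ^ (2 * n) / \<omega> n)" for M
    using suminf_split_initial_segment[OF summable_kernel[OF assms], of M]
    by (simp add: kernel_tail_def fock_kernel_def)
  moreover have "(\<lambda>M. fock_kernel \<alpha> m r - (\<Sum>n<M. r ^ (2 * n) / \<omega> n)) \<longlonglongrightarrow> fock_kernel \<alpha> m r - fock_kernel \<alpha> m r"
    unfolding fock_kernel_def by (intro tendsto_intros summable_LIMSEQ summable_kernel assms)
  ultimately show ?thesis by simp
qed

lemma kernel_tail_mono:
  assumes "0 \<le> r" "r \<le> s" shows "kernel_tail M r \<le> kernel_tail M s"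
  unfolding kernel_tail_def
proof (rule suminf_le)
  show "r ^ (2 * (n + M)) / \<omega> (n + M) \<le> s ^ (2 * (n + M)) / \<omega> (n + M)" for n
    using assms omega_pos[of "n + M"] by (intro divide_right_mono power_mono) auto
qed (use assms summable_ignore_initial_segment[OF summable_kernel, of _ M] in auto)

lemma kernel_tail_nonneg: "r \<ge> 0 \<Longrightarrow> kernel_tail M r \<ge> 0"
  unfolding kernel_tail_def using summable_ignore_initial_segment[OF summable_kernel, of r M]
  by (intro suminf_nonneg) auto

text \<open>Cauchy-Schwarz in the weighted sequence space. The version with \<open>M > 0\<close> makes Taylor remainders
small, uniformly over the unit ball, on each fixed disc.\<close>

lemma point_evaluation_tail:
  fixes a :: "nat \<Rightarrow> complex"
  assumes f: "\<And>z. (\<lambda>n. a n * z ^ n) sums f z" and "f \<in> \<F>" and a0: "\<And>n. n < M \<Longrightarrow> a n = 0"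
  shows "(cmod (f z))\<^sup>2 \<le> kernel_tail M (cmod z) * (\<N> f)\<^sup>2"
proof -
  define r where "r = cmod z"
  define b where "b n = cmod (a n) * sqrt (\<omega> n)" for n
  define k where "k n = r ^ n / sqrt (\<omega> n)" for n
  have bk: "b n * k n = cmod (a n * z ^ n)" for n
    using omega_pos[of n] by (simp add: b_def k_def r_def norm_mult norm_power)
  have b2: "(b n)\<^sup>2 = (cmod (a n))\<^sup>2 * \<omega> n" for n
    using omega_pos[of n] by (simp add: b_def power_mult_distrib)
  have k2: "(k n)\<^sup>2 = r ^ (2 * n) / \<omega> n" for n
    using omega_pos[of n] by (simp add: k_def power_divide power_mult[symmetric] mult.commute)
  have part: "(cmod (\<Sum>n<P. a n * z ^ n))\<^sup>2 \<le> kernel_tail M r * (\<N> f)\<^sup>2" if "P \<ge> M" for P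
  proof -
    have "(\<Sum>n<P. a n * z ^ n) = (\<Sum>n\<in>{M..<P}. a n * z ^ n)"
      using a0 by (intro sum.mono_neutral_right) auto
    then have "cmod (\<Sum>n<P. a n * z ^ n) \<le> (\<Sum>n\<in>{M..<P}. b n * k n)"
      by (simp add: bk norm_sum)
    then have "(cmod (\<Sum>n<P. a n * z ^ n))\<^sup>2 \<le> (\<Sum>n\<in>{M..<P}. b n * k n)\<^sup>2"
      by (intro power_mono) auto
    also have "\<dots> \<le> (\<Sum>n\<in>{M..<P}. (b n)\<^sup>2) * (\<Sum>n\<in>{M..<P}. (k n)\<^sup>2)"
      by (rule Cauchy_Schwarz_ineq_sum)
    also have "(\<Sum>n\<in>{M..<P}. (b n)\<^sup>2) \<le> (\<N> f)\<^sup>2"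
      using fock_series(2)[OF f \<open>f \<in> \<F>\<close>] unfolding b2
      by (intro sum_le_sums) (auto simp: omega_pos less_imp_le)
    also have "(\<Sum>n\<in>{M..<P}. (k n)\<^sup>2) = (\<Sum>n<P - M. r ^ (2 * (n + M)) / \<omega> (n + M))"
      unfolding k2 using that sum.shift_bounds_nat_ivl[of "\<lambda>n. r ^ (2 * n) / \<omega> n" 0 M "P - M"]
      by (simp add: lessThan_atLeast0)
    also have "\<dots> \<le> kernel_tail M r"
      unfolding kernel_tail_def using summable_ignore_initial_segment[OF summable_kernel, of r M]
      by (intro sum_le_suminf) (auto simp: r_def)
    finally show ?thesis
      by (simp add: mult.commute mult_left_mono mult_right_mono sum_nonneg)
  qed
  have "(\<lambda>P. (cmod (\<Sum>n<P. a n * z ^ n))\<^sup>2) \<longlonglongrightarrow> (cmod (f z))\<^sup>2"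
    using f[of z] unfolding sums_def by (intro tendsto_intros)
  then show ?thesis
    by (rule LIMSEQ_le_const2) (use part r_def in auto)
qed

lemma point_evaluation:
  assumes "f \<in> \<F>"
  shows "(cmod (f z))\<^sup>2 \<le> fock_kernel \<alpha> m (cmod z) * (\<N> f)\<^sup>2"
  using point_evaluation_tail[OF taylor_coeff_sums[OF fock_holomorphic[OF assms]] assms, of 0]
  by (simp add: kernel_tail_0)

definition taylor_poly :: "nat \<Rightarrow> (complex \<Rightarrow> complex) \<Rightarrow> complex \<Rightarrow> complex" where
  "taylor_poly M f z = (\<Sum>n<M. taylor_coeff f n * z ^ n)"

lemma power_fock: "(\<lambda>z. z ^ n) \<in> \<F>" "(\<N> (\<lambda>z. z ^ n))\<^sup>2 = \<omega> n"
proof -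
  define a :: "nat \<Rightarrow> complex" where "a k = (if k = n then 1 else 0)" for k
  have "(\<lambda>k. a k * z ^ k) = (\<lambda>k. if k = n then z ^ k else 0)" for z
    by (auto simp: a_def)
  then have s: "(\<lambda>k. a k * z ^ k) sums z ^ n" for z
    using sums_single[of n "\<lambda>k. z ^ k"] by simp
  have "(\<lambda>k. (cmod (a k))\<^sup>2 * \<omega> k) = (\<lambda>k. if k = n then \<omega> k else 0)"
    by (auto simp: a_def)
  then have e: "(\<lambda>k. (cmod (a k))\<^sup>2 * \<omega> k) sums \<omega> n"
    using sums_single[of n \<omega>] by simp
  show *: "(\<lambda>z. z ^ n) \<in> \<F>" using fock_series(1)[OF s] sums_summable[OF e] by simp
  show "(\<N> (\<lambda>z. z ^ n))\<^sup>2 = \<omega> n" using sums_unique2[OF fock_series(2)[OF s *] e] .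
qed

lemma taylor_remainder:
  fixes M :: nat
  assumes f: "f \<in> \<F>"
  defines "R \<equiv> \<lambda>z. f z - taylor_poly M f z"
  shows "R \<in> \<F>" "\<N> R \<le> \<N> f" "(cmod (R z))\<^sup>2 \<le> kernel_tail M (cmod z) * (\<N> f)\<^sup>2"
proof -
  define a where "a n = (if n < M then 0 else taylor_coeff f n)" for n
  note tf = taylor_coeff_sums[OF fock_holomorphic[OF f]]
  have sR: "(\<lambda>n. a n * z ^ n) sums R z" for z
  proof -
    have "(\<lambda>n. (if n < M then taylor_coeff f n else 0) * z ^ n) sums (\<Sum>n<M. (if n < M then taylor_coeff f n else 0) * z ^ n)"
      by (rule finite_power_series_sums) auto
    from sums_diff[OF tf[of z] this]
    have "(\<lambda>n. taylor_coeff f n * z ^ n - (if n < M then taylor_coeff f n else 0) * z ^ n) sums R z"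
      by (simp add: R_def taylor_poly_def)
    moreover have "(\<lambda>n. taylor_coeff f n * z ^ n - (if n < M then taylor_coeff f n else 0) * z ^ n) = (\<lambda>n. a n * z ^ n)"
      by (auto simp: a_def)
    ultimately show ?thesis by simp
  qed
  have le: "(cmod (a n))\<^sup>2 * \<omega> n \<le> (cmod (taylor_coeff f n))\<^sup>2 * \<omega> n" for n
    using omega_pos[of n] by (simp add: a_def)
  note F = fock_series(2)[OF tf f]
  have "summable (\<lambda>n. (cmod (a n))\<^sup>2 * \<omega> n)"
    using le omega_pos by (intro summable_comparison_test'[OF sums_summable[OF F], of 0]) (simp add: less_imp_le)
  then show mem: "R \<in> \<F>" using fock_series(1)[OF sR] by simp
  have "(\<N> R)\<^sup>2 \<le> (\<N> f)\<^sup>2" by (rule sums_le[OF le fock_series(2)[OF sR mem] F])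
  then show RN: "\<N> R \<le> \<N> f" by (rule power2_le_imp_le) auto
  have "(cmod (R z))\<^sup>2 \<le> kernel_tail M (cmod z) * (\<N> R)\<^sup>2"
    by (rule point_evaluation_tail[OF sR mem]) (simp add: a_def)
  also have "\<dots> \<le> kernel_tail M (cmod z) * (\<N> f)\<^sup>2"
    using RN by (intro mult_left_mono power_mono kernel_tail_nonneg) auto
  finally show "(cmod (R z))\<^sup>2 \<le> kernel_tail M (cmod z) * (\<N> f)\<^sup>2" .
qed

lemma taylor_coeff_bound:
  assumes "f \<in> \<F>"
  shows "cmod (taylor_coeff f n) * sqrt (\<omega> n) \<le> \<N> f"
proof -
  note F = fock_series(2)[OF taylor_coeff_sums[OF fock_holomorphic[OF assms]] assms]
  have "(\<Sum>k\<in>{n}. (cmod (taylor_coeff f k))\<^sup>2 * \<omega> k) \<le> (\<N> f)\<^sup>2"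
    using F omega_pos by (intro sum_le_sums) (auto simp: less_imp_le)
  then have "(cmod (taylor_coeff f n) * sqrt (\<omega> n))\<^sup>2 \<le> (\<N> f)\<^sup>2"
    using omega_pos[of n] by (simp add: power_mult_distrib)
  then show ?thesis by (rule power2_le_imp_le) auto
qed

end

section \<open>Injective entire functions\<close>

text \<open>At infinity an injective entire function cannot have an essential singularity, because by the great
Picard theorem it would then take most values infinitely often. So it is a polynomial; its
derivative has no zeros and is therefore constant by the fundamental theorem of algebra.\<close>

lemma injective_entire_imp_affine:
  fixes f :: "complex \<Rightarrow> complex"
  assumes f: "f holomorphic_on UNIV" and inj: "inj f"
  obtains a b where "a \<noteq> 0" "\<And>z. f z = a * z + b"
proof -
  define h where "h z = f (inverse z)" for z
  have h: "h holomorphic_on (UNIV - {0})"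
    unfolding h_def using f
    by (intro holomorphic_on_compose[of inverse _ f, unfolded o_def] holomorphic_intros)
       (auto intro: holomorphic_on_subset)
  have "\<exists>l. (h \<longlongrightarrow> l) (at 0) \<or> ((inverse \<circ> h) \<longlongrightarrow> l) (at 0)"
  proof (rule ccontr)
    assume "\<not> ?thesis"
    then obtain c where c: "\<And>w. w \<noteq> c \<Longrightarrow> infinite {x. x \<in> UNIV - {0} \<and> h x = w}"
      using great_Picard_infinite[OF open_UNIV UNIV_I h] by blast
    have "finite {x. x \<in> UNIV - {0} \<and> h x = w}" for w
    proof -
      have "inj_on h (UNIV - {0})" using inj unfolding h_def inj_on_def by (metis UNIV_I inverse_eq_iff_eq)
      then have "{x. x \<in> UNIV - {0} \<and> h x = w} \<subseteq> {the_inv_into (UNIV - {0}) h w}"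
        by (auto simp: the_inv_into_f_f)
      then show ?thesis by (rule finite_subset) simp
    qed
    moreover obtain w where "w \<noteq> c" using ex_new_if_finite[of "{c}"] infinite_UNIV_char_0 by blast
    ultimately show False using c by blast
  qed
  then obtain l where "(h \<longlongrightarrow> l) (at 0) \<or> ((inverse \<circ> h) \<longlongrightarrow> l) (at 0)" by blast
  then have "(f \<longlongrightarrow> l) at_infinity \<or> ((inverse \<circ> f) \<longlongrightarrow> l) at_infinity"
    by (simp add: lim_at_infinity_0 o_def h_def[abs_def])
  moreover have "\<not> (f \<longlongrightarrow> l) at_infinity"
  proof
    assume "(f \<longlongrightarrow> l) at_infinity"
    then have "f 0 = f 1" using Liouville_weak[OF f] by metis
    then show False using injD[OF inj, of 0 1] by simp
  qed
  ultimately obtain a n where a: "\<And>z. f z = (\<Sum>i\<le>n. a i * z ^ i)"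
    using pole_at_infinity[OF f] by blast
  define c where "c i = a (Suc i) * of_nat (Suc i)" for i
  have der: "(f has_field_derivative (\<Sum>i<n. c i * z ^ i)) (at z)" for z
  proof -
    have "f = (\<lambda>z. \<Sum>i\<le>n. a i * z ^ i)" using a by blast
    moreover have "((\<lambda>z. \<Sum>i\<le>n. a i * z ^ i) has_field_derivative (\<Sum>i\<le>n. a i * (of_nat i * z ^ (i - 1)))) (at z)"
      by (auto intro!: derivative_eq_intros simp: mult_ac)
    moreover have "(\<Sum>i\<le>n. a i * (of_nat i * z ^ (i - 1))) = (\<Sum>i<n. c i * z ^ i)"
      by (simp add: sum.atMost_shift c_def mult_ac)
    ultimately show ?thesis by simp
  qed
  have nz: "(\<Sum>i<n. c i * z ^ i) \<noteq> 0" for z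
    using holomorphic_injective_imp_regular[OF f open_UNIV inj, of z] DERIV_imp_deriv[OF der[of z]] by simp
  have "n > 0" using nz[of 0] by (cases n) auto
  then obtain k where k: "n = Suc k" by (cases n) auto
  have c0: "c i = 0" if i: "i \<in> {1..k}" for i
  proof (rule ccontr)
    assume "c i \<noteq> 0"
    then have "c 0 = 0 \<or> (\<exists>i\<in>{1..k}. c i \<noteq> 0)" using i by blast
    then obtain z where "(\<Sum>i\<le>k. c i * z ^ i) = 0"
      by (rule fundamental_theorem_of_algebra)
    then show False using nz[of z] by (simp add: k lessThan_Suc_atMost)
  qed
  have der0: "(f has_field_derivative c 0) (at z)" for z
  proof -
    have "(\<Sum>i<n. c i * z ^ i) = (\<Sum>i\<in>{0}. c i * z ^ i)"
      using c0 by (intro sum.mono_neutral_right) (auto simp: k)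
    then show ?thesis using der[of z] by simp
  qed
  have "((\<lambda>z. f z - c 0 * z) has_field_derivative 0) (at z)" for z
    by (auto intro!: derivative_eq_intros der0)
  then have "\<exists>d. \<forall>z\<in>UNIV. f z - c 0 * z = d"
    by (intro has_field_derivative_zero_constant) auto
  then obtain d where d: "\<And>z. f z = c 0 * z + d" by (metis UNIV_I diff_add_cancel add.commute)
  have "c 0 \<noteq> 0" using d injD[OF inj, of 0 1] by auto
  then show thesis using d that by blast
qed

lemma entire_divide_root:
  fixes f :: "complex \<Rightarrow> complex"
  assumes f: "f holomorphic_on UNIV" and "f a = 0"
  obtains g where "g holomorphic_on UNIV" "\<And>z. f z = (z - a) * g z"
proof
  show "(\<lambda>z. if z = a then deriv f a else (f z - f a) / (z - a)) holomorphic_on UNIV"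
    using f by (intro pole_lemma) auto
  show "f z = (z - a) * (if z = a then deriv f a else (f z - f a) / (z - a))" for z
    using \<open>f a = 0\<close> by auto
qed

section \<open>Bounded weighted composition operators have affine symbols\<close>

context fock_parameters begin

lemma omega_0: "\<omega> 0 = 1"
proof -
  have "Gamma (2 / m) > 0" using m_pos by simp
  then show ?thesis using alpha_pos by (simp add: monomial_norm2_def)
qed

text \<open>Half of the exponential weight absorbs \<open>cmod z ^ (2 * n)\<close> at the cost of its maximum, which has the
size of \<open>n powr (2 * n / m)\<close>; the other half is a multiple of the measure with parameter \<open>\<alpha> / 2\<close>,
whose total mass is one.\<close>

lemma omega_le:
  assumes n: "n \<ge> 1"
  shows "\<omega> n \<le> 2 powr (2/m) * (4 * real n / (\<alpha> * m)) powr (2/m * real n)"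
proof -
  define S where "S = (4 * real n / (\<alpha> * m)) powr (2/m * real n)"
  interpret half: fock_parameters "\<alpha> / 2" m
    by unfold_locales (use alpha_pos m_pos in auto)
  have cA: "m * \<alpha> powr (2 / m) / (2 * pi * Gamma (2 / m))
      = 2 powr (2/m) * (m * (\<alpha>/2) powr (2 / m) / (2 * pi * Gamma (2 / m)))"
    using alpha_pos by (simp add: powr_divide)
  define c where "c = m * (\<alpha>/2) powr (2 / m) / (2 * pi * Gamma (2 / m))"
  have c: "c \<ge> 0" using m_pos alpha_pos by (simp add: c_def)
  have S: "cmod z ^ (2 * n) \<le> S * exp (\<alpha> / 2 * cmod z powr m)" for z
  proof (cases "z = 0")
    case False
    define y where "y = \<alpha> * m * (cmod z powr m) / (4 * real n)"
    have y: "y > 0" using False n alpha_pos m_pos by (simp add: y_def)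
    have y_le: "y \<le> exp y" using exp_ge_add_one_self[of y] by linarith
    have "cmod z powr m = 4 * real n / (\<alpha> * m) * y"
      using n alpha_pos m_pos by (simp add: y_def)
    have "cmod z ^ (2 * n) = (cmod z powr m) powr (2/m * real n)"
      using False m_pos by (simp add: powr_powr powr_realpow[symmetric])
    also have "\<dots> = S * y powr (2/m * real n)"
      unfolding \<open>cmod z powr m = _\<close> S_def using y n alpha_pos m_pos by (subst powr_mult) auto
    also have "y powr (2/m * real n) \<le> exp y powr (2/m * real n)"
      using y m_pos y_le by (intro powr_mono2) auto
    also have "exp y powr (2/m * real n) = exp (y * (2/m * real n))"
      by (simp add: powr_def mult.commute)
    also have "y * (2/m * real n) = \<alpha> / 2 * cmod z powr m"
      using n m_pos by (simp add: y_def)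
    finally show ?thesis by (simp add: S_def mult_left_mono)
  qed (use n in \<open>simp add: S_def power_0_left\<close>)
  have "ennreal (\<omega> n) = (\<integral>\<^sup>+z. ennreal (cmod z ^ (2 * n)) * ennreal (2 powr (2/m) * c * exp (- \<alpha> * cmod z powr m)) \<partial>lborel)"
    using nn_integral_norm_power_fock_measure[OF alpha_pos m_pos, of n]
    by (subst (asm) nn_integral_fock_measure) (auto simp: m_pos alpha_pos cA c_def[symmetric])
  also have "\<dots> \<le> (\<integral>\<^sup>+z. ennreal (2 powr (2/m) * S) * (ennreal (cmod z ^ (2 * 0)) * ennreal (c * exp (- (\<alpha>/2) * cmod z powr m))) \<partial>lborel)"
  proof (intro nn_integral_mono)
    fix z
    have "cmod z ^ (2 * n) * (2 powr (2/m) * c * exp (- \<alpha> * cmod z powr m))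
      \<le> (S * exp (\<alpha> / 2 * cmod z powr m)) * (2 powr (2/m) * c * exp (- \<alpha> * cmod z powr m))"
      using S[of z] c by (intro mult_right_mono) auto
    also have "\<dots> = 2 powr (2/m) * S * (c * (exp (\<alpha> / 2 * cmod z powr m) * exp (- \<alpha> * cmod z powr m)))"
      by simp
    also have "exp (\<alpha> / 2 * cmod z powr m) * exp (- \<alpha> * cmod z powr m) = exp (- (\<alpha>/2) * cmod z powr m)"
      by (simp add: exp_add[symmetric] field_simps)
    finally show "ennreal (cmod z ^ (2 * n)) * ennreal (2 powr (2/m) * c * exp (- \<alpha> * cmod z powr m))
      \<le> ennreal (2 powr (2/m) * S) * (ennreal (cmod z ^ (2 * 0)) * ennreal (c * exp (- (\<alpha>/2) * cmod z powr m)))"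
      using c by (simp add: ennreal_mult[symmetric] S_def)
  qed
  also have "\<dots> = ennreal (2 powr (2/m) * S) * (\<integral>\<^sup>+z. ennreal (cmod z ^ (2 * 0)) \<partial>fock_measure (\<alpha>/2) m)"
    by (subst nn_integral_fock_measure) (auto simp: m_pos alpha_pos nn_integral_cmult c_def)
  also have "\<dots> = ennreal (2 powr (2/m) * S)"
    using m_pos alpha_pos half.omega_0
    by (subst nn_integral_norm_power_fock_measure) auto
  finally show ?thesis by (subst (asm) ennreal_le_iff) (auto simp: S_def)
qed

lemma shifted_power_fock:
  "(\<lambda>z. (z - w) ^ n) \<in> \<F>" "(\<N> (\<lambda>z. (z - w) ^ n))\<^sup>2 \<le> 4 ^ n * (\<omega> n + (cmod w) ^ (2 * n))"
proof -
  have pw: "(cmod (z - w) ^ n)\<^sup>2 \<le> 4 ^ n * (cmod z ^ (2 * n) + cmod w ^ (2 * n))" for z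
  proof -
    define M where "M = max (cmod z) (cmod w)"
    have "cmod (z - w) \<le> 2 * M" using norm_triangle_ineq4[of z w] by (simp add: M_def)
    then have "cmod (z - w) ^ (2 * n) \<le> (2 * M) ^ (2 * n)" by (intro power_mono) auto
    also have "\<dots> = 4 ^ n * M ^ (2 * n)" by (simp add: power_mult_distrib power_mult)
    also have "M ^ (2 * n) \<le> cmod z ^ (2 * n) + cmod w ^ (2 * n)"
      by (simp add: M_def max_def)
    finally show ?thesis by (simp add: power_mult[symmetric] mult.commute)
  qed
  have one: "(\<integral>\<^sup>+z. ennreal (cmod w ^ (2 * n)) \<partial>\<mu>) = ennreal (cmod w ^ (2 * n))"
  proof -
    have "(\<integral>\<^sup>+z. ennreal (cmod w ^ (2 * n)) * ennreal (cmod z ^ (2 * 0)) \<partial>\<mu>) = ennreal (cmod w ^ (2 * n)) * ennreal (\<omega> 0)"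
      by (subst nn_integral_cmult) (auto simp: nn_integral_norm_power_fock_measure[OF alpha_pos m_pos, of 0, simplified])
    then show ?thesis by (simp add: omega_0)
  qed
  have "(\<integral>\<^sup>+z. ennreal ((cmod ((z - w) ^ n))\<^sup>2) \<partial>\<mu>)
     \<le> (\<integral>\<^sup>+z. ennreal (4 ^ n) * (ennreal (cmod z ^ (2 * n)) + ennreal (cmod w ^ (2 * n))) \<partial>\<mu>)"
    using pw by (intro nn_integral_mono) (simp add: norm_power ennreal_mult[symmetric] ennreal_plus[symmetric] del: ennreal_plus)
  also have "\<dots> = ennreal (4 ^ n) * (ennreal (\<omega> n) + ennreal (cmod w ^ (2 * n)))"
    by (subst nn_integral_cmult, simp, subst nn_integral_add)
       (auto simp only: one nn_integral_norm_power_fock_measure[OF alpha_pos m_pos], auto)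
  also have "\<dots> = ennreal (4 ^ n * (\<omega> n + (cmod w) ^ (2 * n)))"
    by (simp add: ennreal_mult[symmetric] ennreal_plus[symmetric] del: ennreal_plus)
  finally have le: "(\<integral>\<^sup>+z. ennreal ((cmod ((z - w) ^ n))\<^sup>2) \<partial>\<mu>) \<le> \<dots>" .
  show mem: "(\<lambda>z. (z - w) ^ n) \<in> \<F>"
    by (rule fock_memI[OF _ le]) (intro holomorphic_intros)
  show "(\<N> (\<lambda>z. (z - w) ^ n))\<^sup>2 \<le> 4 ^ n * (\<omega> n + (cmod w) ^ (2 * n))"
    by (rule fock_norm2_le[OF mem le]) simp
qed

lemma fock_boundedE:
  assumes "fock_bounded \<alpha> m T"
  obtains B where "B > 0" "\<And>f. f \<in> \<F> \<Longrightarrow> \<N> (T f) \<le> B * \<N> f"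
proof -
  obtain C where C: "\<And>f. f \<in> \<F> \<Longrightarrow> \<N> (T f) \<le> C * \<N> f"
    using assms by (auto simp: fock_bounded_def)
  have "\<N> (T f) \<le> (\<bar>C\<bar> + 1) * \<N> f" if "f \<in> \<F>" for f
  proof -
    have "C * \<N> f \<le> (\<bar>C\<bar> + 1) * \<N> f" by (intro mult_right_mono) auto
    with C[OF that] show ?thesis by simp
  qed
  then show thesis using that[of "\<bar>C\<bar> + 1"] by simp
qed

lemma fock_bounded_mem: "fock_bounded \<alpha> m T \<Longrightarrow> f \<in> \<F> \<Longrightarrow> T f \<in> \<F>"
  by (simp add: fock_bounded_def fock_linear_def)

text \<open>The last factor on the right
decays faster than every geometric sequence, whereas the left side is geometric in \<open>n\<close>, so the
conclusion is contradictory unless \<open>\<psi>\<close> or \<open>g\<close> vanishes at \<open>p\<close>. Each of the two zeros contributes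
\<open>n powr (- (2 / m * n))\<close> to this decay (for squared moduli), and the norm of \<open>(u - w) ^ n\<close> takes one of these
factors back: a single zero would not suffice.\<close>

lemma two_preimages_growth:
  assumes bd: "fock_bounded \<alpha> m (weighted_comp \<psi> \<phi>)"
    and \<phi>: "\<And>z. \<phi> z - w = (z - z1) * (z - z2) * g z"
    and \<psi>: "\<psi> holomorphic_on UNIV" and g: "g holomorphic_on UNIV"
  shows "\<exists>A>0. \<exists>q>0. \<exists>s. \<forall>\<^sub>F n in sequentially.
     (cmod (\<psi> p))\<^sup>2 * ((cmod (g p))\<^sup>2) ^ n \<le> A * (\<alpha> * n) powr s * q ^ n * real n powr (- (2/m * n))"
proof -
  obtain B where B: "B > 0" "\<And>f. f \<in> \<F> \<Longrightarrow> \<N> (weighted_comp \<psi> \<phi> f) \<le> B * \<N> f"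
    using fock_boundedE[OF bd] by blast
  obtain C where C: "C > 0" and KC: "\<And>r. r > 0 \<Longrightarrow> \<alpha> * r powr m \<ge> 1 \<Longrightarrow>
     fock_kernel \<alpha> m r \<le> C * ((\<alpha> * r powr m) powr (1 - 2 / m) * exp (\<alpha> * r powr m))"
    using fock_kernel_asymp[OF alpha_pos m_pos] by blast
  define W where "W = 1 + (cmod w)\<^sup>2"
  define b where "b = 2 / m"
  have b: "b > 0" using m_pos by (simp add: b_def)
  define L where "L = (4 / (\<alpha> * m)) powr b"
  have L: "L > 0" using alpha_pos m_pos by (simp add: L_def)
  define q where "q = exp \<alpha> * 64 * (L + W)"
  have W: "W \<ge> 1" by (simp add: W_def)
  have q: "q > 0" using L W by (simp add: q_def)
  define A where "A = C * B\<^sup>2 * (2 powr b + 1)"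
  have A: "A > 0" using C B by (simp add: A_def add_pos_pos)
  have "\<forall>\<^sub>F n in sequentially. n \<ge> 1 \<and> \<alpha> * real n > 1 \<and> real n powr (1/m) > 2 * cmod z1 \<and>
     real n powr (1/m) > 2 * cmod z2 \<and> real n powr (1/m) > cmod p"
  proof -
    have t: "filterlim (\<lambda>n. real n powr (1/m)) at_top sequentially" using m_pos by real_asymp
    have t2: "filterlim (\<lambda>n. \<alpha> * real n) at_top sequentially" using alpha_pos by real_asymp
    show ?thesis using t t2 by (simp add: eventually_conj_iff filterlim_at_top_dense eventually_ge_at_top)
  qed
  then have "\<forall>\<^sub>F n in sequentially.
     (cmod (\<psi> p))\<^sup>2 * ((cmod (g p))\<^sup>2) ^ n \<le> A * (\<alpha> * n) powr (1 - b) * q ^ n * real n powr (- (b * n))"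
  proof (rule eventually_mono, safe)
    fix n :: nat
    assume n: "n \<ge> 1" "\<alpha> * real n > 1" "real n powr (1/m) > 2 * cmod z1"
      "real n powr (1/m) > 2 * cmod z2" "real n powr (1/m) > cmod p"
    \<comment> \<open>on this circle the weight \<open>exp (\<alpha> * r powr m)\<close> is only geometric in \<open>n\<close>\<close>
    define r where "r = real n powr (1/m)"
    have r: "r > 0" using n by (simp add: r_def)
    have rm: "r powr m = real n" using n m_pos by (simp add: r_def powr_powr)
    have r4: "r ^ (4 * n) = real n powr (b * n) * real n powr (b * n)"
      using n m_pos by (simp add: r_def powr_realpow[symmetric] powr_powr powr_add[symmetric] b_def)
    define f where "f z = (z - w) ^ n" for z :: complex
    have f: "f \<in> \<F>" "(\<N> f)\<^sup>2 \<le> 4 ^ n * (\<omega> n + (cmod w) ^ (2 * n))"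
      unfolding f_def by (rule shifted_power_fock)+
    define T where "T = weighted_comp \<psi> \<phi> f"
    have T: "T \<in> \<F>" unfolding T_def by (rule fock_bounded_mem[OF bd f(1)])
    define K where "K = C * ((\<alpha> * n) powr (1 - b) * exp (\<alpha> * n))"
    have K: "K \<ge> 0" using C by (simp add: K_def)
    have w2: "cmod w ^ (2 * n) \<le> W ^ n * real n powr (b * n)"
    proof -
      have "cmod w ^ (2 * n) = ((cmod w)\<^sup>2) ^ n" by (simp add: power_mult)
      also have "\<dots> \<le> W ^ n" by (intro power_mono) (auto simp: W_def)
      also have "\<dots> \<le> W ^ n * real n powr (b * n)"
        using W n b by (simp add: ge_one_powr_ge_zero)
      finally show ?thesis .
    qed
    have om: "\<omega> n \<le> 2 powr b * L ^ n * real n powr (b * n)"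
    proof -
      have "(4 * real n / (\<alpha> * m)) powr (b * real n) = (4 / (\<alpha> * m) * real n) powr (b * real n)" by simp
      also have "\<dots> = (4 / (\<alpha> * m)) powr (b * real n) * real n powr (b * n)"
        using alpha_pos m_pos by (subst powr_mult) auto
      also have "(4 / (\<alpha> * m)) powr (b * real n) = L ^ n"
        using L by (simp add: L_def powr_powr[symmetric] powr_realpow)
      finally show ?thesis using omega_le[OF n(1)] by (simp add: b_def mult_ac)
    qed
    have sm: "\<omega> n + cmod w ^ (2 * n) \<le> (2 powr b + 1) * (L + W) ^ n * real n powr (b * n)"
    proof -
      have "L ^ n \<le> (L + W) ^ n" "W ^ n \<le> (L + W) ^ n" using L W by (auto intro!: power_mono)
      then have "2 powr b * L ^ n + W ^ n \<le> 2 powr b * (L + W) ^ n + (L + W) ^ n"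
        by (intro add_mono mult_left_mono) auto
      then have "(2 powr b * L ^ n + W ^ n) * real n powr (b * n) \<le> (2 powr b * (L + W) ^ n + (L + W) ^ n) * real n powr (b * n)"
        by (rule mult_right_mono) simp
      then show ?thesis using om w2 by (simp add: algebra_simps)
    qed
    have circ: "(cmod (T z))\<^sup>2 \<le> K * (B\<^sup>2 * (4 ^ n * (\<omega> n + cmod w ^ (2 * n))))" if "cmod z = r" for z
    proof -
      have "(cmod (T z))\<^sup>2 \<le> fock_kernel \<alpha> m r * (\<N> T)\<^sup>2"
        using point_evaluation[OF T, of z] that by simp
      also have "\<dots> \<le> K * (\<N> T)\<^sup>2"
        using KC[OF r] n rm by (intro mult_right_mono) (auto simp: K_def b_def)
      also have "(\<N> T)\<^sup>2 \<le> (B * \<N> f)\<^sup>2"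
        unfolding T_def by (intro power_mono B f) simp
      also have "(B * \<N> f)\<^sup>2 \<le> B\<^sup>2 * (4 ^ n * (\<omega> n + cmod w ^ (2 * n)))"
        unfolding power_mult_distrib using f(2) by (intro mult_left_mono) auto
      finally show ?thesis using K by (simp add: mult_left_mono)
    qed
    \<comment> \<open>dividing by \<open>(z - z1) ^ n * (z - z2) ^ n\<close>, whose modulus is at least \<open>(r / 2) ^ (2 * n)\<close> on the circle\<close>
    define E where "E = K * (B\<^sup>2 * (4 ^ n * (\<omega> n + cmod w ^ (2 * n)))) * 16 ^ n / r ^ (4 * n)"
    have E: "E \<ge> 0" using K r by (simp add: E_def)
    have "cmod (\<psi> p * g p ^ n) \<le> sqrt E"
    proof (rule maximum_modulus_frontier[of "\<lambda>z. \<psi> z * g z ^ n" "ball 0 r"])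
      show "(\<lambda>z. \<psi> z * g z ^ n) holomorphic_on interior (ball 0 r)"
        using \<psi> g by (intro holomorphic_intros) (auto intro: holomorphic_on_subset)
      show "continuous_on (closure (ball 0 r)) (\<lambda>z. \<psi> z * g z ^ n)"
        using \<psi> g by (intro continuous_intros) (auto intro!: holomorphic_on_imp_continuous_on intro: holomorphic_on_subset)
      show "p \<in> ball 0 r" using n by (simp add: r_def)
      fix z assume "z \<in> frontier (ball (0::complex) r)"
      then have z: "cmod z = r" using r by simp
      have "cmod (z - z1) \<ge> r / 2" "cmod (z - z2) \<ge> r / 2"
        using norm_triangle_ineq2[of z z1] norm_triangle_ineq2[of z z2] z n by (auto simp: r_def)
      then have "r / 2 * (r / 2) \<le> cmod (z - z1) * cmod (z - z2)"
        using r by (intro mult_mono) auto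
      then have "(r / 2 * (r / 2)) ^ (2 * n) \<le> (cmod (z - z1) * cmod (z - z2)) ^ (2 * n)"
        using r by (intro power_mono) auto
      moreover have "(r / 2 * (r / 2)) ^ (2 * n) = r ^ (4 * n) / 16 ^ n"
        by (simp add: power_mult_distrib power_mult power_divide power2_eq_square[symmetric])
      ultimately have lo: "r ^ (4 * n) / 16 ^ n \<le> (cmod (z - z1) * cmod (z - z2)) ^ (2 * n)" by simp
      have "T z = \<psi> z * ((z - z1) * (z - z2) * g z) ^ n"
        by (simp add: T_def weighted_comp_def f_def \<phi>)
      then have "(cmod (T z))\<^sup>2 = (cmod (z - z1) * cmod (z - z2)) ^ (2 * n) * (cmod (\<psi> z * g z ^ n))\<^sup>2"
        by (simp add: norm_mult norm_power power_mult_distrib power_mult[symmetric] mult_ac)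
      also have "\<dots> \<ge> r ^ (4 * n) / 16 ^ n * (cmod (\<psi> z * g z ^ n))\<^sup>2"
        using lo by (intro mult_right_mono) auto
      finally have "r ^ (4 * n) / 16 ^ n * (cmod (\<psi> z * g z ^ n))\<^sup>2 \<le> K * (B\<^sup>2 * (4 ^ n * (\<omega> n + cmod w ^ (2 * n))))"
        using circ[OF z] by simp
      then have "(cmod (\<psi> z * g z ^ n))\<^sup>2 \<le> E"
        using r by (simp add: E_def field_simps)
      then show "cmod (\<psi> z * g z ^ n) \<le> sqrt E" by (rule real_le_rsqrt)
    qed simp
    then have "(cmod (\<psi> p * g p ^ n))\<^sup>2 \<le> (sqrt E)\<^sup>2" by (intro power_mono) auto
    then have "(cmod (\<psi> p))\<^sup>2 * ((cmod (g p))\<^sup>2) ^ n \<le> E"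
      using E by (simp add: norm_mult norm_power power_mult_distrib power_mult[symmetric] mult.commute)
    also have "E \<le> K * (B\<^sup>2 * (4 ^ n * ((2 powr b + 1) * (L + W) ^ n * real n powr (b * n)))) * 16 ^ n / r ^ (4 * n)"
      unfolding E_def using K r sm by (intro divide_right_mono mult_right_mono mult_left_mono) auto
    also have "\<dots> = A * (\<alpha> * n) powr (1 - b) * q ^ n * (real n powr (b * n) / r ^ (4 * n))"
    proof -
      have e: "exp (\<alpha> * n) = exp \<alpha> ^ n" using exp_of_nat2_mult[of \<alpha> n] by simp
      have "(64::real) ^ n = 4 ^ n * 16 ^ n" by (simp flip: power_mult_distrib)
      then have "q ^ n = exp \<alpha> ^ n * (4 ^ n * 16 ^ n) * (L + W) ^ n"
        by (simp add: q_def power_mult_distrib)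
      then show ?thesis by (simp add: K_def A_def e)
    qed
    also have "real n powr (b * n) / r ^ (4 * n) = real n powr (- (b * n))"
      using n unfolding r4 by (simp add: powr_minus field_simps)
    finally show "(cmod (\<psi> p))\<^sup>2 * ((cmod (g p))\<^sup>2) ^ n \<le> A * (\<alpha> * n) powr (1 - b) * q ^ n * real n powr (- (b * n))" .
  qed
  then show ?thesis using A q unfolding b_def by blast
qed

text \<open>Two preimages of one value are divided out, and \<open>two_preimages_growth\<close> is used at a point where
neither \<open>\<psi>\<close> nor the remaining factor vanishes; by the identity theorem such a point exists.\<close>

lemma bounded_weighted_comp_imp_inj:
  assumes bd: "fock_bounded \<alpha> m (weighted_comp \<psi> \<phi>)"
    and \<psi>: "\<psi> holomorphic_on UNIV" and \<phi>: "\<phi> holomorphic_on UNIV"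
    and nc: "\<not> \<phi> constant_on UNIV" and nz: "\<psi> p \<noteq> 0"
  shows "inj \<phi>"
proof (rule ccontr)
  assume "\<not> inj \<phi>"
  then obtain z1 z2 where z: "z1 \<noteq> z2" "\<phi> z1 = \<phi> z2" by (auto simp: inj_def)
  define w where "w = \<phi> z1"
  obtain g1 where g1: "g1 holomorphic_on UNIV" "\<And>z. \<phi> z - w = (z - z1) * g1 z"
  proof (rule entire_divide_root[of "\<lambda>z. \<phi> z - w" z1])
    show "(\<lambda>z. \<phi> z - w) holomorphic_on UNIV" using \<phi> by (intro holomorphic_intros)
  qed (simp_all add: w_def)
  have "g1 z2 = 0" using g1(2)[of z2] z by (auto simp: w_def)
  then obtain g where g: "g holomorphic_on UNIV" "\<And>z. g1 z = (z - z2) * g z"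
    using entire_divide_root[OF g1(1)] by blast
  have fac: "\<phi> z - w = (z - z1) * (z - z2) * g z" for z using g1(2) g(2) by (simp add: mult_ac)
  have "\<exists>p. \<psi> p \<noteq> 0 \<and> g p \<noteq> 0"
  proof (rule ccontr)
    assume c: "\<not> ?thesis"
    have op: "open {z. \<psi> z \<noteq> 0}"
      using \<psi> by (intro open_Collect_neq holomorphic_on_imp_continuous_on) auto
    have "g z = 0" for z
      using analytic_continuation_open[of "{z. \<psi> z \<noteq> 0}" UNIV g "\<lambda>_. 0" z] op c nz g(1) by auto
    then have "\<phi> z = w" for z using fac[of z] by simp
    then show False using nc by (auto simp: constant_on_def)
  qed
  then obtain u where u: "\<psi> u \<noteq> 0" "g u \<noteq> 0" by blast
  define \<gamma> where "\<gamma> = (cmod (g u))\<^sup>2"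
  define \<delta> where "\<delta> = (cmod (\<psi> u))\<^sup>2"
  have pos: "\<gamma> > 0" "\<delta> > 0" using u by (auto simp: \<gamma>_def \<delta>_def)
  obtain A q s where Aq: "A > 0" "q > 0" and ev: "\<forall>\<^sub>F n in sequentially.
     \<delta> * \<gamma> ^ n \<le> A * (\<alpha> * n) powr s * q ^ n * real n powr (- (2/m * n))"
    using two_preimages_growth[OF bd fac \<psi> g(1), of u] unfolding \<gamma>_def \<delta>_def by blast
  define Q where "Q = q / \<gamma>"
  define b where "b = 2 / m"
  have Q: "Q > 0" "b > 0" using Aq pos m_pos by (auto simp: Q_def b_def)
  have "(\<lambda>n. A * (\<alpha> * n) powr s * Q ^ n * real n powr (- (b * n))) \<longlonglongrightarrow> 0"
  proof -
    have "(\<lambda>n. A * exp (s * ln (\<alpha> * real n) + real n * ln Q - b * real n * ln (real n))) \<longlonglongrightarrow> 0"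
      using Q(2) alpha_pos by real_asymp
    moreover have "\<forall>\<^sub>F n in sequentially. A * exp (s * ln (\<alpha> * real n) + real n * ln Q - b * real n * ln (real n))
        = A * (\<alpha> * n) powr s * Q ^ n * real n powr (- (b * n))"
      using eventually_gt_at_top[of 0]
    proof eventually_elim
      case (elim n)
      have "exp (real n * ln Q) = Q ^ n" using Q by (simp add: exp_of_nat_mult)
      then show ?case using elim alpha_pos by (simp add: powr_def exp_diff exp_add exp_minus field_simps)
    qed
    ultimately show ?thesis by (rule Lim_transform_eventually)
  qed
  then have "\<forall>\<^sub>F n in sequentially. A * (\<alpha> * n) powr s * Q ^ n * real n powr (- (b * n)) < \<delta>"
    using pos by (simp add: order_tendstoD)
  with ev have "\<forall>\<^sub>F n::nat in sequentially. False"
  proof eventually_elim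
    case (elim n)
    have "\<delta> * \<gamma> ^ n \<le> (A * (\<alpha> * n) powr s * Q ^ n * real n powr (- (b * n))) * \<gamma> ^ n"
      using elim(1) pos by (simp add: Q_def b_def power_divide)
    then have "\<delta> \<le> A * (\<alpha> * n) powr s * Q ^ n * real n powr (- (b * n))"
      using pos by (simp add: mult_le_cancel_right)
    then show False using elim(2) by simp
  qed
  then show False by simp
qed

end

section \<open>Compact operators and the essential norm\<close>

context fock_parameters begin

lemma fock_linear_mem: "fock_linear \<alpha> m T \<Longrightarrow> f \<in> \<F> \<Longrightarrow> T f \<in> \<F>"
  by (simp add: fock_linear_def)

lemma fock_linear_lincomb:
  "fock_linear \<alpha> m T \<Longrightarrow> f \<in> \<F> \<Longrightarrow> g \<in> \<F> \<Longrightarrow>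
    T (\<lambda>z. a * f z + b * g z) = (\<lambda>z. a * T f z + b * T g z)"
  by (simp add: fock_linear_def)

lemma fock_linear_zero: "fock_linear \<alpha> m T \<Longrightarrow> T (\<lambda>z. 0) = (\<lambda>z. 0)"
  using fock_linear_lincomb[OF _ fock_zero(1) fock_zero(1), of T 0 0] by simp

lemma fock_linear_scale: "fock_linear \<alpha> m T \<Longrightarrow> f \<in> \<F> \<Longrightarrow> T (\<lambda>z. a * f z) = (\<lambda>z. a * T f z)"
  using fock_linear_lincomb[of T f f a 0] by simp

lemma fock_linear_sum:
  assumes T: "fock_linear \<alpha> m T" and "finite A" "\<And>i. i \<in> A \<Longrightarrow> f i \<in> \<F>"
  shows "T (\<lambda>z. \<Sum>i\<in>A. f i z) = (\<lambda>z. \<Sum>i\<in>A. T (f i) z)"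
  using assms(2,3)
proof (induction rule: finite_induct)
  case (insert x A)
  have "T (\<lambda>z. 1 * f x z + 1 * (\<Sum>i\<in>A. f i z)) = (\<lambda>z. 1 * T (f x) z + 1 * T (\<lambda>z. \<Sum>i\<in>A. f i z) z)"
    using insert by (intro fock_linear_lincomb[OF T] fock_sum) auto
  then show ?case using insert by simp
qed (simp add: fock_linear_zero[OF T])

lemma fock_norm_zero_imp: 
  assumes "f \<in> \<F>" "\<N> f = 0" shows "f = (\<lambda>z. 0)"
  using point_evaluation[OF assms(1)] assms(2) by auto

text \<open>Unit vectors whose images have norms tending to infinity have no subsequence with convergent images.\<close>

lemma fock_compact_imp_bounded:
  assumes K: "fock_compact \<alpha> m K"
  obtains B where "B > 0" "\<And>f. f \<in> \<F> \<Longrightarrow> \<N> (K f) \<le> B * \<N> f"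
proof -
  have lin: "fock_linear \<alpha> m K" using K by (simp add: fock_compact_def)
  have "\<exists>B. \<forall>f\<in>\<F>. \<N> (K f) \<le> B * \<N> f"
  proof (rule ccontr)
    assume "\<not> ?thesis"
    then have "\<forall>n::nat. \<exists>f\<in>\<F>. \<N> (K f) > real n * \<N> f" by (meson not_le)
    then obtain f where f: "\<And>n. f n \<in> \<F>" "\<And>n. \<N> (K (f n)) > real n * \<N> (f n)" by metis
    have pos: "\<N> (f n) > 0" for n
    proof (rule ccontr)
      assume "\<not> \<N> (f n) > 0"
      then have 0: "\<N> (f n) = 0" using fock_norm_nonneg[of "f n"] by linarith
      then have "f n = (\<lambda>z. 0)" using f(1) fock_norm_zero_imp by blast
      then have "\<N> (K (f n)) = 0" using fock_linear_zero[OF lin] fock_zero by simp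
      with f(2)[of n] 0 show False by simp
    qed
    define F where "F n = (\<lambda>z. complex_of_real (1 / \<N> (f n)) * f n z)" for n
    have F: "F n \<in> \<F>" "\<N> (F n) \<le> 1" for n
      using fock_scale[OF f(1)[of n], of "complex_of_real (1 / \<N> (f n))"] pos[of n]
      by (simp_all add: F_def norm_divide)
    have KF: "\<N> (K (F n)) \<ge> real n" for n
    proof -
      have "K (F n) = (\<lambda>z. complex_of_real (1 / \<N> (f n)) * K (f n) z)"
        unfolding F_def by (rule fock_linear_scale[OF lin f(1)])
      then have "\<N> (K (F n)) = \<N> (K (f n)) / \<N> (f n)"
        using fock_scale(2)[OF fock_linear_mem[OF lin f(1)], of "complex_of_real (1 / \<N> (f n))" n] pos[of n]
        by (simp add: norm_divide)
      then show ?thesis using f(2)[of n] pos[of n] by (simp add: pos_le_divide_eq)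
    qed
    obtain g r where g: "g \<in> \<F>" and r: "strict_mono r"
      and lim: "(\<lambda>n. \<N> (\<lambda>z. K (F (r n)) z - g z)) \<longlonglongrightarrow> 0"
      using K F unfolding fock_compact_def by blast
    have "\<forall>\<^sub>F n in sequentially. \<N> (\<lambda>z. K (F (r n)) z - g z) < 1"
      using lim by (rule order_tendstoD) simp
    moreover have "\<forall>\<^sub>F n::nat in sequentially. real n > 1 + \<N> g"
      using filterlim_real_sequentially by (simp add: filterlim_at_top_dense)
    ultimately have "\<forall>\<^sub>F n::nat in sequentially. False"
    proof eventually_elim
      case (elim n)
      have "\<N> (K (F (r n))) - \<N> g \<le> \<N> (\<lambda>z. K (F (r n)) z - g z)"
        by (intro fock_norm_diff_ge fock_linear_mem[OF lin] F g)
      moreover have "real n \<le> real (r n)" using seq_suble[OF r, of n] by simp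
      ultimately show False using elim KF[of "r n"] by linarith
    qed
    then show False by simp
  qed
  then obtain B where B: "\<And>f. f \<in> \<F> \<Longrightarrow> \<N> (K f) \<le> B * \<N> f" by blast
  have "\<N> (K f) \<le> (\<bar>B\<bar> + 1) * \<N> f" if "f \<in> \<F>" for f
  proof -
    have "B * \<N> f \<le> (\<bar>B\<bar> + 1) * \<N> f" by (intro mult_right_mono) auto
    with B[OF that] show ?thesis by simp
  qed
  then show thesis using that[of "\<bar>B\<bar> + 1"] by simp
qed

text \<open>Both operators are bounded, so the real supremum defining the operator norm of the difference is over
a set that is bounded above.\<close>

lemma onorm_diff_compact_upper:
  assumes T: "fock_bounded \<alpha> m T" and K: "fock_compact \<alpha> m K"
    and f: "f \<in> \<F>" "\<N> f \<le> 1"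
  shows "\<N> (\<lambda>z. T f z - K f z) \<le> fock_onorm \<alpha> m (\<lambda>f z. T f z - K f z)"
proof -
  obtain A where A: "A > 0" "\<And>f. f \<in> \<F> \<Longrightarrow> \<N> (T f) \<le> A * \<N> f" using fock_boundedE[OF T] by blast
  obtain B where B: "B > 0" "\<And>f. f \<in> \<F> \<Longrightarrow> \<N> (K f) \<le> B * \<N> f" using fock_compact_imp_bounded[OF K] by blast
  have lin: "fock_linear \<alpha> m T" "fock_linear \<alpha> m K" using T K by (auto simp: fock_bounded_def fock_compact_def)
  have "\<N> (\<lambda>z. T g z - K g z) \<le> A + B" if "g \<in> \<F>" "\<N> g \<le> 1" for g
  proof -
    have "\<N> (\<lambda>z. T g z - K g z) \<le> \<N> (T g) + \<N> (K g)"
      using fock_diff(2) fock_linear_mem lin that by blast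
    also have "\<dots> \<le> A * 1 + B * 1"
      using A(2)[OF that(1)] B(2)[OF that(1)] mult_left_mono[OF that(2), of A] mult_left_mono[OF that(2), of B] A(1) B(1)
      by linarith
    finally show ?thesis by simp
  qed
  then show ?thesis unfolding fock_onorm_def
    using f by (intro cSUP_upper) (auto intro!: bdd_aboveI2[of _ _ "A + B"])
qed

lemma onorm_le:
  assumes "\<And>f. f \<in> \<F> \<Longrightarrow> \<N> f \<le> 1 \<Longrightarrow> \<N> (T f) \<le> b"
  shows "fock_onorm \<alpha> m T \<le> b"
proof -
  have "(\<lambda>z. 0) \<in> {f \<in> \<F>. \<N> f \<le> 1}" using fock_zero by simp
  then show ?thesis unfolding fock_onorm_def using assms by (intro cSUP_least) auto
qed

lemma onorm_diff_compact_nonneg: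
  assumes "fock_bounded \<alpha> m T" "fock_compact \<alpha> m K"
  shows "0 \<le> fock_onorm \<alpha> m (\<lambda>f z. T f z - K f z)"
  using onorm_diff_compact_upper[OF assms fock_zero(1)] fock_zero(2)
    fock_norm_nonneg[of "\<lambda>z. T (\<lambda>z. 0) z - K (\<lambda>z. 0) z"] by linarith

lemma ess_norm_le:
  assumes T: "fock_bounded \<alpha> m T" and K: "fock_compact \<alpha> m K"
    and le: "\<And>f. f \<in> \<F> \<Longrightarrow> \<N> f \<le> 1 \<Longrightarrow> \<N> (\<lambda>z. T f z - K f z) \<le> b"
  shows "fock_ess_norm \<alpha> m T \<le> b"
proof -
  have "fock_ess_norm \<alpha> m T \<le> fock_onorm \<alpha> m (\<lambda>f z. T f z - K f z)"
    unfolding fock_ess_norm_def using K onorm_diff_compact_nonneg[OF T]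
    by (intro cINF_lower) (auto intro!: bdd_belowI2[of _ 0])
  also have "\<dots> \<le> b" using le by (rule onorm_le)
  finally show ?thesis .
qed

lemma compact_rank_one:
  assumes h: "h \<in> \<F>"
    and lin: "\<And>f g a b. f \<in> \<F> \<Longrightarrow> g \<in> \<F> \<Longrightarrow> l (\<lambda>z. a * f z + b * g z) = a * l f + b * l g"
    and bd: "\<And>f. f \<in> \<F> \<Longrightarrow> cmod (l f) \<le> B * \<N> f"
  shows "fock_compact \<alpha> m (\<lambda>f z. l f * h z)"
  unfolding fock_compact_def
proof (intro conjI allI impI)
  show "fock_linear \<alpha> m (\<lambda>f z. l f * h z)"
    unfolding fock_linear_def using fock_scale(1)[OF h] by (simp add: lin distrib_right mult.assoc)
  fix F :: "nat \<Rightarrow> complex \<Rightarrow> complex"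
  assume F: "\<forall>n. F n \<in> \<F> \<and> \<N> (F n) \<le> 1"
  have "cmod (l (F n)) \<le> \<bar>B\<bar>" for n
  proof -
    have "cmod (l (F n)) \<le> B * \<N> (F n)" using bd F by blast
    also have "\<dots> \<le> \<bar>B\<bar> * 1" using F by (intro mult_mono) auto
    finally show ?thesis by simp
  qed
  then have "bounded (range (\<lambda>n. l (F n)))" by (auto simp: bounded_iff)
  then obtain c r where r: "strict_mono (r :: nat \<Rightarrow> nat)" and c: "((\<lambda>n. l (F n)) \<circ> r) \<longlonglongrightarrow> c"
    using bounded_imp_convergent_subsequence by blast
  show "\<exists>g\<in>\<F>. \<exists>r. strict_mono r \<and> (\<lambda>n. \<N> (\<lambda>z. l (F (r n)) * h z - g z)) \<longlonglongrightarrow> 0"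
  proof (intro bexI[of _ "\<lambda>z. c * h z"] exI[of _ r] conjI r fock_scale(1)[OF h])
    have "\<N> (\<lambda>z. l (F (r n)) * h z - c * h z) = cmod (l (F (r n)) - c) * \<N> h" for n
      using fock_scale(2)[OF h, of "l (F (r n)) - c"] by (simp add: algebra_simps)
    moreover have "(\<lambda>n. cmod (l (F (r n)) - c) * \<N> h) \<longlonglongrightarrow> cmod (c - c) * \<N> h"
      using c by (intro tendsto_intros) (simp add: o_def)
    ultimately show "(\<lambda>n. \<N> (\<lambda>z. l (F (r n)) * h z - c * h z)) \<longlonglongrightarrow> 0" by simp
  qed
qed

lemma compact_zero: "fock_compact \<alpha> m (\<lambda>f z. 0)"
  using compact_rank_one[OF fock_zero(1), of "\<lambda>_. 0" 0] by simp

lemma compact_add: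
  assumes "fock_compact \<alpha> m K" "fock_compact \<alpha> m L"
  shows "fock_compact \<alpha> m (\<lambda>f z. K f z + L f z)"
  unfolding fock_compact_def
proof (intro conjI allI impI)
  have lin: "fock_linear \<alpha> m K" "fock_linear \<alpha> m L" using assms by (auto simp: fock_compact_def)
  show "fock_linear \<alpha> m (\<lambda>f z. K f z + L f z)"
    unfolding fock_linear_def
  proof (intro conjI ballI allI)
    show "(\<lambda>z. K f z + L f z) \<in> \<F>" if "f \<in> \<F>" for f
      by (intro fock_add(1) fock_linear_mem[OF lin(1)] fock_linear_mem[OF lin(2)] that)
    show "(\<lambda>z. K (\<lambda>z. a * f z + b * g z) z + L (\<lambda>z. a * f z + b * g z) z)
        = (\<lambda>z. a * (K f z + L f z) + b * (K g z + L g z))" if "f \<in> \<F>" "g \<in> \<F>" for f g a b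
      unfolding fock_linear_lincomb[OF lin(1) that] fock_linear_lincomb[OF lin(2) that]
      by (simp add: algebra_simps)
  qed
  fix F :: "nat \<Rightarrow> complex \<Rightarrow> complex"
  assume F: "\<forall>n. F n \<in> \<F> \<and> \<N> (F n) \<le> 1"
  obtain g r where g: "g \<in> \<F>" and r: "strict_mono r" and gl: "(\<lambda>n. \<N> (\<lambda>z. K (F (r n)) z - g z)) \<longlonglongrightarrow> 0"
    using assms(1) F unfolding fock_compact_def by blast
  have "\<forall>n. F (r n) \<in> \<F> \<and> \<N> (F (r n)) \<le> 1" using F by simp
  then obtain h s where h: "h \<in> \<F>" and s: "strict_mono s" and hl: "(\<lambda>n. \<N> (\<lambda>z. L (F (r (s n))) z - h z)) \<longlonglongrightarrow> 0"
    using assms(2)[unfolded fock_compact_def, THEN conjunct2, THEN spec[of _ "\<lambda>n. F (r n)"]] by blast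
  show "\<exists>g\<in>\<F>. \<exists>r. strict_mono r \<and> (\<lambda>n. \<N> (\<lambda>z. K (F (r n)) z + L (F (r n)) z - g z)) \<longlonglongrightarrow> 0"
  proof (intro bexI[of _ "\<lambda>z. g z + h z"] exI[of _ "r \<circ> s"] conjI strict_mono_o r s fock_add(1) g h)
    have gl': "(\<lambda>n. \<N> (\<lambda>z. K (F (r (s n))) z - g z)) \<longlonglongrightarrow> 0"
      using LIMSEQ_subseq_LIMSEQ[OF gl s] by (simp add: o_def)
    have le: "\<N> (\<lambda>z. K (F (r (s n))) z + L (F (r (s n))) z - (g z + h z))
       \<le> \<N> (\<lambda>z. K (F (r (s n))) z - g z) + \<N> (\<lambda>z. L (F (r (s n))) z - h z)" for n
      using fock_add(2)[OF fock_diff(1)[OF fock_linear_mem[OF lin(1)] g] fock_diff(1)[OF fock_linear_mem[OF lin(2)] h], of "F (r (s n))" "F (r (s n))"] F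
      by (simp add: algebra_simps)
    have lim: "(\<lambda>n. \<N> (\<lambda>z. K (F (r (s n))) z - g z) + \<N> (\<lambda>z. L (F (r (s n))) z - h z)) \<longlonglongrightarrow> 0"
      using tendsto_add[OF gl' hl] by simp
    have "(\<lambda>n. \<N> (\<lambda>z. K (F (r (s n))) z + L (F (r (s n))) z - (g z + h z))) \<longlonglongrightarrow> 0"
      by (rule real_tendsto_sandwich[OF _ _ tendsto_const lim]) (simp_all add: le)
    then show "(\<lambda>n. \<N> (\<lambda>z. K (F ((r \<circ> s) n)) z + L (F ((r \<circ> s) n)) z - (g z + h z))) \<longlonglongrightarrow> 0"
      by simp
  qed
qed

lemma compact_sum:
  assumes "finite A" "\<And>i. i \<in> A \<Longrightarrow> fock_compact \<alpha> m (K i)"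
  shows "fock_compact \<alpha> m (\<lambda>f z. \<Sum>i\<in>A. K i f z)"
  using assms
proof (induction rule: finite_induct)
  case (insert x A)
  then show ?case using compact_add[of "K x" "\<lambda>f z. \<Sum>i\<in>A. K i f z"] by simp
qed (simp add: compact_zero)

text \<open>The assumption \<open>orth\<close> is what remains of orthonormality. If the images of a subsequence under a
compact \<open>K\<close> converge to \<open>g\<close>, then the image of a sum of \<open>P\<close> terms is close to \<open>P * g\<close>, while its norm is
at most a constant times \<open>sqrt P\<close>. So \<open>g\<close> has norm zero.\<close>

lemma ess_norm_ge:
  fixes e :: "nat \<Rightarrow> complex \<Rightarrow> complex"
  assumes T: "fock_bounded \<alpha> m T"
    and e: "\<And>j. e j \<in> \<F>"
    and orth: "\<And>A. finite A \<Longrightarrow> (\<N> (\<lambda>z. \<Sum>i\<in>A. e i z))\<^sup>2 \<le> real (card A)"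
    and s: "\<And>j. s \<le> \<N> (T (e j))"
  shows "s \<le> fock_ess_norm \<alpha> m T"
  unfolding fock_ess_norm_def
proof (rule cINF_greatest)
  show "{K. fock_compact \<alpha> m K} \<noteq> {}" using compact_zero by blast
  fix K assume "K \<in> {K. fock_compact \<alpha> m K}"
  then have K: "fock_compact \<alpha> m K" by simp
  have lin: "fock_linear \<alpha> m T" "fock_linear \<alpha> m K" using T K by (auto simp: fock_bounded_def fock_compact_def)
  obtain B where B: "B > 0" "\<And>f. f \<in> \<F> \<Longrightarrow> \<N> (K f) \<le> B * \<N> f" using fock_compact_imp_bounded[OF K] by blast
  have e1: "\<N> (e j) \<le> 1" for j
  proof -
    have "(\<N> (e j))\<^sup>2 \<le> 1\<^sup>2" using orth[of "{j}"] by simp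
    then show ?thesis by (rule power2_le_imp_le) simp
  qed
  obtain g r where g: "g \<in> \<F>" and r: "strict_mono r"
    and lim: "(\<lambda>n. \<N> (\<lambda>z. K (e (r n)) z - g z)) \<longlonglongrightarrow> 0"
    using K e e1 unfolding fock_compact_def by blast
  have Ke: "K (e j) \<in> \<F>" for j by (rule fock_linear_mem[OF lin(2) e])
  have Ng: "\<N> g \<le> B / sqrt (real P) + 1 / real P" if P: "P \<ge> 1" for P
  proof -
    have "\<forall>\<^sub>F n in sequentially. \<N> (\<lambda>z. K (e (r n)) z - g z) < 1 / real P"
      using P by (intro order_tendstoD[OF lim]) simp
    then obtain J where J: "\<And>n. n \<ge> J \<Longrightarrow> \<N> (\<lambda>z. K (e (r n)) z - g z) < 1 / real P"
      by (auto simp: eventually_sequentially)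
    \<comment> \<open>\<open>P\<close> consecutive terms, all of whose images are within \<open>1 / P\<close> of \<open>g\<close>\<close>
    define I where "I = {J..<J + P}"
    have inj: "inj_on r I" using r by (meson inj_on_subset strict_mono_imp_inj_on subset_UNIV)
    define S where "S z = (\<Sum>i\<in>I. e (r i) z)" for z
    have S: "S \<in> \<F>" unfolding S_def[abs_def] using e by (intro fock_sum) (auto simp: I_def)
    have "(\<N> S)\<^sup>2 \<le> real P"
    proof -
      have "S = (\<lambda>z. \<Sum>i\<in>r ` I. e i z)" by (simp add: S_def[abs_def] sum.reindex[OF inj])
      then show ?thesis using orth[of "r ` I"] card_image[OF inj] by (simp add: I_def)
    qed
    then have NS: "\<N> S \<le> sqrt (real P)" by (rule real_le_rsqrt)
    have KS: "K S = (\<lambda>z. \<Sum>i\<in>I. K (e (r i)) z)"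
      unfolding S_def[abs_def] using e by (intro fock_linear_sum[OF lin(2)]) (auto simp: I_def)
    define D where "D z = (\<Sum>i\<in>I. K (e (r i)) z - g z)" for z
    have D: "D \<in> \<F>" "\<N> D \<le> (\<Sum>i\<in>I. \<N> (\<lambda>z. K (e (r i)) z - g z))"
      unfolding D_def[abs_def] using fock_sum[of I "\<lambda>i z. K (e (r i)) z - g z"] fock_diff(1)[OF Ke g]
      by (auto simp: I_def)
    have "(\<Sum>i\<in>I. \<N> (\<lambda>z. K (e (r i)) z - g z)) \<le> (\<Sum>i\<in>I. 1 / real P)"
      using J by (intro sum_mono less_imp_le) (auto simp: I_def)
    then have D1: "\<N> D \<le> 1" using D(2) P by (simp add: I_def)
    have "(\<lambda>z. of_nat P * g z) = (\<lambda>z. K S z - D z)"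
      by (simp add: KS D_def sum_subtractf I_def)
    then have "real P * \<N> g = \<N> (\<lambda>z. K S z - D z)"
      using fock_scale(2)[OF g, of "of_nat P"] by simp
    also have "\<dots> \<le> \<N> (K S) + \<N> D" by (intro fock_diff(2) fock_linear_mem[OF lin(2) S] D)
    also have "\<dots> \<le> B * sqrt (real P) + 1"
      using B(2)[OF S] mult_left_mono[OF NS less_imp_le[OF B(1)]] D1 by linarith
    finally have "\<N> g \<le> (B * sqrt (real P) + 1) / real P" using P by (simp add: field_simps)
    also have "\<dots> = B / sqrt (real P) + 1 / real P"
    proof -
      have "sqrt (real P) / real P = 1 / sqrt (real P)"
        using P by (simp add: divide_eq_eq real_div_sqrt)
      moreover have "(B * sqrt (real P) + 1) / real P = B * (sqrt (real P) / real P) + 1 / real P"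
        by (simp add: add_divide_distrib)
      ultimately show ?thesis by simp
    qed
    finally show ?thesis .
  qed
  have "\<N> g \<le> 0"
  proof (rule LIMSEQ_le_const)
    show "(\<lambda>P. B / sqrt (real P) + 1 / real P) \<longlonglongrightarrow> 0" by real_asymp
    show "\<exists>N. \<forall>n\<ge>N. \<N> g \<le> B / sqrt (real n) + 1 / real n" using Ng by blast
  qed
  have "s \<le> fock_onorm \<alpha> m (\<lambda>f z. T f z - K f z) + \<N> (\<lambda>z. K (e (r n)) z - g z)" for n
  proof -
    have "\<N> (T (e (r n))) - \<N> (K (e (r n))) \<le> \<N> (\<lambda>z. T (e (r n)) z - K (e (r n)) z)"
      by (intro fock_norm_diff_ge fock_linear_mem[OF lin(1)] e Ke)
    also have "\<dots> \<le> fock_onorm \<alpha> m (\<lambda>f z. T f z - K f z)"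
      by (intro onorm_diff_compact_upper T K e e1)
    finally show ?thesis
      using s[of "r n"] fock_norm_diff_ge[OF Ke g, of "r n"] \<open>\<N> g \<le> 0\<close> by linarith
  qed
  moreover have "(\<lambda>n. fock_onorm \<alpha> m (\<lambda>f z. T f z - K f z) + \<N> (\<lambda>z. K (e (r n)) z - g z)) \<longlonglongrightarrow> fock_onorm \<alpha> m (\<lambda>f z. T f z - K f z) + 0"
    by (intro tendsto_intros lim)
  ultimately show "s \<le> fock_onorm \<alpha> m (\<lambda>f z. T f z - K f z)"
    by (auto intro: LIMSEQ_le_const)
qed

lemma norm_power2_sum_disjoint_support:
  fixes d :: "'i \<Rightarrow> complex"
  assumes "finite A" "\<And>i j. i \<in> A \<Longrightarrow> j \<in> A \<Longrightarrow> i \<noteq> j \<Longrightarrow> d i = 0 \<or> d j = 0"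
  shows "(cmod (\<Sum>i\<in>A. d i))\<^sup>2 = (\<Sum>i\<in>A. (cmod (d i))\<^sup>2)"
proof (cases "\<exists>k\<in>A. d k \<noteq> 0")
  case True
  then obtain k where k: "k \<in> A" "d k \<noteq> 0" by blast
  then have "\<And>i. i \<in> A \<Longrightarrow> i \<noteq> k \<Longrightarrow> d i = 0" using assms(2) by blast
  then have "(\<Sum>i\<in>A. d i) = (\<Sum>i\<in>{k}. d i)" "(\<Sum>i\<in>A. (cmod (d i))\<^sup>2) = (\<Sum>i\<in>{k}. (cmod (d i))\<^sup>2)"
    using k assms(1) by (intro sum.mono_neutral_right; simp)+
  then show ?thesis by simp
qed simp

text \<open>Polynomials with disjoint sets of exponents are orthogonal, which is read off from the coefficients.\<close>

lemma block_sum_norm: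
  fixes d :: "nat \<Rightarrow> nat \<Rightarrow> complex"
  assumes A: "finite A"
    and p: "strict_mono p"
    and supp: "\<And>i n. d i n \<noteq> 0 \<Longrightarrow> p i \<le> n \<and> n < p (Suc i)"
    and norm1: "\<And>i. (\<Sum>n<p (Suc i). (cmod (d i n))\<^sup>2 * \<omega> n) = 1"
  shows "(\<lambda>z. \<Sum>i\<in>A. \<Sum>n<p (Suc i). d i n * z ^ n) \<in> \<F>"
    and "(\<N> (\<lambda>z. \<Sum>i\<in>A. \<Sum>n<p (Suc i). d i n * z ^ n))\<^sup>2 = card A"
proof -
  define M where "M = Max (insert 0 ((\<lambda>i. p (Suc i)) ` A))"
  have M: "p (Suc i) \<le> M" if "i \<in> A" for i
    unfolding M_def using A that by (intro Max_ge) auto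
  have d0: "d i n = 0" if "p (Suc i) \<le> n" for i n
    using supp[of i n] that by force
  have ext: "(\<Sum>n<p (Suc i). d i n * u n) = (\<Sum>n<M. d i n * u n)" if "i \<in> A" for i and u :: "nat \<Rightarrow> complex"
    using M[OF that] d0 by (intro sum.mono_neutral_left) auto
  have ext2: "(\<Sum>n<p (Suc i). (cmod (d i n))\<^sup>2 * \<omega> n) = (\<Sum>n<M. (cmod (d i n))\<^sup>2 * \<omega> n)" if "i \<in> A" for i
    using M[OF that] d0 by (intro sum.mono_neutral_left) auto
  define a where "a n = (\<Sum>i\<in>A. d i n)" for n
  have a0: "a n = 0" if "n \<ge> M" for n
    unfolding a_def using M d0 that by (intro sum.neutral ballI) (meson le_trans)
  have eq: "(\<Sum>i\<in>A. \<Sum>n<p (Suc i). d i n * z ^ n) = (\<Sum>n<M. a n * z ^ n)" for z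
  proof -
    have "(\<Sum>i\<in>A. \<Sum>n<p (Suc i). d i n * z ^ n) = (\<Sum>i\<in>A. \<Sum>n<M. d i n * z ^ n)"
      by (intro sum.cong ext refl)
    also have "\<dots> = (\<Sum>n<M. \<Sum>i\<in>A. d i n * z ^ n)" by (rule sum.swap)
    finally show ?thesis by (simp add: a_def sum_distrib_right)
  qed
  have ser: "(\<lambda>n. a n * z ^ n) sums (\<Sum>i\<in>A. \<Sum>n<p (Suc i). d i n * z ^ n)" for z
    unfolding eq by (rule finite_power_series_sums) (rule a0)
  have fin: "(\<lambda>n. (cmod (a n))\<^sup>2 * \<omega> n) sums (\<Sum>n<M. (cmod (a n))\<^sup>2 * \<omega> n)"
    using a0 by (intro sums_finite) (auto simp: not_less)
  show mem: "(\<lambda>z. \<Sum>i\<in>A. \<Sum>n<p (Suc i). d i n * z ^ n) \<in> \<F>"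
    using fock_series(1)[OF ser] sums_summable[OF fin] by simp
  have dis: "d i n = 0 \<or> d j n = 0" if "i \<noteq> j" for i j n
  proof (rule ccontr)
    assume "\<not> ?thesis"
    then have 1: "p i \<le> n" "n < p (Suc i)" "p j \<le> n" "n < p (Suc j)" using supp by auto
    have "p (Suc i) \<le> p j" if "i < j" for i j using p that by (simp add: strict_mono_less_eq Suc_leI)
    then show False using 1 \<open>i \<noteq> j\<close> by (metis leD le_less_trans linorder_neqE_nat)
  qed
  have "(\<N> (\<lambda>z. \<Sum>i\<in>A. \<Sum>n<p (Suc i). d i n * z ^ n))\<^sup>2 = (\<Sum>n<M. (cmod (a n))\<^sup>2 * \<omega> n)"
    by (rule sums_unique2[OF fock_series(2)[OF ser mem] fin])
  also have "\<dots> = (\<Sum>n<M. \<Sum>i\<in>A. (cmod (d i n))\<^sup>2 * \<omega> n)"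
    unfolding a_def by (intro sum.cong refl, subst norm_power2_sum_disjoint_support[OF A])
      (use dis in \<open>auto simp: sum_distrib_right\<close>)
  also have "\<dots> = (\<Sum>i\<in>A. \<Sum>n<M. (cmod (d i n))\<^sup>2 * \<omega> n)" by (rule sum.swap)
  also have "\<dots> = (\<Sum>i\<in>A. 1)" by (intro sum.cong refl) (simp add: ext2[symmetric] norm1)
  finally show "(\<N> (\<lambda>z. \<Sum>i\<in>A. \<Sum>n<p (Suc i). d i n * z ^ n))\<^sup>2 = card A" by simp
qed

text \<open>Starting each block of exponents where the previous one ends gives an orthonormal sequence of test
polynomials, to which \<open>ess_norm_ge\<close> applies.\<close>

lemma ess_norm_ge_blocks:
  assumes T: "fock_bounded \<alpha> m T"
    and blocks: "\<And>P. \<exists>Q>P. \<exists>c. (\<forall>n. c n \<noteq> 0 \<longrightarrow> P \<le> n \<and> n < Q) \<and> (\<Sum>n<Q. (cmod (c n))\<^sup>2 * \<omega> n) = 1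
        \<and> s \<le> \<N> (T (\<lambda>z. \<Sum>n<Q. c n * z ^ n))"
  shows "s \<le> fock_ess_norm \<alpha> m T"
proof -
  define R where "R P Q c \<longleftrightarrow> P < Q \<and> (\<forall>n. c n \<noteq> 0 \<longrightarrow> P \<le> n \<and> n < Q) \<and>
      (\<Sum>n<Q. (cmod (c n))\<^sup>2 * \<omega> n) = 1 \<and> s \<le> \<N> (T (\<lambda>z. \<Sum>n<Q. c n * z ^ n))"
    for P Q :: nat and c :: "nat \<Rightarrow> complex"
  have "\<forall>P. \<exists>Q c. R P Q c" using blocks unfolding R_def by blast
  then obtain Q where "\<forall>P. \<exists>c. R P (Q P) c" by (rule choice[THEN exE])
  then obtain c where "\<forall>P. R P (Q P) (c P)" by (rule choice[THEN exE])
  then have Q: "Q P > P" and c: "c P n \<noteq> 0 \<Longrightarrow> P \<le> n \<and> n < Q P"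
     "(\<Sum>n<Q P. (cmod (c P n))\<^sup>2 * \<omega> n) = 1" "s \<le> \<N> (T (\<lambda>z. \<Sum>n<Q P. c P n * z ^ n))" for P n
    unfolding R_def by blast+
  \<comment> \<open>the block with number \<open>j\<close> uses the exponents from \<open>p j\<close> up to \<open>p (Suc j) - 1\<close>\<close>
  define p where "p j = (Q ^^ j) 0" for j
  have p: "p (Suc j) = Q (p j)" for j by (simp add: p_def)
  have mono: "strict_mono p" by (rule strict_mono_Suc_iff[THEN iffD2]) (simp add: p Q)
  define e where "e j z = (\<Sum>n<p (Suc j). c (p j) n * z ^ n)" for j z
  note bl = block_sum_norm[of _ p "\<lambda>i. c (p i)", OF _ mono]
  show ?thesis
  proof (rule ess_norm_ge[OF T, of e])
    show "e j \<in> \<F>" for j using bl(1)[of "{j}"] c by (simp add: e_def[abs_def] p)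
    show "(\<N> (\<lambda>z. \<Sum>i\<in>A. e i z))\<^sup>2 \<le> real (card A)" if "finite A" for A
      using bl(2)[OF that] c by (simp add: e_def p)
    show "s \<le> \<N> (T (e j))" for j using c(3)[of "p j"] by (simp add: e_def[abs_def] p)
  qed
qed

end

section \<open>Two-sided estimates\<close>

context fock_parameters begin

lemma kernel_ge_partial_sum:
  assumes "r \<ge> 0" "finite A"
  shows "(\<Sum>n\<in>A. r ^ (2 * n) / \<omega> n) \<le> fock_kernel \<alpha> m r"
  unfolding fock_kernel_def using assms by (intro sum_le_suminf summable_kernel) auto

lemma kernel_pos: "r \<ge> 0 \<Longrightarrow> fock_kernel \<alpha> m r > 0"
  using kernel_ge_partial_sum[of r "{0}"] by (simp add: omega_0)

text \<open>The sum on the left is a polynomial of degree less than \<open>2 * P\<close>, and the kernel is at least a multiple of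
\<open>r ^ (2 * P)\<close>.\<close>

lemma kernel_head_le_half:
  "\<forall>\<^sub>F r in at_top. (\<Sum>n<P. r ^ (2 * n) / \<omega> n) \<le> fock_kernel \<alpha> m r / 2"
proof -
  define S where "S = (\<Sum>n<P. 1 / \<omega> n) + 1"
  have S: "S > 0" unfolding S_def by (intro add_nonneg_pos sum_nonneg) auto
  have "\<forall>\<^sub>F r::real in at_top. r \<ge> 1 \<and> r \<ge> 2 * \<omega> P * S"
    by (intro eventually_conj eventually_ge_at_top)
  then show ?thesis
  proof eventually_elim
    case (elim r)
    define H where "H = (\<Sum>n<P. r ^ (2 * n) / \<omega> n)"
    have H: "H \<ge> 0" unfolding H_def using elim by (intro sum_nonneg) auto
    have "r\<^sup>2 * H = (\<Sum>n<P. r ^ (2 * n + 2) / \<omega> n)"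
      by (simp add: H_def sum_distrib_left power2_eq_square mult_ac)
    also have "\<dots> \<le> (\<Sum>n<P. r ^ (2 * P) * (1 / \<omega> n))"
    proof (rule sum_mono)
      fix n assume "n \<in> {..<P}"
      then have "r ^ (2 * n + 2) \<le> r ^ (2 * P)" using elim by (intro power_increasing) auto
      then show "r ^ (2 * n + 2) / \<omega> n \<le> r ^ (2 * P) * (1 / \<omega> n)"
        by (simp add: divide_right_mono)
    qed
    also have "\<dots> \<le> r ^ (2 * P) * S"
      unfolding sum_distrib_left[symmetric] S_def using elim by (intro mult_left_mono) auto
    finally have 1: "r\<^sup>2 * H \<le> r ^ (2 * P) * S" .
    have "r * 1 \<le> r * r" using elim by (intro mult_left_mono) auto
    then have "2 * \<omega> P * S \<le> r\<^sup>2" using elim unfolding power2_eq_square by linarith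
    then have "2 * \<omega> P * S * H \<le> r\<^sup>2 * H" using H by (rule mult_right_mono)
    with 1 have "S * (2 * \<omega> P * H) \<le> S * r ^ (2 * P)" by (simp add: mult_ac)
    then have "2 * \<omega> P * H \<le> r ^ (2 * P)" using S by simp
    then have "2 * H \<le> r ^ (2 * P) / \<omega> P" using omega_pos[of P] by (simp add: field_simps)
    also have "\<dots> \<le> fock_kernel \<alpha> m r" using kernel_ge_partial_sum[of r "{P}"] elim by simp
    finally show ?case by (simp add: H_def)
  qed
qed

text \<open>The coefficients are those of the reproducing kernel at \<open>w\<close>, restricted to exponents between \<open>P\<close>
and \<open>Q\<close> and normalised; the value at \<open>w\<close> is then the square root of the truncated kernel. Little is
lost at the lower end by assumption and at the upper end by choosing \<open>Q\<close> large.\<close>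

lemma truncated_kernel_block:
  assumes head: "(\<Sum>n<P. cmod w ^ (2 * n) / \<omega> n) \<le> fock_kernel \<alpha> m (cmod w) / 2"
  shows "\<exists>Q>P. \<exists>c. (\<forall>n. c n \<noteq> 0 \<longrightarrow> P \<le> n \<and> n < Q) \<and> (\<Sum>n<Q. (cmod (c n))\<^sup>2 * \<omega> n) = 1
     \<and> fock_kernel \<alpha> m (cmod w) / 4 \<le> (cmod (\<Sum>n<Q. c n * w ^ n))\<^sup>2"
proof -
  define r where "r = cmod w"
  define K where "K = fock_kernel \<alpha> m r"
  have K: "K > 0" unfolding K_def r_def by (intro kernel_pos) simp
  have "(\<lambda>Q. \<Sum>n<Q. r ^ (2 * n) / \<omega> n) \<longlonglongrightarrow> K"
    unfolding K_def fock_kernel_def by (intro summable_LIMSEQ summable_kernel) (simp add: r_def)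
  then have "\<forall>\<^sub>F Q in sequentially. 3/4 * K < (\<Sum>n<Q. r ^ (2 * n) / \<omega> n)"
    using K by (intro order_tendstoD) auto
  then have "\<forall>\<^sub>F Q in sequentially. 3/4 * K < (\<Sum>n<Q. r ^ (2 * n) / \<omega> n) \<and> P < Q"
    using eventually_gt_at_top by (rule eventually_conj)
  then obtain Q where Q: "3/4 * K < (\<Sum>n<Q. r ^ (2 * n) / \<omega> n)" "P < Q"
    by (auto simp: eventually_sequentially)
  define S where "S = (\<Sum>n\<in>{P..<Q}. r ^ (2 * n) / \<omega> n)"
  have "(\<Sum>n<Q. r ^ (2 * n) / \<omega> n) = (\<Sum>n<P. r ^ (2 * n) / \<omega> n) + S"
    unfolding S_def using Q(2) by (simp add: lessThan_atLeast0 sum.atLeastLessThan_concat)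
  then have S: "S \<ge> K / 4" using Q(1) head by (simp add: K_def r_def)
  then have Spos: "S > 0" using K by linarith
  define c where "c n = (if P \<le> n \<and> n < Q then cnj w ^ n / of_real (\<omega> n * sqrt S) else 0)" for n
  have c2: "(cmod (c n))\<^sup>2 * \<omega> n = r ^ (2 * n) / \<omega> n / S" if "n \<in> {P..<Q}" for n
  proof -
    have "cmod (c n) = r ^ n / (\<omega> n * sqrt S)"
      using that Spos by (simp add: c_def r_def norm_divide norm_power norm_mult)
    then have "(cmod (c n))\<^sup>2 = r ^ (2 * n) / ((\<omega> n)\<^sup>2 * S)"
      using Spos by (simp add: power_divide power_mult_distrib power_mult[symmetric] mult.commute)
    then show ?thesis using omega_pos[of n] Spos by (simp add: power2_eq_square field_simps)
  qed
  have "(\<Sum>n<Q. (cmod (c n))\<^sup>2 * \<omega> n) = (\<Sum>n\<in>{P..<Q}. (cmod (c n))\<^sup>2 * \<omega> n)"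
    by (intro sum.mono_neutral_right) (auto simp: c_def)
  also have "\<dots> = S / S"
    unfolding S_def sum_divide_distrib by (intro sum.cong refl) (simp add: c2 S_def)
  finally have n1: "(\<Sum>n<Q. (cmod (c n))\<^sup>2 * \<omega> n) = 1" using Spos by simp
  have cw: "c n * w ^ n = of_real (r ^ (2 * n) / \<omega> n / sqrt S)" if "n \<in> {P..<Q}" for n
  proof -
    have "cnj w ^ n * w ^ n = (w * cnj w) ^ n" by (simp add: power_mult_distrib mult.commute)
    also have "\<dots> = of_real (r ^ (2 * n))"
      by (simp only: complex_norm_square[symmetric] r_def[symmetric] of_real_power[symmetric] power_mult)
    finally have "cnj w ^ n * w ^ n = of_real (r ^ (2 * n))" .
    then show ?thesis using that by (simp add: c_def)
  qed
  have "(\<Sum>n<Q. c n * w ^ n) = (\<Sum>n\<in>{P..<Q}. c n * w ^ n)"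
    by (intro sum.mono_neutral_right) (auto simp: c_def)
  also have "\<dots> = (\<Sum>n\<in>{P..<Q}. of_real (r ^ (2 * n) / \<omega> n / sqrt S))"
    by (intro sum.cong refl cw)
  also have "\<dots> = of_real (S / sqrt S)" by (simp only: S_def of_real_sum sum_divide_distrib)
  finally have "(cmod (\<Sum>n<Q. c n * w ^ n))\<^sup>2 = S"
    using Spos by (simp add: real_div_sqrt)
  then show ?thesis
    using Q(2) n1 S by (intro exI[of _ Q] conjI exI[of _ c]) (auto simp: c_def K_def r_def)
qed

lemma affine_at_infinity:
  assumes "a \<noteq> 0"
  shows "filterlim (\<lambda>z. cmod (a * z + b)) at_top at_infinity"
proof (rule filterlim_at_top_mono)
  show "filterlim (\<lambda>z. - cmod b + cmod a * cmod z) at_top at_infinity"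
    using assms by (intro filterlim_tendsto_add_at_top[OF tendsto_const] filterlim_tendsto_pos_mult_at_top[OF tendsto_const _ filterlim_norm_at_top]) auto
  show "\<forall>\<^sub>F z in at_infinity. - cmod b + cmod a * cmod z \<le> cmod (a * z + b)"
  proof (intro always_eventually allI)
    fix z show "- cmod b + cmod a * cmod z \<le> cmod (a * z + b)"
      using norm_triangle_ineq2[of "a * z" "- b"] by (simp add: norm_mult)
  qed
qed

text \<open>The factors \<open>r powr (m - 2)\<close> in the size of the kernel are comparable at \<open>z\<close> and at \<open>a * z + b\<close>, because
the quotient of the two moduli tends to \<open>cmod a\<close>.\<close>

lemma kernel_ratio_affine:
  assumes a: "a \<noteq> 0"
  shows "\<exists>k>0. \<forall>\<^sub>F z in at_infinity.
     k * exp (\<alpha> * (cmod (a * z + b) powr m - cmod z powr m)) * fock_kernel \<alpha> m (cmod z) \<le> fock_kernel \<alpha> m (cmod (a * z + b))"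
proof -
  obtain c C where c: "c > 0" "C > 0" and lo: "\<And>r. r > 0 \<Longrightarrow> \<alpha> * r powr m \<ge> 1 \<Longrightarrow>
       c * ((\<alpha> * r powr m) powr (1 - 2 / m) * exp (\<alpha> * r powr m)) \<le> fock_kernel \<alpha> m r"
    and up: "\<And>r. r > 0 \<Longrightarrow> \<alpha> * r powr m \<ge> 1 \<Longrightarrow>
       fock_kernel \<alpha> m r \<le> C * ((\<alpha> * r powr m) powr (1 - 2 / m) * exp (\<alpha> * r powr m))"
    using fock_kernel_asymp[OF alpha_pos m_pos] by blast
  define s where "s = m - 2"
  define q where "q = cmod a powr s / 2"
  have q: "q > 0" using a by (simp add: q_def)
  have lim: "((\<lambda>z. cmod (a + b * inverse z) powr s) \<longlongrightarrow> cmod (a + b * 0) powr s) at_infinity"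
    using a by (intro tendsto_intros tendsto_inverse_0) auto
  have e1: "\<forall>\<^sub>F z in at_infinity. q < cmod (a + b * inverse z) powr s"
    using a by (intro order_tendstoD(1)[OF lim]) (simp add: q_def)
  have nz: "filterlim cmod at_top at_infinity" by (rule filterlim_norm_at_top)
  define R where "R = (1 / \<alpha>) powr (1 / m) + 1"
  have R: "r > 0 \<and> \<alpha> * r powr m \<ge> 1" if "r \<ge> R" for r
  proof -
    have "(1 / \<alpha>) powr (1 / m) \<ge> 0" by simp
    then have r: "r > 0" "(1 / \<alpha>) powr (1 / m) \<le> r" using that unfolding R_def by linarith+
    have "1 = \<alpha> * ((1 / \<alpha>) powr (1 / m)) powr m" using alpha_pos m_pos by (simp add: powr_powr)
    also have "\<dots> \<le> \<alpha> * r powr m"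
      using alpha_pos m_pos r by (intro mult_left_mono powr_mono2) auto
    finally show ?thesis using r by simp
  qed
  have e2: "\<forall>\<^sub>F z in at_infinity. R \<le> cmod z" using nz by (simp add: filterlim_at_top)
  have e3: "\<forall>\<^sub>F z in at_infinity. R \<le> cmod (a * z + b)" using affine_at_infinity[OF a, of b] by (simp add: filterlim_at_top)
  have "\<forall>\<^sub>F z in at_infinity. c / C * q * exp (\<alpha> * (cmod (a * z + b) powr m - cmod z powr m)) * fock_kernel \<alpha> m (cmod z) \<le> fock_kernel \<alpha> m (cmod (a * z + b))"
    using e1 e2 e3
  proof eventually_elim
    case (elim z)
    define r where "r = cmod z"
    define t where "t = cmod (a * z + b)"
    have r: "r > 0" "\<alpha> * r powr m \<ge> 1" using R[of r] elim by (auto simp: r_def)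
    have t: "t > 0" "\<alpha> * t powr m \<ge> 1" using R[of t] elim by (auto simp: t_def)
    have e: "exp (\<alpha> * (t powr m - r powr m)) * exp (\<alpha> * r powr m) = exp (\<alpha> * t powr m)"
      by (simp add: exp_add[symmetric] algebra_simps)
    have pw: "(\<alpha> * x powr m) powr (1 - 2 / m) = \<alpha> powr (1 - 2 / m) * x powr s" if "x > 0" for x
    proof -
      have "m * (1 - 2 / m) = s" using m_pos by (simp add: s_def field_simps)
      then show ?thesis using that alpha_pos by (simp add: powr_mult powr_powr)
    qed
    have "cmod (a + b * inverse z) = t / r"
    proof -
      have "a + b * inverse z = (a * z + b) / z" using r by (auto simp: r_def field_simps)
      then show ?thesis by (simp add: t_def r_def norm_divide)
    qed
    then have "q < t powr s / r powr s" using elim(1) r t by (simp add: powr_divide)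
    then have qt: "q * r powr s \<le> t powr s" using r by (simp add: field_simps)
    have "c / C * q * exp (\<alpha> * (t powr m - r powr m)) * fock_kernel \<alpha> m r
      \<le> c / C * q * exp (\<alpha> * (t powr m - r powr m)) * (C * ((\<alpha> * r powr m) powr (1 - 2 / m) * exp (\<alpha> * r powr m)))"
      using c q up[OF r] by (intro mult_left_mono) auto
    also have "\<dots> = c * \<alpha> powr (1 - 2 / m) * (q * r powr s) * (exp (\<alpha> * (t powr m - r powr m)) * exp (\<alpha> * r powr m))"
      using c by (simp add: pw[OF r(1)])
    also have "\<dots> \<le> c * \<alpha> powr (1 - 2 / m) * (t powr s) * (exp (\<alpha> * (t powr m - r powr m)) * exp (\<alpha> * r powr m))"
      using c qt by (intro mult_right_mono mult_left_mono) auto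
    also have "\<dots> = c * ((\<alpha> * t powr m) powr (1 - 2 / m) * exp (\<alpha> * t powr m))"
      unfolding e by (simp add: pw[OF t(1)])
    also have "\<dots> \<le> fock_kernel \<alpha> m t" by (rule lo[OF t])
    finally show ?case by (simp add: r_def t_def)
  qed
  then show ?thesis using c q by (intro exI[of _ "c / C * q"] conjI) auto
qed

text \<open>The truncated kernel at \<open>a * z + b\<close> is a unit vector with large value there; the point evaluation at \<open>z\<close>
then bounds the norm of its image from below.\<close>

lemma ess_norm_lower_bound:
  assumes a: "a \<noteq> 0" and k: "k > 0"
    and ratio: "\<forall>\<^sub>F z in at_infinity.
       k * exp (\<alpha> * (cmod (a * z + b) powr m - cmod z powr m)) * fock_kernel \<alpha> m (cmod z) \<le> fock_kernel \<alpha> m (cmod (a * z + b))"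
    and T: "fock_bounded \<alpha> m (weighted_comp \<psi> (\<lambda>z. a * z + b))"
    and L: "L \<ge> 0" "\<exists>\<^sub>F z in at_infinity. L < (cmod (\<psi> z))\<^sup>2 * exp (\<alpha> * (cmod (a * z + b) powr m - cmod z powr m))"
  shows "k / 4 * L \<le> (fock_ess_norm \<alpha> m (weighted_comp \<psi> (\<lambda>z. a * z + b)))\<^sup>2"
proof -
  let ?T = "weighted_comp \<psi> (\<lambda>z. a * z + b)"
  have "sqrt (k / 4 * L) \<le> fock_ess_norm \<alpha> m ?T"
  proof (rule ess_norm_ge_blocks[OF T])
    fix P
    have "\<forall>\<^sub>F z in at_infinity. (\<Sum>n<P. cmod (a * z + b) ^ (2 * n) / \<omega> n) \<le> fock_kernel \<alpha> m (cmod (a * z + b)) / 2"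
      by (rule eventually_compose_filterlim[OF kernel_head_le_half affine_at_infinity[OF a, of b]])
    then have "\<exists>\<^sub>F z in at_infinity. L < (cmod (\<psi> z))\<^sup>2 * exp (\<alpha> * (cmod (a * z + b) powr m - cmod z powr m)) \<and>
        ((\<Sum>n<P. cmod (a * z + b) ^ (2 * n) / \<omega> n) \<le> fock_kernel \<alpha> m (cmod (a * z + b)) / 2 \<and>
         k * exp (\<alpha> * (cmod (a * z + b) powr m - cmod z powr m)) * fock_kernel \<alpha> m (cmod z) \<le> fock_kernel \<alpha> m (cmod (a * z + b)))"
      using ratio by (intro frequently_eventually_frequently[OF L(2)] eventually_conj)
    then obtain z where z: "L < (cmod (\<psi> z))\<^sup>2 * exp (\<alpha> * (cmod (a * z + b) powr m - cmod z powr m))"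
        "(\<Sum>n<P. cmod (a * z + b) ^ (2 * n) / \<omega> n) \<le> fock_kernel \<alpha> m (cmod (a * z + b)) / 2"
        "k * exp (\<alpha> * (cmod (a * z + b) powr m - cmod z powr m)) * fock_kernel \<alpha> m (cmod z) \<le> fock_kernel \<alpha> m (cmod (a * z + b))"
      by (auto dest!: frequently_ex)
    define w where "w = a * z + b"
    define E where "E = exp (\<alpha> * (cmod w powr m - cmod z powr m))"
    obtain Q c where Q: "Q > P" and c: "\<And>n. c n \<noteq> 0 \<Longrightarrow> P \<le> n \<and> n < Q" "(\<Sum>n<Q. (cmod (c n))\<^sup>2 * \<omega> n) = 1"
      and cw: "fock_kernel \<alpha> m (cmod w) / 4 \<le> (cmod (\<Sum>n<Q. c n * w ^ n))\<^sup>2"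
      using truncated_kernel_block[OF z(2)] unfolding w_def by blast
    define f where "f u = (\<Sum>n<Q. c n * u ^ n)" for u
    have f: "f \<in> \<F>" unfolding f_def[abs_def] by (intro fock_sum fock_scale(1) power_fock) auto
    have K: "fock_kernel \<alpha> m (cmod z) > 0" by (intro kernel_pos) simp
    have "k / 4 * L * fock_kernel \<alpha> m (cmod z) \<le> k / 4 * ((cmod (\<psi> z))\<^sup>2 * E) * fock_kernel \<alpha> m (cmod z)"
      using z(1) k K by (intro mult_right_mono mult_left_mono) (auto simp: E_def w_def)
    also have "\<dots> = (cmod (\<psi> z))\<^sup>2 * (k * E * fock_kernel \<alpha> m (cmod z) / 4)" by simp
    also have "\<dots> \<le> (cmod (\<psi> z))\<^sup>2 * (cmod (f w))\<^sup>2"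
      using z(3) cw by (intro mult_left_mono) (auto simp: E_def w_def f_def)
    also have "\<dots> = (cmod (?T f z))\<^sup>2"
      by (simp add: weighted_comp_def w_def norm_mult power_mult_distrib)
    also have "\<dots> \<le> fock_kernel \<alpha> m (cmod z) * (\<N> (?T f))\<^sup>2"
      by (rule point_evaluation[OF fock_bounded_mem[OF T f]])
    finally have "k / 4 * L \<le> (\<N> (?T f))\<^sup>2" using K by simp
    then have "sqrt (k / 4 * L) \<le> \<N> (?T f)" by (rule real_le_lsqrt[rotated]) (use k L in auto)
    then show "\<exists>Q>P. \<exists>c. (\<forall>n. c n \<noteq> 0 \<longrightarrow> P \<le> n \<and> n < Q) \<and> (\<Sum>n<Q. (cmod (c n))\<^sup>2 * \<omega> n) = 1 \<and>
          sqrt (k / 4 * L) \<le> \<N> (?T (\<lambda>z. \<Sum>n<Q. c n * z ^ n))"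
      using Q c unfolding f_def[abs_def] by blast
  qed
  then have "(sqrt (k / 4 * L))\<^sup>2 \<le> (fock_ess_norm \<alpha> m ?T)\<^sup>2" using k L by (intro power_mono) auto
  then show ?thesis using k L by simp
qed

lemma ess_norm_nonneg: "fock_bounded \<alpha> m T \<Longrightarrow> 0 \<le> fock_ess_norm \<alpha> m T"
  unfolding fock_ess_norm_def using compact_zero onorm_diff_compact_nonneg
  by (intro cINF_greatest) auto

text \<open>The compact operators are the compositions of the operator with Taylor truncation at degree \<open>M\<close>.\<close>

lemma ess_norm_upper_bound:
  assumes a: "a \<noteq> 0" and \<psi>: "\<psi> holomorphic_on UNIV"
    and T: "fock_bounded \<alpha> m (weighted_comp \<psi> (\<lambda>z. a * z + b))"
    and L: "L \<ge> 0" "\<forall>\<^sub>F z in at_infinity. (cmod (\<psi> z))\<^sup>2 * exp (\<alpha> * (cmod (a * z + b) powr m - cmod z powr m)) \<le> L"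
  shows "(fock_ess_norm \<alpha> m (weighted_comp \<psi> (\<lambda>z. a * z + b)))\<^sup>2 \<le> L / (cmod a)\<^sup>2"
proof -
  define T where "T = weighted_comp \<psi> (\<lambda>z. a * z + b)"
  note T' = \<open>fock_bounded \<alpha> m (weighted_comp \<psi> (\<lambda>z. a * z + b))\<close>[folded T_def]
  obtain \<rho> where \<rho>: "\<And>z. cmod z \<ge> \<rho> \<Longrightarrow> (cmod (\<psi> z))\<^sup>2 * exp (\<alpha> * (cmod (a * z + b) powr m - cmod z powr m)) \<le> L"
    using L(2) by (auto simp: eventually_at_infinity)
  have "compact (\<psi> ` cball 0 \<rho>)"
    using \<psi> by (intro compact_continuous_image holomorphic_on_imp_continuous_on) (auto intro: holomorphic_on_subset)
  then obtain B where B: "\<And>z. cmod z \<le> \<rho> \<Longrightarrow> cmod (\<psi> z) \<le> B"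
    using compact_imp_bounded bounded_iff by (metis (no_types, lifting) imageI mem_cball_0)
  define \<sigma> where "\<sigma> = cmod a * \<bar>\<rho>\<bar> + cmod b"
  have \<sigma>: "\<sigma> \<ge> 0" "\<And>z. cmod z \<le> \<rho> \<Longrightarrow> cmod (a * z + b) \<le> \<sigma>"
  proof -
    show "\<sigma> \<ge> 0" by (simp add: \<sigma>_def)
    fix z assume "cmod z \<le> \<rho>"
    then have "cmod a * cmod z \<le> cmod a * \<bar>\<rho>\<bar>" by (intro mult_left_mono) auto
    then show "cmod (a * z + b) \<le> \<sigma>"
      using norm_triangle_ineq[of "a * z" b] by (simp add: \<sigma>_def norm_mult)
  qed
  define c where "c = m * \<alpha> powr (2 / m) / (2 * pi * Gamma (2 / m))"
  have c: "c \<ge> 0" using m_pos by (simp add: c_def)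
  have bound: "(fock_ess_norm \<alpha> m T)\<^sup>2 \<le> B\<^sup>2 * kernel_tail M \<sigma> + L / (cmod a)\<^sup>2" for M
  proof -
    define b0 where "b0 = B\<^sup>2 * kernel_tail M \<sigma> + L / (cmod a)\<^sup>2"
    have b0: "b0 \<ge> 0" using kernel_tail_nonneg[OF \<sigma>(1)] L by (simp add: b0_def)
    define K where "K f z = (\<Sum>n<M. taylor_coeff f n * T (\<lambda>z. z ^ n) z)" for f z
    have K: "fock_compact \<alpha> m K"
      unfolding K_def[abs_def]
    proof (intro compact_sum compact_rank_one fock_bounded_mem[OF T'] power_fock)
      fix n f assume "f \<in> \<F>"
      then show "cmod (taylor_coeff f n) \<le> 1 / sqrt (\<omega> n) * \<N> f"
        using taylor_coeff_bound[of f n] omega_pos[of n] by (simp add: field_simps)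
    qed (auto simp: taylor_coeff_linear fock_holomorphic)
    have "fock_ess_norm \<alpha> m T \<le> sqrt b0"
    proof (rule ess_norm_le[OF T' K])
      fix f assume f: "f \<in> \<F>" "\<N> f \<le> 1"
      define R where "R z = f z - taylor_poly M f z" for z
      have R: "R \<in> \<F>" "\<N> R \<le> 1" "\<And>z. (cmod (R z))\<^sup>2 \<le> kernel_tail M (cmod z)"
      proof -
        show "R \<in> \<F>" "\<N> R \<le> 1" using taylor_remainder(1,2)[OF f(1), of M] f(2) by (auto simp: R_def[abs_def])
        fix z
        have "(cmod (R z))\<^sup>2 \<le> kernel_tail M (cmod z) * (\<N> f)\<^sup>2"
          using taylor_remainder(3)[OF f(1)] by (simp add: R_def)
        also have "\<dots> \<le> kernel_tail M (cmod z) * 1"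
          using f(2) by (intro mult_left_mono kernel_tail_nonneg) (auto simp: power_le_one)
        finally show "(cmod (R z))\<^sup>2 \<le> kernel_tail M (cmod z)" by simp
      qed
      note [measurable] = fock_borel[OF R(1)]
      define D where "D z = T f z - K f z" for z
      have D: "D z = \<psi> z * R (a * z + b)" for z
        by (simp add: D_def K_def T_def weighted_comp_def R_def taylor_poly_def algebra_simps sum_distrib_left)
      have DF: "D \<in> \<F>" unfolding D_def[abs_def]
        using K by (intro fock_diff(1) fock_bounded_mem[OF T' f(1)] fock_linear_mem[OF _ f(1)]) (simp add: fock_compact_def)
      note [measurable] = fock_borel[OF DF]
      have pt: "(cmod (D z))\<^sup>2 * (c * exp (- \<alpha> * cmod z powr m))
        \<le> B\<^sup>2 * kernel_tail M \<sigma> * (c * exp (- \<alpha> * cmod z powr m)) + L * ((cmod (R (a * z + b)))\<^sup>2 * (c * exp (- \<alpha> * cmod (a * z + b) powr m)))" for z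
      \<comment> \<open>inside the disc the Taylor remainder is small, outside it the weight is at most \<open>L\<close>\<close>
      proof (cases "cmod z \<le> \<rho>")
        case True
        have "(cmod (D z))\<^sup>2 \<le> B\<^sup>2 * kernel_tail M \<sigma>"
          unfolding D norm_mult power_mult_distrib
          using B[OF True] order.trans[OF R(3)[of "a * z + b"] kernel_tail_mono[OF _ \<sigma>(2)[OF True]]] kernel_tail_nonneg[OF \<sigma>(1)]
          by (intro mult_mono power_mono) auto
        then have "(cmod (D z))\<^sup>2 * (c * exp (- \<alpha> * cmod z powr m)) \<le> B\<^sup>2 * kernel_tail M \<sigma> * (c * exp (- \<alpha> * cmod z powr m))"
          using c by (intro mult_right_mono) auto
        moreover have "0 \<le> L * ((cmod (R (a * z + b)))\<^sup>2 * (c * exp (- \<alpha> * cmod (a * z + b) powr m)))" using L c by simp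
        ultimately show ?thesis by linarith
      next
        case False
        define X where "X = (cmod (R (a * z + b)))\<^sup>2 * (c * exp (- \<alpha> * cmod (a * z + b) powr m))"
        have X: "X \<ge> 0" using c by (simp add: X_def)
        have "exp (- \<alpha> * cmod z powr m) = exp (\<alpha> * (cmod (a * z + b) powr m - cmod z powr m)) * exp (- \<alpha> * cmod (a * z + b) powr m)"
          by (simp add: exp_add[symmetric] algebra_simps)
        then have "(cmod (D z))\<^sup>2 * (c * exp (- \<alpha> * cmod z powr m)) = ((cmod (\<psi> z))\<^sup>2 * exp (\<alpha> * (cmod (a * z + b) powr m - cmod z powr m))) * X"
          by (simp add: D X_def norm_mult power_mult_distrib)
        also have "\<dots> \<le> L * X" using \<rho>[of z] False X by (intro mult_right_mono) auto
        finally have "(cmod (D z))\<^sup>2 * (c * exp (- \<alpha> * cmod z powr m)) \<le> L * X" .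
        moreover have "0 \<le> B\<^sup>2 * kernel_tail M \<sigma> * (c * exp (- \<alpha> * cmod z powr m))"
          using kernel_tail_nonneg[OF \<sigma>(1)] c by simp
        ultimately show ?thesis by (simp add: X_def)
      qed
      have "(\<integral>\<^sup>+z. ennreal ((cmod (D z))\<^sup>2) \<partial>\<mu>) = (\<integral>\<^sup>+z. ennreal ((cmod (D z))\<^sup>2 * (c * exp (- \<alpha> * cmod z powr m))) \<partial>lborel)"
        using c by (subst nn_integral_fock_measure) (auto simp: m_pos alpha_pos c_def[symmetric] ennreal_mult)
      also have "\<dots> \<le> (\<integral>\<^sup>+z. ennreal (B\<^sup>2 * kernel_tail M \<sigma>) * (ennreal (cmod z ^ (2 * 0)) * ennreal (c * exp (- \<alpha> * cmod z powr m)))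
          + ennreal L * (ennreal ((cmod (R (a * z + b)))\<^sup>2) * ennreal (c * exp (- \<alpha> * cmod (a * z + b) powr m))) \<partial>lborel)"
      proof (intro nn_integral_mono)
        fix z
        show "ennreal ((cmod (D z))\<^sup>2 * (c * exp (- \<alpha> * cmod z powr m)))
          \<le> ennreal (B\<^sup>2 * kernel_tail M \<sigma>) * (ennreal (cmod z ^ (2 * 0)) * ennreal (c * exp (- \<alpha> * cmod z powr m)))
          + ennreal L * (ennreal ((cmod (R (a * z + b)))\<^sup>2) * ennreal (c * exp (- \<alpha> * cmod (a * z + b) powr m)))"
          using ennreal_leI[OF pt[of z]] c L kernel_tail_nonneg[OF \<sigma>(1)]
          by (simp add: ennreal_mult[symmetric] ennreal_plus[symmetric] del: ennreal_plus)
      qed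
      also have "\<dots> = ennreal (B\<^sup>2 * kernel_tail M \<sigma>) * (\<integral>\<^sup>+z. ennreal (cmod z ^ (2 * 0)) * ennreal (c * exp (- \<alpha> * cmod z powr m)) \<partial>lborel)
          + ennreal L * (\<integral>\<^sup>+z. ennreal ((cmod (R (a * z + b)))\<^sup>2) * ennreal (c * exp (- \<alpha> * cmod (a * z + b) powr m)) \<partial>lborel)"
        by (simp add: nn_integral_add nn_integral_cmult)
      also have "(\<integral>\<^sup>+z. ennreal (cmod z ^ (2 * 0)) * ennreal (c * exp (- \<alpha> * cmod z powr m)) \<partial>lborel) = 1"
        using nn_integral_norm_power_fock_measure[OF alpha_pos m_pos, of 0] unfolding c_def
        by (subst (asm) nn_integral_fock_measure) (auto simp: m_pos alpha_pos omega_0)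
      also have "(\<integral>\<^sup>+z. ennreal ((cmod (R (a * z + b)))\<^sup>2) * ennreal (c * exp (- \<alpha> * cmod (a * z + b) powr m)) \<partial>lborel)
         = ennreal (1 / (cmod a)\<^sup>2) * ennreal ((\<N> R)\<^sup>2)"
      proof -
        have "(\<integral>\<^sup>+z. ennreal ((cmod (R (a * z + b)))\<^sup>2) * ennreal (c * exp (- \<alpha> * cmod (a * z + b) powr m)) \<partial>lborel)
           = ennreal (1 / (cmod a)\<^sup>2) * (\<integral>\<^sup>+z. ennreal ((cmod (R z))\<^sup>2) * ennreal (c * exp (- \<alpha> * cmod z powr m)) \<partial>lborel)"
          by (rule nn_integral_lborel_complex_affine[OF a, of "\<lambda>z. ennreal ((cmod (R z))\<^sup>2) * ennreal (c * exp (- \<alpha> * cmod z powr m))"]) measurable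
        also have "(\<integral>\<^sup>+z. ennreal ((cmod (R z))\<^sup>2) * ennreal (c * exp (- \<alpha> * cmod z powr m)) \<partial>lborel) = ennreal ((\<N> R)\<^sup>2)"
          using nn_integral_fock[OF R(1)] unfolding c_def by (subst (asm) nn_integral_fock_measure) (auto simp: m_pos alpha_pos)
        finally show ?thesis .
      qed
      also have "ennreal (B\<^sup>2 * kernel_tail M \<sigma>) * 1 + ennreal L * (ennreal (1 / (cmod a)\<^sup>2) * ennreal ((\<N> R)\<^sup>2))
        = ennreal (B\<^sup>2 * kernel_tail M \<sigma> + L * (1 / (cmod a)\<^sup>2 * (\<N> R)\<^sup>2))"
        using L kernel_tail_nonneg[OF \<sigma>(1)] by (simp add: ennreal_mult[symmetric] ennreal_plus[symmetric] del: ennreal_plus)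
      also have "\<dots> \<le> ennreal b0"
      proof (rule ennreal_leI)
        have "1 / (cmod a)\<^sup>2 * (\<N> R)\<^sup>2 \<le> 1 / (cmod a)\<^sup>2 * 1"
          using R(2) by (intro mult_left_mono) (auto simp: power_le_one)
        then have "L * (1 / (cmod a)\<^sup>2 * (\<N> R)\<^sup>2) \<le> L * (1 / (cmod a)\<^sup>2 * 1)" using L(1) by (rule mult_left_mono)
        then show "B\<^sup>2 * kernel_tail M \<sigma> + L * (1 / (cmod a)\<^sup>2 * (\<N> R)\<^sup>2) \<le> b0" by (simp add: b0_def)
      qed
      finally have "(\<N> D)\<^sup>2 \<le> b0" by (rule fock_norm2_le[OF DF _ b0])
      then show "\<N> (\<lambda>z. T f z - K f z) \<le> sqrt b0" unfolding D_def[abs_def] by (rule real_le_rsqrt)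
    qed
    then have "(fock_ess_norm \<alpha> m T)\<^sup>2 \<le> (sqrt b0)\<^sup>2" by (intro power_mono ess_norm_nonneg[OF T'])
    then show ?thesis using b0 by (simp add: b0_def)
  qed
  have "(fock_ess_norm \<alpha> m T)\<^sup>2 \<le> B\<^sup>2 * 0 + L / (cmod a)\<^sup>2"
  proof (rule LIMSEQ_le_const)
    show "(\<lambda>M. B\<^sup>2 * kernel_tail M \<sigma> + L / (cmod a)\<^sup>2) \<longlonglongrightarrow> B\<^sup>2 * 0 + L / (cmod a)\<^sup>2"
      by (intro tendsto_intros kernel_tail_tendsto \<sigma>)
  qed (use bound in blast)
  then show ?thesis by (simp add: T_def)
qed

end

theorem theorem1p3:
  fixes \<alpha> m :: real and \<phi> :: "complex \<Rightarrow> complex"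
  assumes "m > 0" and "\<alpha> > 0"
    and "\<phi> holomorphic_on UNIV"
    and "\<not> \<phi> constant_on UNIV"
  shows "\<exists>c1>0. \<exists>c2>0. \<forall>\<psi> :: complex \<Rightarrow> complex.
           \<psi> holomorphic_on UNIV \<longrightarrow>
           fock_bounded \<alpha> m (weighted_comp \<psi> \<phi>) \<longrightarrow>
             ereal c1 * fock_limsup \<alpha> m \<psi> \<phi>
               \<le> ereal ((fock_ess_norm \<alpha> m (weighted_comp \<psi> \<phi>))\<^sup>2) \<and>
             ereal ((fock_ess_norm \<alpha> m (weighted_comp \<psi> \<phi>))\<^sup>2)
               \<le> ereal c2 * fock_limsup \<alpha> m \<psi> \<phi>"
proof -
  interpret fock_parameters \<alpha> m by unfold_locales (use assms in auto)
  have limsup_nonneg: "0 \<le> fock_limsup \<alpha> m \<psi> \<phi>" for \<psi>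
    unfolding fock_limsup_def by (intro le_Limsup trivial_limit_at_infinity always_eventually) auto
  show ?thesis
  proof (cases "\<exists>a b. a \<noteq> 0 \<and> \<phi> = (\<lambda>z. a * z + b)")
    case True
    then obtain a b where a: "a \<noteq> 0" and \<phi>: "\<phi> = (\<lambda>z. a * z + b)" by blast
    obtain k where k: "k > 0" and ratio: "\<forall>\<^sub>F z in at_infinity.
       k * exp (\<alpha> * (cmod (a * z + b) powr m - cmod z powr m)) * fock_kernel \<alpha> m (cmod z) \<le> fock_kernel \<alpha> m (cmod (a * z + b))"
      using kernel_ratio_affine[OF a] by blast
    have "ereal (k / 4) * fock_limsup \<alpha> m \<psi> \<phi> \<le> ereal ((fock_ess_norm \<alpha> m (weighted_comp \<psi> \<phi>))\<^sup>2) \<and>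
        ereal ((fock_ess_norm \<alpha> m (weighted_comp \<psi> \<phi>))\<^sup>2) \<le> ereal (1 / (cmod a)\<^sup>2) * fock_limsup \<alpha> m \<psi> \<phi>"
      if \<psi>: "\<psi> holomorphic_on UNIV" and bd: "fock_bounded \<alpha> m (weighted_comp \<psi> \<phi>)" for \<psi>
    proof
      define N where "N = (fock_ess_norm \<alpha> m (weighted_comp \<psi> \<phi>))\<^sup>2"
      define h where "h z = (cmod (\<psi> z))\<^sup>2 * exp (\<alpha> * (cmod (a * z + b) powr m - cmod z powr m))" for z
      have lim: "fock_limsup \<alpha> m \<psi> \<phi> = Limsup at_infinity (\<lambda>z. ereal (h z))"
        by (simp add: fock_limsup_def h_def \<phi>)
      have lower: "k / 4 * L \<le> N" if "L \<ge> 0" "\<exists>\<^sub>F z in at_infinity. L < h z" for L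
        using ess_norm_lower_bound[OF a k ratio bd[unfolded \<phi>] that[unfolded h_def]] by (simp add: N_def \<phi>)
      have upper: "N \<le> L / (cmod a)\<^sup>2" if "L \<ge> 0" "\<forall>\<^sub>F z in at_infinity. h z \<le> L" for L
        using ess_norm_upper_bound[OF a \<psi> bd[unfolded \<phi>] that[unfolded h_def]] by (simp add: N_def \<phi>)
      have "fock_limsup \<alpha> m \<psi> \<phi> \<le> ereal (N / (k / 4))"
      proof (rule ccontr)
        assume "\<not> ?thesis"
        then obtain L where L: "ereal (N / (k / 4)) < ereal L" "ereal L < fock_limsup \<alpha> m \<psi> \<phi>"
          using ereal_dense2 by (metis not_le)
        have "\<exists>\<^sub>F z in at_infinity. L < h z"
        proof (rule ccontr)
          assume "\<not> ?thesis"
          then have "\<forall>\<^sub>F z in at_infinity. ereal (h z) \<le> ereal L" by (simp add: not_frequently not_less)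
          then have "fock_limsup \<alpha> m \<psi> \<phi> \<le> ereal L" unfolding lim by (rule Limsup_bounded)
          then show False using L(2) by simp
        qed
        moreover have "N / (k / 4) \<ge> 0" using k by (simp add: N_def)
        then have "L \<ge> 0" using L(1) by simp
        ultimately have "k / 4 * L \<le> N" by (intro lower)
        then show False using L(1) k by (simp add: field_simps)
      qed
      then have "ereal (k / 4) * fock_limsup \<alpha> m \<psi> \<phi> \<le> ereal (k / 4) * ereal (N / (k / 4))"
        using k by (intro ereal_mult_left_mono) auto
      then show "ereal (k / 4) * fock_limsup \<alpha> m \<psi> \<phi> \<le> ereal ((fock_ess_norm \<alpha> m (weighted_comp \<psi> \<phi>))\<^sup>2)"
        using k by (simp add: N_def)
      show "ereal ((fock_ess_norm \<alpha> m (weighted_comp \<psi> \<phi>))\<^sup>2) \<le> ereal (1 / (cmod a)\<^sup>2) * fock_limsup \<alpha> m \<psi> \<phi>"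
      proof (cases "fock_limsup \<alpha> m \<psi> \<phi>")
        case (real l)
        then have l: "l \<ge> 0" using limsup_nonneg[of \<psi>] by simp
        have "N * (cmod a)\<^sup>2 \<le> l + e" if "e > 0" for e
        proof -
          have "Limsup at_infinity (\<lambda>z. ereal (h z)) < ereal (l + e)"
            using real that by (simp add: lim)
          then have "\<forall>\<^sub>F z in at_infinity. ereal (h z) < ereal (l + e)" by (rule Limsup_lessD)
          then have "\<forall>\<^sub>F z in at_infinity. h z \<le> l + e" by eventually_elim simp
          then show ?thesis using upper[of "l + e"] l that a by (simp add: field_simps)
        qed
        then have "N * (cmod a)\<^sup>2 \<le> l" by (rule field_le_epsilon)
        then show ?thesis using a by (simp add: real N_def field_simps)
      next
        case PInf
        then show ?thesis using a by simp
      next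
        case MInf
        then show ?thesis using limsup_nonneg[of \<psi>] by simp
      qed
    qed
    moreover have "k / 4 > 0" "1 / (cmod a)\<^sup>2 > 0" using k a by auto
    ultimately show ?thesis by blast
  next
    case False
    show ?thesis
    proof (intro exI[of _ 1] conjI allI impI)
      fix \<psi> :: "complex \<Rightarrow> complex"
      assume \<psi>: "\<psi> holomorphic_on UNIV" and bd: "fock_bounded \<alpha> m (weighted_comp \<psi> \<phi>)"
      have zero: "\<psi> z = 0" for z
      proof (rule ccontr)
        assume "\<psi> z \<noteq> 0"
        then have "inj \<phi>" using bounded_weighted_comp_imp_inj[OF bd \<psi> assms(3,4)] by blast
        then show False using injective_entire_imp_affine[OF assms(3)] False by (metis ext)
      qed
      have "fock_ess_norm \<alpha> m (weighted_comp \<psi> \<phi>) \<le> 0"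
        by (rule ess_norm_le[OF bd compact_zero]) (simp add: weighted_comp_def zero fock_zero)
      then have "fock_ess_norm \<alpha> m (weighted_comp \<psi> \<phi>) = 0" using ess_norm_nonneg[OF bd] by simp
      moreover have "fock_limsup \<alpha> m \<psi> \<phi> = 0"
        unfolding fock_limsup_def by (simp add: zero Limsup_const[OF trivial_limit_at_infinity])
      ultimately show "ereal 1 * fock_limsup \<alpha> m \<psi> \<phi> \<le> ereal ((fock_ess_norm \<alpha> m (weighted_comp \<psi> \<phi>))\<^sup>2)"
        "ereal ((fock_ess_norm \<alpha> m (weighted_comp \<psi> \<phi>))\<^sup>2) \<le> ereal 1 * fock_limsup \<alpha> m \<psi> \<phi>"
        by simp_all
    qed auto
  qed
qed

end
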